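(* Let $\Lambda=\mathbf{k}\mathcal{Q}/I$ be a finite dimensional algebra over an algebraically closed field $\mathbf{k}$. Let $x$ be a point in $\mathcal{Q}$ such that the corresponding simple $\Lambda$-module $S_x$ has finite projective dimension. If the neighborhood $\Lambda(x)$ is mild, then there is no loop at $x$ in $\mathcal{Q}$.
   Context: Here $\Lambda=\mathbf{k}\mathcal{Q}/I$ is a basic algebra presented by a finite quiver $\mathcal{Q}$ and an admissible ideal $I$ (in particular $I$ is generated by linear combinations of paths of length at least two). Modules are finite dimensional right modules. For a point $z$ of $\mathcal{Q}$, $e_z$ is the corresponding primitive idempotent, $S_z$ the corresponding simple module and $P_z=e_z\Lambda$ its projective cover; an arrow $a\to b$ lies in $e_a\Lambda e_b$. The neighborhood of $x$ is the algebra $\Lambda(x)=e\Lambda e$, where $e$ is the sum of all primitive idempotents $e_z$ such that $z$ belongs to the support of $P_x=e_x\Lambda$ (that is, $e_x\Lambda e_z\neq 0$), or there is an arrow $z\to x$ in $\mathcal{Q}$, or there is a configuration of arrows $y'\leftarrow x\rightleftarrows y\leftarrow z$ in $\mathcal{Q}$ with four different points $x,y,y',z$. An algebra is distributive if its lattice of two-sided ideals is distributive. It is mild if it is distributive and every proper quotient by a nonzero two-sided ideal is representation-finite. *)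

theory Defs
  imports
    "HOL-Computational_Algebra.Polynomial"
    "HOL-Library.Extended_Nat"
    "Graph_Theory.Arc_Walk"
    "HOL-Algebra.Module"
    "HOL-Algebra.QuotRing"
begin

section \<open>Path algebras\<close>

text \<open>
  A finite quiver is a \<^locale>\<open>fin_digraph\<close>: finitely many points and arrows, loops and
  multiple arrows allowed. A path is a pair \<open>(u, p)\<close> of its starting point and the list of its
  arrows, so that \<open>(u, [])\<close> is the trivial path at \<open>u\<close>. Paths are composed from left to right,
  whence an arrow from \<open>a\<close> to \<open>b\<close> lies in \<open>e\<^sub>a \<Lambda> e\<^sub>b\<close>.
\<close>

definition quiver_paths :: "('v, 'e) pre_digraph \<Rightarrow> ('v \<times> 'e list) set" where
  "quiver_paths Q = {(u, p). \<exists>v. pre_digraph.awalk Q u p v}"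

text \<open>
  Algebras over the field \<^typ>\<open>'k\<close> are given as records of type \<^typ>\<open>('k, 'a) module\<close>, of which
  \<open>smult\<close> is the scalar multiplication. An element of the path algebra is the finitely supported
  function giving the coefficient of every path; the coefficient at a path of a product is the sum
  over all ways to cut this path in two.
\<close>

definition path_algebra ::
    "('v, 'e) pre_digraph \<Rightarrow> ('k::field, 'v \<times> 'e list \<Rightarrow> 'k) module" where
  "path_algebra Q =
    \<lparr>carrier = {f. finite {r. f r \<noteq> 0} \<and> {r. f r \<noteq> 0} \<subseteq> quiver_paths Q},
     mult = (\<lambda>f g (u, p). \<Sum>i\<le>length p.
        f (u, take i p) * g (pre_digraph.awlast Q u (take i p), drop i p)),
     one = (\<lambda>(u, p). if u \<in> verts Q \<and> p = [] then 1 else 0),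
     zero = (\<lambda>r. 0),
     add = (\<lambda>f g r. f r + g r),
     smult = (\<lambda>c f r. c * f r)\<rparr>"

text \<open>The \<open>m\<close>-th power of the ideal generated by the arrows is spanned by the paths of length at
  least \<open>m\<close>.\<close>

definition arrow_ideal_power ::
    "('v, 'e) pre_digraph \<Rightarrow> nat \<Rightarrow> ('v \<times> 'e list \<Rightarrow> 'k::field) set" where
  "arrow_ideal_power Q m =
    {f \<in> carrier (path_algebra Q). \<forall>u p. f (u, p) \<noteq> 0 \<longrightarrow> m \<le> length p}"

definition admissible_ideal ::
    "('v, 'e) pre_digraph \<Rightarrow> ('v \<times> 'e list \<Rightarrow> 'k::field) set \<Rightarrow> bool" where
  "admissible_ideal Q I \<longleftrightarrow> ideal I (path_algebra Q) \<and>
    I \<subseteq> arrow_ideal_power Q 2 \<and> (\<exists>m\<ge>2. arrow_ideal_power Q m \<subseteq> I)"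


section \<open>Quotients and corners of algebras\<close>

definition quotient_algebra :: "('k, 'a) module \<Rightarrow> 'a set \<Rightarrow> ('k, 'a set) module" where
  "quotient_algebra A J =
    \<lparr>carrier = carrier (A Quot J),
     mult = mult (A Quot J),
     one = one (A Quot J),
     zero = zero (A Quot J),
     add = add (A Quot J),
     smult = (\<lambda>c X. \<Union>a\<in>X. J +>\<^bsub>A\<^esub> (c \<odot>\<^bsub>A\<^esub> a))\<rparr>"

text \<open>The algebra \<open>e A e\<close>, with unit \<open>e\<close>, for an idempotent \<open>e\<close>.\<close>

definition corner_algebra :: "('k, 'a) module \<Rightarrow> 'a \<Rightarrow> ('k, 'a) module" where
  "corner_algebra A e =
    A\<lparr>carrier := {e \<otimes>\<^bsub>A\<^esub> a \<otimes>\<^bsub>A\<^esub> e | a. a \<in> carrier A}, one := e\<rparr>"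


section \<open>Finite dimensional right modules\<close>

text \<open>
  The fields \<open>mult\<close> and \<open>one\<close> inherited from \<^typ>\<open>'m ring\<close> carry no meaning, as in the record
  \<open>module\<close> of HOL-Algebra.
\<close>

record ('a, 'm) right_module = "'m ring" +
  ract :: "'m \<Rightarrow> 'a \<Rightarrow> 'm" (infixl \<open>\<lhd>\<index>\<close> 70)

locale right_module = A?: ring A + M?: abelian_group M
  for A (structure) and M :: "('a, 'm) right_module" (structure) +
  assumes ract_closed: "m \<in> carrier M \<Longrightarrow> a \<in> carrier A \<Longrightarrow> m \<lhd>\<^bsub>M\<^esub> a \<in> carrier M"
    and ract_l_distr: "m \<in> carrier M \<Longrightarrow> n \<in> carrier M \<Longrightarrow> a \<in> carrier A \<Longrightarrow>
      (m \<oplus>\<^bsub>M\<^esub> n) \<lhd>\<^bsub>M\<^esub> a = (m \<lhd>\<^bsub>M\<^esub> a) \<oplus>\<^bsub>M\<^esub> (n \<lhd>\<^bsub>M\<^esub> a)"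
    and ract_r_distr: "m \<in> carrier M \<Longrightarrow> a \<in> carrier A \<Longrightarrow> b \<in> carrier A \<Longrightarrow>
      m \<lhd>\<^bsub>M\<^esub> (a \<oplus>\<^bsub>A\<^esub> b) = (m \<lhd>\<^bsub>M\<^esub> a) \<oplus>\<^bsub>M\<^esub> (m \<lhd>\<^bsub>M\<^esub> b)"
    and ract_assoc: "m \<in> carrier M \<Longrightarrow> a \<in> carrier A \<Longrightarrow> b \<in> carrier A \<Longrightarrow>
      m \<lhd>\<^bsub>M\<^esub> (a \<otimes>\<^bsub>A\<^esub> b) = (m \<lhd>\<^bsub>M\<^esub> a) \<lhd>\<^bsub>M\<^esub> b"
    and ract_one: "m \<in> carrier M \<Longrightarrow> m \<lhd>\<^bsub>M\<^esub> \<one>\<^bsub>A\<^esub> = m"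

text \<open>
  A module over an algebra is a vector space by letting the scalar \<open>c\<close> act as \<open>c \<cdot> 1\<close>; module
  homomorphisms are then automatically linear. Finite dimensional means to have a finite
  spanning set.
\<close>

definition fd_module :: "('k, 'a) module \<Rightarrow> ('a, 'm) right_module \<Rightarrow> bool" where
  "fd_module A M \<longleftrightarrow> right_module A M \<and>
    (\<exists>B. finite B \<and> B \<subseteq> carrier M \<and>
      (\<forall>m\<in>carrier M. \<exists>c :: 'm \<Rightarrow> 'k.
         m = (\<Oplus>\<^bsub>M\<^esub>b\<in>B. b \<lhd>\<^bsub>M\<^esub> (c b \<odot>\<^bsub>A\<^esub> \<one>\<^bsub>A\<^esub>))))"

definition module_hom ::
    "('k, 'a) module \<Rightarrow> ('a, 'm) right_module \<Rightarrow> ('a, 'n) right_module \<Rightarrow> ('m \<Rightarrow> 'n) set" where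
  "module_hom A M N = {f \<in> carrier M \<rightarrow> carrier N.
    (\<forall>m\<in>carrier M. \<forall>m'\<in>carrier M. f (m \<oplus>\<^bsub>M\<^esub> m') = f m \<oplus>\<^bsub>N\<^esub> f m') \<and>
    (\<forall>m\<in>carrier M. \<forall>a\<in>carrier A. f (m \<lhd>\<^bsub>M\<^esub> a) = f m \<lhd>\<^bsub>N\<^esub> a)}"

definition module_iso ::
    "('k, 'a) module \<Rightarrow> ('a, 'm) right_module \<Rightarrow> ('a, 'n) right_module \<Rightarrow> bool" where
  "module_iso A M N \<longleftrightarrow> (\<exists>f\<in>module_hom A M N. bij_betw f (carrier M) (carrier N))"

definition is_submodule :: "('k, 'a) module \<Rightarrow> 'm set \<Rightarrow> ('a, 'm) right_module \<Rightarrow> bool" where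
  "is_submodule A U M \<longleftrightarrow> additive_subgroup U M \<and>
    (\<forall>u\<in>U. \<forall>a\<in>carrier A. u \<lhd>\<^bsub>M\<^esub> a \<in> U)"

definition indecomposable :: "('k, 'a) module \<Rightarrow> ('a, 'm) right_module \<Rightarrow> bool" where
  "indecomposable A M \<longleftrightarrow> carrier M \<noteq> {\<zero>\<^bsub>M\<^esub>} \<and>
    (\<forall>U V. is_submodule A U M \<and> is_submodule A V M \<and>
       U <+>\<^bsub>M\<^esub> V = carrier M \<and> U \<inter> V = {\<zero>\<^bsub>M\<^esub>} \<longrightarrow> U = {\<zero>\<^bsub>M\<^esub>} \<or> V = {\<zero>\<^bsub>M\<^esub>})"

text \<open>
  Quantification over all finite dimensional modules ranges over modules whose elements are of
  type \<^typ>\<open>nat \<Rightarrow> 'k\<close>. Since every finite dimensional vector space embeds into this type, every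
  finite dimensional module is isomorphic to one of these.
\<close>

type_synonym ('k, 'a) std_module = "('a, nat \<Rightarrow> 'k) right_module"

definition representation_finite :: "('k, 'a) module \<Rightarrow> bool" where
  "representation_finite A \<longleftrightarrow>
    (\<exists>\<M> :: ('k, 'a) std_module set. finite \<M> \<and>
      (\<forall>M :: ('k, 'a) std_module. fd_module A M \<and> indecomposable A M \<longrightarrow>
         (\<exists>N\<in>\<M>. module_iso A M N)))"

definition projective :: "('k, 'a) module \<Rightarrow> ('a, 'm) right_module \<Rightarrow> bool" where
  "projective A P \<longleftrightarrow>
    (\<forall>(M :: ('k, 'a) std_module) (N :: ('k, 'a) std_module).
      fd_module A M \<and> fd_module A N \<longrightarrow>
      (\<forall>g\<in>module_hom A M N. g ` carrier M = carrier N \<longrightarrow>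
        (\<forall>f\<in>module_hom A P N. \<exists>h\<in>module_hom A P M. \<forall>p\<in>carrier P. g (h p) = f p)))"

definition module_ker :: "('a, 'm) right_module \<Rightarrow> ('a, 'n) right_module \<Rightarrow> ('m \<Rightarrow> 'n) \<Rightarrow> 'm set" where
  "module_ker M N f = {m \<in> carrier M. f m = \<zero>\<^bsub>N\<^esub>}"

text \<open>
  \<open>\<dots> \<rightarrow> P 2 \<rightarrow> P 1 \<rightarrow> P 0 \<rightarrow> M \<rightarrow> 0\<close> is exact, with augmentation \<open>\<epsilon>\<close> and with differentials
  \<open>d i\<close> from \<open>P (i + 1)\<close> to \<open>P i\<close>.
\<close>

definition projective_resolution ::
    "('k, 'a) module \<Rightarrow> ('a, 'm) right_module \<Rightarrow> (nat \<Rightarrow> ('k, 'a) std_module) \<Rightarrow>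
     (nat \<Rightarrow> (nat \<Rightarrow> 'k) \<Rightarrow> (nat \<Rightarrow> 'k)) \<Rightarrow> ((nat \<Rightarrow> 'k) \<Rightarrow> 'm) \<Rightarrow> bool" where
  "projective_resolution A M P d \<epsilon> \<longleftrightarrow>
    (\<forall>i. fd_module A (P i) \<and> projective A (P i)) \<and>
    (\<forall>i. d i \<in> module_hom A (P (Suc i)) (P i)) \<and>
    \<epsilon> \<in> module_hom A (P 0) M \<and>
    \<epsilon> ` carrier (P 0) = carrier M \<and>
    d 0 ` carrier (P 1) = module_ker (P 0) M \<epsilon> \<and>
    (\<forall>i. d (Suc i) ` carrier (P (Suc (Suc i))) = module_ker (P (Suc i)) (P i) (d i))"

definition projective_dimension :: "('k, 'a) module \<Rightarrow> ('a, 'm) right_module \<Rightarrow> enat" where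
  "projective_dimension A M =
    Inf {enat n | n. \<exists>P d \<epsilon>. projective_resolution A M P d \<epsilon> \<and>
      (\<forall>i>n. carrier (P i) = {\<zero>\<^bsub>P i\<^esub>})}"


section \<open>Mild algebras\<close>

definition distributive_algebra :: "('k, 'a) module \<Rightarrow> bool" where
  "distributive_algebra A \<longleftrightarrow>
    (\<forall>J K L. ideal J A \<and> ideal K A \<and> ideal L A \<longrightarrow>
      J \<inter> (K <+>\<^bsub>A\<^esub> L) = (J \<inter> K) <+>\<^bsub>A\<^esub> (J \<inter> L))"

definition mild :: "('k, 'a) module \<Rightarrow> bool" where
  "mild A \<longleftrightarrow> distributive_algebra A \<and>
    (\<forall>J. ideal J A \<and> J \<noteq> {\<zero>\<^bsub>A\<^esub>} \<longrightarrow> representation_finite (quotient_algebra A J))"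


section \<open>Bound quiver algebras\<close>

abbreviation bound_quiver_algebra ::
    "('v, 'e) pre_digraph \<Rightarrow> ('v \<times> 'e list \<Rightarrow> 'k::field) set \<Rightarrow>
     ('k, ('v \<times> 'e list \<Rightarrow> 'k) set) module" where
  "bound_quiver_algebra Q I \<equiv> quotient_algebra (path_algebra Q) I"

definition prim_idem ::
    "('v, 'e) pre_digraph \<Rightarrow> ('v \<times> 'e list \<Rightarrow> 'k::field) set \<Rightarrow> 'v \<Rightarrow>
     ('v \<times> 'e list \<Rightarrow> 'k) set" where
  "prim_idem Q I z = I +>\<^bsub>path_algebra Q\<^esub> (\<lambda>r. if r = (z, []) then 1 else 0)"

text \<open>
  The simple module at \<open>x\<close> is the field, on which an element of the algebra acts as its
  coefficient at the trivial path at \<open>x\<close>. This coefficient is the same for all representatives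
  in the path algebra, because it vanishes on an admissible ideal.
\<close>

definition simple_module ::
    "('v, 'e) pre_digraph \<Rightarrow> 'v \<Rightarrow> (('v \<times> 'e list \<Rightarrow> 'k::field) set, 'k) right_module" where
  "simple_module Q x =
    \<lparr>carrier = UNIV, mult = (*), one = 1, zero = 0, add = (+),
     ract = (\<lambda>m X. m * (THE c. \<forall>f\<in>X. f (x, []) = c))\<rparr>"

definition neighborhood_points ::
    "('v, 'e) pre_digraph \<Rightarrow> ('v \<times> 'e list \<Rightarrow> 'k::field) set \<Rightarrow> 'v \<Rightarrow> 'v set" where
  "neighborhood_points Q I x = (let \<Lambda> = bound_quiver_algebra Q I in
    {z \<in> verts Q.
      (\<exists>a\<in>carrier \<Lambda>. prim_idem Q I x \<otimes>\<^bsub>\<Lambda>\<^esub> a \<otimes>\<^bsub>\<Lambda>\<^esub> prim_idem Q I z \<noteq> \<zero>\<^bsub>\<Lambda>\<^esub>) \<or>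
      z \<rightarrow>\<^bsub>Q\<^esub> x \<or>
      (\<exists>y y'. distinct [x, y, y', z] \<and>
        x \<rightarrow>\<^bsub>Q\<^esub> y' \<and> x \<rightarrow>\<^bsub>Q\<^esub> y \<and> y \<rightarrow>\<^bsub>Q\<^esub> x \<and> z \<rightarrow>\<^bsub>Q\<^esub> y)})"

definition neighborhood ::
    "('v, 'e) pre_digraph \<Rightarrow> ('v \<times> 'e list \<Rightarrow> 'k::field) set \<Rightarrow> 'v \<Rightarrow>
     ('k, ('v \<times> 'e list \<Rightarrow> 'k) set) module" where
  "neighborhood Q I x = (let \<Lambda> = bound_quiver_algebra Q I in
    corner_algebra \<Lambda> (\<Oplus>\<^bsub>\<Lambda>\<^esub>z\<in>neighborhood_points Q I x. prim_idem Q I z))"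

end

theory Submission
  imports Defs "HOL-Library.Function_Algebras"
begin

text \<open>
  The argument is that of Igusa, Liu and Paquette. Suppose that there is a loop \<open>a\<close> at \<open>x\<close>. Killing all
  other points and arrows maps the algebra \<open>\<Lambda>\<close> onto \<open>B = k[t]/t\<^sup>2\<close> with \<open>a \<mapsto> t\<close>. If \<open>S\<^sub>x\<close> has finite
  projective dimension, then \<open>Ext\<^sup>1(S\<^sub>x, \<Omega>\<^sup>-\<^sup>n Y) = 0\<close> for large \<open>n\<close> and all \<open>Y\<close>, where \<open>\<Omega>\<^sup>-\<^sup>1\<close> is the
  exact cosyzygy functor \<open>Y \<mapsto> Hom(\<Lambda>, Y) / Y\<close>. This makes \<open>Hom(B, \<Omega>\<^sup>-\<^sup>n Y)\<close> a free \<open>B\<close>-module, so that an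
  endomorphism of \<open>Y\<close> has a trace in \<open>B\<close>, whose coefficient at \<open>t\<close> we consider. It vanishes for
  nilpotent endomorphisms, by additivity along a filtration of \<open>Y\<close>, and in particular for
  multiplication by \<open>a\<close> on the dual of \<open>\<Lambda>\<close>. But on modules without extensions by \<open>S\<^sub>x\<close> it can be
  computed before taking cosyzygies, up to sign, because the trace on \<open>Hom(B, Hom(\<Lambda>, Y))\<close> lies in \<open>k\<close>.
  For multiplication by \<open>a\<close> on the dual of \<open>\<Lambda>\<close> this gives \<open>\<plusminus>1\<close>, a contradiction.
\<close>

section \<open>Traces on spaces of functions\<close>

text \<open>For a module V, \<open>Hom(B, V)\<close> consists of the vectors on which the algebra
  acts through B, and t maps it into the socle \<open>Hom(S, V)\<close>. It is free as soon as every
  u in this socle is t times such a vector; the obstruction is the class of the cocycle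
  \<open>D r *s u\<close> in \<open>Ext^1(S, V)\<close>. If \<tau> is a linear choice of such
  vectors, an endomorphism f satisfies f(\<tau> u) = \<tau>(f u) + w with w in the socle, so the
  coefficient of its trace at t is the ordinary trace of the commutator of f and \<tau> on the
  socle.

  Cosyzygies are taken via \<open>Hom(\<Lambda>, Y)\<close> rather than injective hulls because this
  is functorial without choices and respects inclusions, so a filtration survives iteration. The
  obstacle is that the terms of the filtration may have nonzero \<open>Ext^1(S, -)\<close> before
  the n-th cosyzygy, while a trace can be followed from Y to its cosyzygy only where this group
  vanishes. The dual of the algebra is injective and has vanishing groups at all stages, so its
  trace is followed from the start, and the filtration enters only at stage n.\<close>

definition fscale :: "'k::field \<Rightarrow> ('q \<Rightarrow> 'k) \<Rightarrow> 'q \<Rightarrow> 'k" (infixr \<open>*s\<close> 75) where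
  "c *s f = (\<lambda>q. c * f q)"

lemma fscale_apply: "(c *s f) q = c * f q"
  by (simp add: fscale_def)

declare plus_fun_apply [simp del] zero_fun_apply [simp del] minus_apply [simp del]
  uminus_apply [simp del]

lemmas pointwise = plus_fun_apply zero_fun_apply minus_apply uminus_apply fscale_apply

lemma sum_apply: "sum f A q = (\<Sum>a\<in>A. f a q)"
  by (induction A rule: infinite_finite_induct) (simp_all add: pointwise)

global_interpretation fs: vector_space "fscale :: 'k::field \<Rightarrow> ('q \<Rightarrow> 'k) \<Rightarrow> 'q \<Rightarrow> 'k"
  by unfold_locales (auto simp: fun_eq_iff pointwise algebra_simps)

global_interpretation fsp: vector_space_pair
  "fscale :: 'k::field \<Rightarrow> ('q \<Rightarrow> 'k) \<Rightarrow> 'q \<Rightarrow> 'k"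
  "fscale :: 'k::field \<Rightarrow> ('s \<Rightarrow> 'k) \<Rightarrow> 's \<Rightarrow> 'k"
  by unfold_locales

abbreviation lin :: "(('q \<Rightarrow> 'k::field) \<Rightarrow> ('s \<Rightarrow> 'k)) \<Rightarrow> bool" where
  "lin \<equiv> Vector_Spaces.linear fscale fscale"

lemma linI:
  assumes "\<And>u v. f (u + v) = f u + f v" "\<And>c u. f (c *s u) = c *s f u"
  shows "lin f"
  using assms by (intro Vector_Spaces.linear.intro fs.vector_space_axioms)
    (unfold_locales, auto)

lemma lin_add: "lin f \<Longrightarrow> f (u + v) = f u + f v"
  and lin_scale: "lin f \<Longrightarrow> f (c *s u) = c *s f u"
  and lin_diff: "lin f \<Longrightarrow> f (u - v) = f u - f v"
  and lin_minus: "lin f \<Longrightarrow> f (- u) = - f u"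
  and lin_0: "lin f \<Longrightarrow> f 0 = 0"
  and lin_sum: "lin f \<Longrightarrow> f (sum g A) = (\<Sum>a\<in>A. f (g a))"
  by (rule fsp.linear_add fsp.linear_scale fsp.linear_diff fsp.linear_neg fsp.linear_0
      fsp.linear_sum, assumption)+

lemma lin_zero: "lin (\<lambda>_. 0)"
  and lin_id: "lin (\<lambda>u. u)"
  and lin_app: "lin f \<Longrightarrow> lin g \<Longrightarrow> lin (\<lambda>u. f (g u))"
  and lin_plus: "lin f1 \<Longrightarrow> lin g1 \<Longrightarrow> lin (\<lambda>u. f1 u + g1 u)"
  and lin_minus': "lin f1 \<Longrightarrow> lin g1 \<Longrightarrow> lin (\<lambda>u. f1 u - g1 u)"
  and lin_scaled: "lin f1 \<Longrightarrow> lin (\<lambda>u. c *s f1 u)"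
  by (rule linI; simp add: lin_add lin_scale algebra_simps fs.scale_right_distrib
      fs.scale_right_diff_distrib)+

lemmas lin_intros = lin_zero lin_id lin_plus lin_minus' lin_scaled

section \<open>Bases, linear extensions and projections\<close>

definition fin_dim :: "('q \<Rightarrow> 'k::field) set \<Rightarrow> bool" where
  "fin_dim V \<longleftrightarrow> fs.subspace V \<and> (\<exists>S. finite S \<and> V \<subseteq> fs.span S)"

definition basis_of :: "('q \<Rightarrow> 'k::field) set \<Rightarrow> ('q \<Rightarrow> 'k) set \<Rightarrow> bool" where
  "basis_of V B \<longleftrightarrow> finite B \<and> fs.independent B \<and> fs.span B = V"

lemma fin_dim_subspace: "fin_dim V \<Longrightarrow> fs.subspace V"
  by (simp add: fin_dim_def)

lemma fin_dim_subset: "fin_dim V \<Longrightarrow> fs.subspace U \<Longrightarrow> U \<subseteq> V \<Longrightarrow> fin_dim U"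
  unfolding fin_dim_def by blast

lemma basis_extend:
  assumes "fin_dim V" "fs.subspace U" "U \<subseteq> V"
  obtains A B where "basis_of U A" "basis_of V B" "A \<subseteq> B"
proof -
  obtain S where S: "finite S" "V \<subseteq> fs.span S" using assms by (auto simp: fin_dim_def)
  obtain A where A: "A \<subseteq> U" "fs.independent A" "U \<subseteq> fs.span A"
    using fs.maximal_independent_subset[of U] by metis
  obtain B where B: "A \<subseteq> B" "B \<subseteq> V" "fs.independent B" "V \<subseteq> fs.span B"
    using fs.maximal_independent_subset_extend[of A V] A assms by blast
  have "finite B" using fs.independent_span_bound[of S B] S B by auto
  moreover have "fs.span B = V" "fs.span A = U"
    using A B assms fin_dim_subspace[OF assms(1)] fs.span_minimal by (metis subset_antisym)+
  moreover have "finite A" using \<open>finite B\<close> B(1) by (rule rev_finite_subset)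
  ultimately show ?thesis using that[of A B] A B by (auto simp: basis_of_def)
qed

lemma fin_dim_basis:
  assumes "fin_dim V" obtains B where "basis_of V B"
  using basis_extend[OF assms fin_dim_subspace[OF assms]] by blast

lemma basis_of_mem: "basis_of V B \<Longrightarrow> b \<in> B \<Longrightarrow> b \<in> V"
  using fs.span_superset unfolding basis_of_def by blast

lemma lin_extend_basis:
  assumes "fs.independent B"
  obtains g where "lin g" "\<And>b. b \<in> B \<Longrightarrow> g b = f b"
  using fsp.linear_independent_extend[OF assms] by blast

text \<open>Maps obtained on submodules are linear only there, whereas \<open>lin\<close> speaks of
  the whole function space. Extending them lets linearity be used without membership
  conditions.\<close>

lemma lin_extend:
  fixes f :: "('q \<Rightarrow> 'k::field) \<Rightarrow> ('s \<Rightarrow> 'k)"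
  assumes "fs.subspace V" "\<And>u v. u \<in> V \<Longrightarrow> v \<in> V \<Longrightarrow> f (u + v) = f u + f v"
    "\<And>c u. u \<in> V \<Longrightarrow> f (c *s u) = c *s f u"
  obtains g where "lin g" "\<And>v. v \<in> V \<Longrightarrow> g v = f v"
proof -
  obtain B where B: "B \<subseteq> V" "fs.independent B" "V \<subseteq> fs.span B"
    using fs.maximal_independent_subset[of V] by metis
  obtain g where g: "lin g" "\<And>b. b \<in> B \<Longrightarrow> g b = f b" using lin_extend_basis[OF B(2)] by blast
  have f0: "f 0 = 0" using assms(3)[of 0 0] fs.subspace_0[OF assms(1)] by simp
  have "v \<in> V \<and> g v = f v" if "v \<in> fs.span B" for v
    using that
  proof (induction rule: fs.span_induct_alt)
    case base then show ?case using lin_0[OF g(1)] f0 fs.subspace_0[OF assms(1)] by simp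
  next
    case (step c x y)
    have x: "x \<in> V" "c *s x \<in> V" using step B fs.subspace_scale[OF assms(1)] by auto
    then show ?case using step g(2)[of x] assms(2)[of "c *s x" y] assms(3)[of x c]
        fs.subspace_add[OF assms(1), of "c *s x" y]
      by (simp add: lin_add[OF g(1)] lin_scale[OF g(1)])
  qed
  then show ?thesis using that g B by blast
qed

lemma lin_projection:
  fixes U :: "('q \<Rightarrow> 'k::field) set"
  assumes "fs.subspace U"
  obtains p where "lin p" "\<And>v. p v \<in> U" "\<And>u. u \<in> U \<Longrightarrow> p u = u"
  using fsp.linear_exists_left_inverse_on[OF lin_id assms] by auto

lemma lin_section:
  fixes f :: "('q \<Rightarrow> 'k::field) \<Rightarrow> ('s \<Rightarrow> 'k)"
  assumes "lin f" "fs.subspace V"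
  obtains g where "lin g" "\<And>w. g w \<in> V" "\<And>v. v \<in> V \<Longrightarrow> f (g (f v)) = f v"
  using fsp.linear_exists_right_inverse_on[OF assms] by auto

section \<open>Traces, commutators and short exact sequences\<close>

lemma representation_combination:
  assumes "finite B" "fs.independent B" "b \<in> B"
  shows "fs.representation B (\<Sum>c\<in>B. g c *s c) b = g b"
proof -
  have "fs.representation B (\<Sum>c\<in>B. g c *s c) b = (\<Sum>c\<in>B. fs.representation B (g c *s c) b)"
    using assms by (subst fs.representation_sum) (auto intro: fs.span_base fs.span_scale)
  also have "\<dots> = (\<Sum>c\<in>B. if c = b then g b else 0)"
    using assms by (intro sum.cong)
      (auto simp: fs.representation_scale fs.span_base fs.representation_basis)
  finally show ?thesis using assms by simp
qed

lemma representation_sum_basis: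
  assumes "basis_of V B" "v \<in> V"
  shows "(\<Sum>b\<in>B. fs.representation B v b *s b) = v"
  using assms fs.sum_representation_eq[of B v B] by (auto simp: basis_of_def)

text \<open>Only the restriction of \<open>f\<close> to \<open>V\<close> counts, and the value is
  meaningful when this restriction stays in \<open>V\<close>. The arbitrary choice of a basis is
  justified by \<open>trace_on_basis\<close>.\<close>

definition trace_on :: "('q \<Rightarrow> 'k::field) set \<Rightarrow> (('q \<Rightarrow> 'k) \<Rightarrow> ('q \<Rightarrow> 'k)) \<Rightarrow> 'k" where
  "trace_on V f = (let B = SOME B. basis_of V B in \<Sum>b\<in>B. fs.representation B (f b) b)"

text \<open>Two bases give the same value because both expand into the same double sum.\<close>

lemma trace_two_bases:
  assumes B: "basis_of V B" and C: "basis_of V C"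
    and f: "lin f" "f ` V \<subseteq> V" and g: "lin g" "g ` V \<subseteq> V"
  shows "(\<Sum>b\<in>B. fs.representation B (f (g b)) b) = (\<Sum>c\<in>C. fs.representation C (g (f c)) c)"
proof -
  let ?r = "fs.representation B" and ?s = "fs.representation C"
  have rl: "?r (f (g b)) b = (\<Sum>c\<in>C. ?s (g b) c * ?r (f c) b)" if "b \<in> B" for b
  proof -
    have "g b \<in> V" using g basis_of_mem[OF B that] by auto
    then have "f (g b) = (\<Sum>c\<in>C. ?s (g b) c *s f c)"
      using representation_sum_basis[OF C, of "g b"] lin_sum[OF f(1)] lin_scale[OF f(1)]
      by (metis (mono_tags, lifting) sum.cong)
    moreover have fc: "f c \<in> fs.span B" if "c \<in> C" for c
      using f basis_of_mem[OF C that] B by (auto simp: basis_of_def)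
    ultimately have "?r (f (g b)) b = (\<Sum>c\<in>C. ?r (?s (g b) c *s f c) b)"
      using B by (subst \<open>f (g b) = _\<close>, subst fs.representation_sum)
        (auto simp: fs.span_scale basis_of_def)
    then show ?thesis using B fc by (simp add: fs.representation_scale basis_of_def)
  qed
  have rr: "?s (g (f c)) c = (\<Sum>b\<in>B. ?r (f c) b * ?s (g b) c)" if "c \<in> C" for c
  proof -
    have "f c \<in> V" using f basis_of_mem[OF C that] by auto
    then have "g (f c) = (\<Sum>b\<in>B. ?r (f c) b *s g b)"
      using representation_sum_basis[OF B, of "f c"] lin_sum[OF g(1)] lin_scale[OF g(1)]
      by (metis (mono_tags, lifting) sum.cong)
    moreover have gb: "g b \<in> fs.span C" if "b \<in> B" for b
      using g basis_of_mem[OF B that] C by (auto simp: basis_of_def)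
    ultimately have "?s (g (f c)) c = (\<Sum>b\<in>B. ?s (?r (f c) b *s g b) c)"
      using C by (subst \<open>g (f c) = _\<close>, subst fs.representation_sum)
        (auto simp: fs.span_scale basis_of_def)
    then show ?thesis using C gb by (simp add: fs.representation_scale basis_of_def)
  qed
  show ?thesis using sum.swap[of "\<lambda>b c. ?s (g b) c * ?r (f c) b" C B] 
    by (simp add: rl rr mult.commute)
qed

text \<open>The case of \<open>trace_two_bases\<close> in which one map is the identity; the case of
  equal bases gives \<open>trace_on_commute\<close>.\<close>

lemma trace_on_basis:
  assumes "basis_of V B" "lin f" "f ` V \<subseteq> V"
  shows "trace_on V f = (\<Sum>b\<in>B. fs.representation B (f b) b)"
proof -
  have "basis_of V (SOME B. basis_of V B)" using assms someI by metis
  from trace_two_bases[OF this assms, of "\<lambda>u. u"] show ?thesis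
    by (simp add: lin_id trace_on_def Let_def)
qed

lemma trace_on_commute:
  assumes "fin_dim V" "lin f" "f ` V \<subseteq> V" "lin g" "g ` V \<subseteq> V"
  shows "trace_on V (\<lambda>u. f (g u)) = trace_on V (\<lambda>u. g (f u))"
proof -
  obtain B where B: "basis_of V B" using fin_dim_basis assms by blast
  have im: "(\<lambda>u. f (g u)) ` V \<subseteq> V" "(\<lambda>u. g (f u)) ` V \<subseteq> V" using assms by auto
  show ?thesis
    unfolding trace_on_basis[OF B lin_app[OF assms(2,4)] im(1)]
      trace_on_basis[OF B lin_app[OF assms(4,2)] im(2)]
    by (rule trace_two_bases[OF B B assms(2-5)])
qed

lemma trace_on_diff:
  assumes "fin_dim V" "lin f" "f ` V \<subseteq> V" "lin g" "g ` V \<subseteq> V"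
  shows "trace_on V (\<lambda>u. f u - g u) = trace_on V f - trace_on V g"
proof -
  obtain B where B: "basis_of V B" using fin_dim_basis assms by blast
  have d: "(\<lambda>u. f u - g u) ` V \<subseteq> V"
    using assms fs.subspace_diff[OF fin_dim_subspace[OF assms(1)]] by auto
  have s: "f b \<in> fs.span B" "g b \<in> fs.span B" if "b \<in> B" for b
    using B basis_of_mem[OF B that] assms by (auto simp: basis_of_def)
  show ?thesis unfolding trace_on_basis[OF B lin_minus'[OF assms(2,4)] d]
      trace_on_basis[OF B assms(2,3)] trace_on_basis[OF B assms(4,5)] sum_subtractf[symmetric]
    using B s by (intro sum.cong) (auto simp: fs.representation_diff basis_of_def)
qed

lemma trace_on_cong:
  assumes "fin_dim V" "\<And>v. v \<in> V \<Longrightarrow> f v = g v"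
  shows "trace_on V f = trace_on V g"
proof -
  have "basis_of V (SOME B. basis_of V B)" using assms fin_dim_basis someI by metis
  then show ?thesis using assms basis_of_mem unfolding trace_on_def Let_def
    by (metis (mono_tags, lifting) sum.cong)
qed

text \<open>In a basis of \<open>V\<close> that extends one of \<open>U\<close>, the values of
  \<open>f\<close> have no coordinate along the added vectors, which therefore contribute nothing to
  the diagonal.\<close>

lemma trace_on_subspace:
  assumes "fin_dim V" "fs.subspace U" "U \<subseteq> V" "lin f" "f ` V \<subseteq> U"
  shows "trace_on V f = trace_on U f"
proof -
  obtain A B where AB: "basis_of U A" "basis_of V B" "A \<subseteq> B"
    using basis_extend[OF assms(1-3)] by blast
  have iB: "fs.independent B" and fB: "finite B" using AB by (auto simp: basis_of_def)
  have r: "fs.representation B u b = (if b \<in> A then fs.representation A u b else 0)"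
    if "u \<in> U" for u b
    using fs.representation_extend[OF iB _ AB(3)] that AB fs.representation_ne_zero[of A u b]
    by (auto simp: basis_of_def)
  have m: "f b \<in> U" if "b \<in> B" for b using basis_of_mem[OF AB(2) that] assms by auto
  have "trace_on V f = (\<Sum>b\<in>B. if b \<in> A then fs.representation A (f b) b else 0)"
    using assms m by (subst trace_on_basis[OF AB(2)]) (auto simp: r)
  also have "\<dots> = (\<Sum>b\<in>A. fs.representation A (f b) b)"
    using fB AB(3) by (simp add: sum.If_cases Int_absorb1)
  finally show ?thesis using assms by (subst trace_on_basis[OF AB(1)]) auto
qed

text \<open>Additivity of the trace along 0 -> U -> V -> p(V) -> 0. In a basis of \<open>V\<close>
  extending one of \<open>U\<close>, the added vectors \<open>C\<close> map to a basis of the image,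
  and the diagonal splits accordingly.\<close>

lemma trace_on_exact:
  assumes V: "fin_dim V" and p: "lin p" and f: "lin f" "f ` V \<subseteq> V" and g: "lin g"
    and gp: "\<And>v. v \<in> V \<Longrightarrow> g (p v) = p (f v)"
    and U: "U = {v \<in> V. p v = 0}"
  shows "trace_on V f = trace_on U f + trace_on (p ` V) g"
proof -
  have sV: "fs.subspace V" using V by (rule fin_dim_subspace)
  have sU: "fs.subspace U" unfolding U using sV
    by (auto simp: fs.subspace_def lin_0[OF p] lin_add[OF p] lin_scale[OF p])
  have UV: "U \<subseteq> V" using U by auto
  have fU: "f ` U \<subseteq> U" using f gp U lin_0[OF g] by fastforce
  obtain A B where AB: "basis_of U A" "basis_of V B" "A \<subseteq> B"
    using basis_extend[OF V sU UV] by blast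
  define C where "C = B - A"
  have fin: "finite A" "finite B" "finite C" "fs.independent A" "fs.independent B"
    using AB by (auto simp: basis_of_def C_def)
  have B_eq: "B = A \<union> C" "A \<inter> C = {}" using AB(3) by (auto simp: C_def)
  note split = sum.union_disjoint[OF fin(1,3) B_eq(2), folded B_eq(1)]
  have pA: "p b = 0" if "b \<in> A" for b using basis_of_mem[OF AB(1) that] U by auto
  have pv: "p v = (\<Sum>b\<in>C. fs.representation B v b *s p b)" if "v \<in> V" for v
  proof -
    have "p v = (\<Sum>b\<in>B. fs.representation B v b *s p b)"
      using representation_sum_basis[OF AB(2) that] lin_sum[OF p] lin_scale[OF p]
      by (metis (mono_tags, lifting) sum.cong)
    then show ?thesis using pA by (simp add: split)
  qed
  have CV: "C \<subseteq> V" using basis_of_mem[OF AB(2)] by (auto simp: C_def)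
  \<comment> \<open>A relation among the images puts the combination \<open>?v\<close> into the
    kernel \<open>U\<close>, hence into the span of \<open>A\<close>, so its coordinates along
    \<open>C\<close> vanish.\<close>
  have ind: "\<forall>b\<in>C. h b = 0" if "(\<Sum>b\<in>C. h b *s p b) = 0" for h
  proof -
    let ?v = "\<Sum>b\<in>C. h b *s b"
    have "?v \<in> V" using CV sV by (intro fs.subspace_sum fs.subspace_scale) auto
    moreover have "p ?v = 0" using that by (simp add: lin_sum[OF p] lin_scale[OF p])
    ultimately have vU: "?v \<in> U" using U by auto
    have e: "?v = (\<Sum>b\<in>B. (if b \<in> A then 0 else h b) *s b)"
      using fin by (simp add: split) (rule sum.cong, auto simp: C_def)
    have "fs.representation B ?v b = h b" if "b \<in> C" for b
      unfolding e using representation_combination[OF fin(2,5)] that by (auto simp: C_def)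
    moreover have "fs.representation B ?v b = 0" if "b \<in> C" for b
      using fs.representation_extend[OF fin(5) _ AB(3), of ?v] vU AB(1) that
        fs.representation_ne_zero[of A ?v b]
      by (auto simp: basis_of_def C_def)
    ultimately show ?thesis by auto
  qed
  have inj: "inj_on p C"
  proof
    fix b c assume bc: "b \<in> C" "c \<in> C" "p b = p c"
    show "b = c"
    proof (rule ccontr)
      assume ne: "b \<noteq> c"
      \<comment> \<open>A coincidence \<open>p b = p c\<close> is the relation with coefficients 1
        and -1.\<close>
      let ?h = "\<lambda>d. if d = b then 1 else if d = c then - 1 else (0::'b)"
      have "(\<Sum>d\<in>C. ?h d *s p d) = (\<Sum>d\<in>{b, c}. ?h d *s p d)"
        using bc fin by (intro sum.mono_neutral_right) auto
      also have "\<dots> = 0" using ne bc by simp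
      finally show False using ind[of ?h] bc by auto
    qed
  qed
  have ipC: "fs.independent (p ` C)"
    using ind[of "\<lambda>c. _ (p c)"] fin inj
    by (intro fs.independent_if_scalars_zero) (auto simp: sum.reindex)
  have sp: "fs.span (p ` C) = p ` V"
  proof
    show "fs.span (p ` C) \<subseteq> p ` V"
      using CV fsp.linear_subspace_image[OF p sV] by (intro fs.span_minimal) auto
    show "p ` V \<subseteq> fs.span (p ` C)"
    proof
      fix w assume "w \<in> p ` V"
      then obtain v where "v \<in> V" "w = p v" by blast
      then show "w \<in> fs.span (p ` C)"
        by (simp add: pv) (intro fs.span_sum fs.span_scale fs.span_base imageI)
    qed
  qed
  have bC: "basis_of (p ` V) (p ` C)" using fin ipC sp by (auto simp: basis_of_def)
  have "trace_on (p ` V) g = (\<Sum>c\<in>C. fs.representation (p ` C) (g (p c)) (p c))"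
    using gp f by (subst trace_on_basis[OF bC g]) (auto simp: sum.reindex[OF inj])
  also have "\<dots> = (\<Sum>c\<in>C. fs.representation B (f c) c)"
  proof (rule sum.cong)
    fix c assume c: "c \<in> C"
    have cV: "c \<in> V" "f c \<in> V" using c CV f by auto
    have "g (p c) = (\<Sum>b\<in>C. fs.representation B (f c) b *s p b)"
      using gp[OF cV(1)] pv[OF cV(2)] by (rule trans)
    also have "\<dots> = (\<Sum>d\<in>p ` C. fs.representation B (f c) (the_inv_into C p d) *s d)"
      using inj by (simp add: sum.reindex the_inv_into_f_f)
    finally show "fs.representation (p ` C) (g (p c)) (p c) = fs.representation B (f c) c"
      using representation_combination[OF _ ipC] c fin inj by (simp add: the_inv_into_f_f)
  qed simp
  finally have 1: "trace_on (p ` V) g = (\<Sum>c\<in>C. fs.representation B (f c) c)" .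
  have "fs.representation B (f b) b = fs.representation A (f b) b" if "b \<in> A" for b
    using fs.representation_extend[OF fin(5) _ AB(3), of "f b"] AB(1) fU basis_of_mem[OF AB(1) that]
    by (auto simp: basis_of_def)
  then have "trace_on U f = (\<Sum>b\<in>A. fs.representation B (f b) b)"
    by (subst trace_on_basis[OF AB(1) f(1) fU]) auto
  then show ?thesis using 1 by (simp add: trace_on_basis[OF AB(2) f] split)
qed

section \<open>Cosyzygies and extensions\<close>

definition slice :: "'r \<Rightarrow> ('r list \<Rightarrow> 'k) \<Rightarrow> 'r list \<Rightarrow> 'k" where
  "slice r F = (\<lambda>l. F (r # l))"

text \<open>The default zero at the empty list and outside of \<open>R\<close> makes the stored form
  of a family unique, so that equality can be tested on slices.\<close>

definition glue :: "'r set \<Rightarrow> ('r \<Rightarrow> 'r list \<Rightarrow> 'k::zero) \<Rightarrow> 'r list \<Rightarrow> 'k" where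
  "glue R f = (\<lambda>l. case l of [] \<Rightarrow> 0 | r # l' \<Rightarrow> if r \<in> R then f r l' else 0)"

lemma slice_glue: "slice r (glue R f) = (if r \<in> R then f r else 0)"
  by (auto simp: slice_def glue_def fun_eq_iff zero_fun_apply)

lemma glue_Nil: "glue R f [] = 0"
  by (simp add: glue_def)

lemma slice_eqI:
  assumes "F [] = H []" "\<And>r. slice r F = slice r H"
  shows "F = H"
proof
  fix l show "F l = H l"
    using assms(1) fun_cong[OF assms(2), of "hd l" "tl l"] by (cases l) (auto simp: slice_def)
qed

lemma slice_add: "slice r (F + H) = slice r F + slice r H"
  and slice_diff: "slice r (F - H) = slice r F - slice r H"
  and slice_scale: "slice r (c *s F) = c *s slice r F"
  and slice_zero: "slice r 0 = 0"
  for F H :: "'r list \<Rightarrow> 'k::field"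
  by (auto simp: slice_def pointwise fun_eq_iff)

lemma lin_slice: "lin (slice r :: ('r list \<Rightarrow> 'k::field) \<Rightarrow> _)"
  by (rule linI) (simp_all add: slice_add slice_scale)

lemma lin_glue:
  assumes "\<And>r. lin (f r)"
  shows "lin (\<lambda>F. glue R (\<lambda>r. f r F))"
  by (rule linI; rule slice_eqI; simp add: slice_glue glue_Nil slice_add slice_scale pointwise
    lin_add[OF assms] lin_scale[OF assms])

text \<open>
  A finite dimensional algebra, presented as the quotient of an algebra \<open>R\<close> of functions by an ideal
  \<open>I\<close>. Modulo \<open>I\<close> an element is determined by its values on the finite set \<open>G\<close>.
\<close>

locale bound_algebra =
  fixes R :: "('p \<Rightarrow> 'k::field) set" and mul :: "('p \<Rightarrow> 'k) \<Rightarrow> ('p \<Rightarrow> 'k) \<Rightarrow> 'p \<Rightarrow> 'k" (infixl \<open>\<cdot>\<close> 70)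
    and un :: "'p \<Rightarrow> 'k" and I :: "('p \<Rightarrow> 'k) set" and G :: "'p set"
  assumes R: "fs.subspace R"
    and mul_closed: "r \<in> R \<Longrightarrow> s \<in> R \<Longrightarrow> r \<cdot> s \<in> R"
    and mul_assoc: "r \<in> R \<Longrightarrow> s \<in> R \<Longrightarrow> t \<in> R \<Longrightarrow> r \<cdot> s \<cdot> t = r \<cdot> (s \<cdot> t)"
    and mul_add_left: "r \<in> R \<Longrightarrow> s \<in> R \<Longrightarrow> t \<in> R \<Longrightarrow> (r + s) \<cdot> t = r \<cdot> t + s \<cdot> t"
    and mul_add_right: "r \<in> R \<Longrightarrow> s \<in> R \<Longrightarrow> t \<in> R \<Longrightarrow> r \<cdot> (s + t) = r \<cdot> s + r \<cdot> t"
    and mul_scale_left: "r \<in> R \<Longrightarrow> s \<in> R \<Longrightarrow> (c *s r) \<cdot> s = c *s (r \<cdot> s)"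
    and mul_scale_right: "r \<in> R \<Longrightarrow> s \<in> R \<Longrightarrow> r \<cdot> (c *s s) = c *s (r \<cdot> s)"
    and un: "un \<in> R" "r \<in> R \<Longrightarrow> un \<cdot> r = r" "r \<in> R \<Longrightarrow> r \<cdot> un = r"
    and I: "I \<subseteq> R"
    and I_left: "i \<in> I \<Longrightarrow> r \<in> R \<Longrightarrow> r \<cdot> i \<in> I"
    and I_right: "i \<in> I \<Longrightarrow> r \<in> R \<Longrightarrow> i \<cdot> r \<in> I"
    and G: "finite G" "g \<in> G \<Longrightarrow> (\<lambda>p. if p = g then 1 else 0) \<in> R"
    and G_span: "r \<in> R \<Longrightarrow> r - (\<Sum>g\<in>G. r g *s (\<lambda>p. if p = g then 1 else 0)) \<in> I"
begin

lemma R_closed: "r \<in> R \<Longrightarrow> s \<in> R \<Longrightarrow> r + s \<in> R" "r \<in> R \<Longrightarrow> c *s r \<in> R" "0 \<in> R"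
  using R by (auto simp: fs.subspace_def)

lemma I_R: "i \<in> I \<Longrightarrow> i \<in> R"
  using I by auto

text \<open>A right module, since \<open>r \<cdot> s\<close> acts by \<open>r\<close> first. The
  module laws are required on \<open>R\<close> and \<open>V\<close> only, but linearity of
  \<open>act r\<close> everywhere. As \<open>I\<close> acts by zero, this is a module over the
  quotient algebra.\<close>

definition rmod :: "('q \<Rightarrow> 'k) set \<Rightarrow> (('p \<Rightarrow> 'k) \<Rightarrow> ('q \<Rightarrow> 'k) \<Rightarrow> ('q \<Rightarrow> 'k)) \<Rightarrow> bool" where
  "rmod V act \<longleftrightarrow> fin_dim V \<and> (\<forall>r. lin (act r)) \<and> (\<forall>r\<in>R. \<forall>v\<in>V. act r v \<in> V) \<and>
    (\<forall>r\<in>R. \<forall>s\<in>R. \<forall>v\<in>V. act (r + s) v = act r v + act s v) \<and>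
    (\<forall>c. \<forall>r\<in>R. \<forall>v\<in>V. act (c *s r) v = c *s act r v) \<and>
    (\<forall>r\<in>R. \<forall>s\<in>R. \<forall>v\<in>V. act (r \<cdot> s) v = act s (act r v)) \<and>
    (\<forall>v\<in>V. act un v = v) \<and> (\<forall>i\<in>I. \<forall>v\<in>V. act i v = 0)"

lemma rmodD:
  assumes "rmod V act"
  shows "fin_dim V" "fs.subspace V" "lin (act r)"
    "r \<in> R \<Longrightarrow> v \<in> V \<Longrightarrow> act r v \<in> V"
    "r \<in> R \<Longrightarrow> s \<in> R \<Longrightarrow> v \<in> V \<Longrightarrow> act (r + s) v = act r v + act s v"
    "r \<in> R \<Longrightarrow> v \<in> V \<Longrightarrow> act (c *s r) v = c *s act r v"
    "r \<in> R \<Longrightarrow> s \<in> R \<Longrightarrow> v \<in> V \<Longrightarrow> act (r \<cdot> s) v = act s (act r v)"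
    "v \<in> V \<Longrightarrow> act un v = v" "i \<in> I \<Longrightarrow> v \<in> V \<Longrightarrow> act i v = 0"
  using assms fin_dim_subspace unfolding rmod_def by auto

lemma rmod_submodule:
  assumes "rmod V act" "fs.subspace U" "U \<subseteq> V" "\<And>r u. r \<in> R \<Longrightarrow> u \<in> U \<Longrightarrow> act r u \<in> U"
  shows "rmod U act"
  using assms fin_dim_subset[OF rmodD(1)[OF assms(1)] assms(2,3)] unfolding rmod_def by blast

definition rhom where
  "rhom V act W act' f \<longleftrightarrow> lin f \<and> f ` V \<subseteq> W \<and> (\<forall>r\<in>R. \<forall>v\<in>V. f (act r v) = act' r (f v))"

text \<open>
  \<open>cosyz V\<close> is the cokernel of \<open>V \<rightarrow> Hom(\<Lambda>, V)\<close>, identified with the maps vanishing at the unit. So that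
  it can be iterated within one type, the map \<open>r \<mapsto> F r\<close> is stored as the function sending \<open>r # l\<close> to
  \<open>F r l\<close>.
\<close>

definition cosyz :: "(('p \<Rightarrow> 'k) list \<Rightarrow> 'k) set \<Rightarrow> (('p \<Rightarrow> 'k) list \<Rightarrow> 'k) set" where
  "cosyz V = {F. F [] = 0 \<and> (\<forall>r. r \<notin> R \<longrightarrow> slice r F = 0) \<and> (\<forall>r\<in>R. slice r F \<in> V) \<and>
    (\<forall>r\<in>R. \<forall>s\<in>R. slice (r + s) F = slice r F + slice s F) \<and>
    (\<forall>c. \<forall>r\<in>R. slice (c *s r) F = c *s slice r F) \<and>
    (\<forall>i\<in>I. slice i F = 0) \<and> slice un F = 0}"

text \<open>On \<open>Hom(\<Lambda>, V)\<close> the element \<open>r\<close> sends a map to its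
  composite with left multiplication by \<open>r\<close>. The result has the value
  \<open>slice r F\<close> at the unit; subtracting the image
  \<open>s \<mapsto> act s (slice r F)\<close> of this value under V ->
  \<open>Hom(\<Lambda>, V)\<close> restores the normalisation.\<close>

definition cosyz_act where
  "cosyz_act act r F = glue R (\<lambda>s. slice (r \<cdot> s) F - act s (slice r F))"

definition cosyz_map where
  "cosyz_map f F = glue R (\<lambda>s. f (slice s F))"

lemma cosyzD:
  assumes "F \<in> cosyz V"
  shows "F [] = 0" "r \<notin> R \<Longrightarrow> slice r F = 0" "r \<in> R \<Longrightarrow> slice r F \<in> V"
    "r \<in> R \<Longrightarrow> s \<in> R \<Longrightarrow> slice (r + s) F = slice r F + slice s F"
    "r \<in> R \<Longrightarrow> slice (c *s r) F = c *s slice r F"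
    "i \<in> I \<Longrightarrow> slice i F = 0" "slice un F = 0"
  using assms unfolding cosyz_def by auto

lemma cosyz_glueI:
  assumes "\<And>r. r \<in> R \<Longrightarrow> f r \<in> V" "\<And>r s. r \<in> R \<Longrightarrow> s \<in> R \<Longrightarrow> f (r + s) = f r + f s"
    "\<And>c r. r \<in> R \<Longrightarrow> f (c *s r) = c *s f r" "\<And>i. i \<in> I \<Longrightarrow> f i = 0" "f un = 0"
  shows "glue R f \<in> cosyz V"
  using assms un(1) by (auto simp: cosyz_def slice_glue glue_Nil R_closed I_R)

lemma cosyz_eqI:
  assumes "F \<in> cosyz V" "H \<in> cosyz V'" "\<And>r. r \<in> R \<Longrightarrow> slice r F = slice r H"
  shows "F = H"
proof (rule slice_eqI)
  show "slice r F = slice r H" for r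
    using assms(3)[of r] cosyzD(2)[OF assms(1), of r] cosyzD(2)[OF assms(2), of r]
    by (cases "r \<in> R") simp_all
qed (simp add: cosyzD(1)[OF assms(1)] cosyzD(1)[OF assms(2)])

lemma cosyz_mono: "U \<subseteq> V \<Longrightarrow> cosyz U \<subseteq> cosyz V"
  by (auto simp: cosyz_def)

lemma cosyz_subspace:
  assumes "fs.subspace V"
  shows "fs.subspace (cosyz V)"
  unfolding fs.subspace_def cosyz_def
  using assms
  by (auto simp: slice_add slice_scale slice_zero pointwise fs.subspace_def
      fs.scale_right_distrib algebra_simps)

text \<open>A linear map that kills \<open>I\<close> does not see the difference between
  \<open>r\<close> and its part supported on the finite set \<open>G\<close>. This is behind the
  finite dimension of cosyzygies and of the dual.\<close>

lemma coordinates: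
  assumes r: "r \<in> R" and add: "\<And>r s. r \<in> R \<Longrightarrow> s \<in> R \<Longrightarrow> \<phi> (r + s) = \<phi> r + \<phi> s"
    and scale: "\<And>r c. r \<in> R \<Longrightarrow> \<phi> (c *s r) = c *s \<phi> r" and I0: "\<And>i. i \<in> I \<Longrightarrow> \<phi> i = 0"
  shows "\<phi> r = (\<Sum>g\<in>G. r g *s \<phi> (\<lambda>p. if p = g then 1 else 0))"
proof -
  define \<delta> where "\<delta> = (\<lambda>(g::'p) p. if p = g then 1 else 0 :: 'k)"
  have sR: "(\<Sum>g\<in>H. r g *s \<delta> g) \<in> R" if "H \<subseteq> G" for H
    using that G(2) R_closed unfolding \<delta>_def by (intro fs.subspace_sum[OF R]) auto
  have ss: "\<phi> (\<Sum>g\<in>H. r g *s \<delta> g) = (\<Sum>g\<in>H. r g *s \<phi> (\<delta> g))"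
    if "finite H" "H \<subseteq> G" for H
    using that
  proof (induction H rule: finite_induct)
    case empty
    show ?case using scale[OF R_closed(3), of 0] by simp
  next
    case (insert h H)
    then have "r h *s \<delta> h \<in> R" "\<delta> h \<in> R" using G(2) R_closed unfolding \<delta>_def by auto
    then show ?case using insert add[OF _ sR] scale by simp
  qed
  have i: "r - (\<Sum>g\<in>G. r g *s \<delta> g) \<in> I" using G_span[OF r] by (simp add: \<delta>_def)
  have "\<phi> r = \<phi> ((r - (\<Sum>g\<in>G. r g *s \<delta> g)) + (\<Sum>g\<in>G. r g *s \<delta> g))" by simp
  also have "\<dots> = \<phi> (\<Sum>g\<in>G. r g *s \<delta> g)" using add[OF I_R[OF i] sR[of G]] I0[OF i] by simp
  finally show ?thesis using ss G by (simp add: \<delta>_def)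
qed

lemma cosyz_fin_dim:
  assumes "fin_dim V"
  shows "fin_dim (cosyz V)"
proof -
  obtain S where S: "finite S" "V \<subseteq> fs.span S" using assms by (auto simp: fin_dim_def)
  define \<delta> where "\<delta> = (\<lambda>(g::'p) p. if p = g then 1 else 0 :: 'k)"
  \<comment> \<open>Rank one maps, sending \<open>r\<close> to its coefficient at \<open>g\<close>
    times \<open>v\<close>. They need not lie in \<open>cosyz V\<close>; it suffices that their span
    contains it.\<close>
  define E where "E = (\<lambda>g v. glue R (\<lambda>r. r g *s v))"
  have linE: "lin (E g)" for g unfolding E_def by (intro lin_glue lin_intros)
  have "F \<in> fs.span (\<Union>g\<in>G. E g ` S)" if F: "F \<in> cosyz V" for F
  proof -
    have sl: "slice r F = (\<Sum>g\<in>G. r g *s slice (\<delta> g) F)" if "r \<in> R" for r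
      unfolding \<delta>_def by (rule coordinates[OF that cosyzD(4,5,6)[OF F]])
    have "F = (\<Sum>g\<in>G. E g (slice (\<delta> g) F))"
    proof (rule slice_eqI)
      have "(\<Sum>g\<in>H. E g (slice (\<delta> g) F)) [] = 0" for H
        by (induction H rule: infinite_finite_induct) (auto simp: E_def glue_Nil pointwise)
      then show "F [] = (\<Sum>g\<in>G. E g (slice (\<delta> g) F)) []" using cosyzD(1)[OF F] by simp
      fix r show "slice r F = slice r (\<Sum>g\<in>G. E g (slice (\<delta> g) F))"
        using sl[of r] cosyzD(2)[OF F, of r]
        by (cases "r \<in> R") (simp_all add: lin_sum[OF lin_slice] E_def slice_glue)
    qed
    moreover have "E g (slice (\<delta> g) F) \<in> fs.span (\<Union>g\<in>G. E g ` S)" if "g \<in> G" for g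
    proof -
      have "slice (\<delta> g) F \<in> fs.span S" using cosyzD(3)[OF F] G(2)[OF that] S by (auto simp: \<delta>_def)
      then have "E g (slice (\<delta> g) F) \<in> fs.span (E g ` S)"
        using fsp.linear_span_image[OF linE, of g S] by blast
      moreover have "E g ` S \<subseteq> (\<Union>g\<in>G. E g ` S)" using that by auto
      ultimately show ?thesis using subsetD[OF fs.span_mono] by metis
    qed
    ultimately show ?thesis using fs.span_sum[of G "\<lambda>g. E g (slice (\<delta> g) F)"] by simp
  qed
  moreover have "finite (\<Union>g\<in>G. E g ` S)" using S G by auto
  ultimately show ?thesis using cosyz_subspace assms unfolding fin_dim_def by blast
qed

lemma cosyz_rmod:
  assumes "rmod V act"
  shows "rmod (cosyz V) (cosyz_act act)"
proof -
  note D = rmodD[OF assms]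
  note closed = mul_closed R_closed I_R un(1)
  have mem: "cosyz_act act r F \<in> cosyz V" if r: "r \<in> R" and F: "F \<in> cosyz V" for r F
    unfolding cosyz_act_def
  proof (rule cosyz_glueI)
    note E = cosyzD[OF F]
    show "slice (r \<cdot> s) F - act s (slice r F) \<in> V" if "s \<in> R" for s
      using that r by (intro fs.subspace_diff[OF D(2)] E(3) D(4) mul_closed)
    show "slice (r \<cdot> (s + t)) F - act (s + t) (slice r F)
        = slice (r \<cdot> s) F - act s (slice r F) + (slice (r \<cdot> t) F - act t (slice r F))"
      if "s \<in> R" "t \<in> R" for s t
      using that r by (simp add: mul_add_right closed E D)
    show "slice (r \<cdot> (c *s s)) F - act (c *s s) (slice r F)
        = c *s (slice (r \<cdot> s) F - act s (slice r F))" if "s \<in> R" for c s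
      using that r by (simp add: mul_scale_right closed E D fs.scale_right_diff_distrib)
    show "slice (r \<cdot> i) F - act i (slice r F) = 0" if "i \<in> I" for i
      using that r by (simp add: I_left E D)
    show "slice (r \<cdot> un) F - act un (slice r F) = 0" using r by (simp add: un E D)
  qed
  have sl: "slice s (cosyz_act act r F) = slice (r \<cdot> s) F - act s (slice r F)" if "s \<in> R" for r s F
    using that by (simp add: cosyz_act_def slice_glue)
  have "lin (cosyz_act act r)" for r
    unfolding cosyz_act_def by (intro lin_glue lin_intros lin_slice lin_app[OF D(3)])
  moreover have "cosyz_act act (r + s) F = cosyz_act act r F + cosyz_act act s F"
    if "r \<in> R" "s \<in> R" "F \<in> cosyz V" for r s F
    using that
    by (intro cosyz_eqI[OF mem fs.subspace_add[OF cosyz_subspace[OF D(2)] mem mem]])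
      (simp_all add: sl slice_add mul_add_left closed cosyzD[OF that(3)] lin_add[OF D(3)])
  moreover have "cosyz_act act (c *s r) F = c *s cosyz_act act r F"
    if "r \<in> R" "F \<in> cosyz V" for c r F
    using that
    by (intro cosyz_eqI[OF mem fs.subspace_scale[OF cosyz_subspace[OF D(2)] mem]])
      (simp_all add: sl slice_scale mul_scale_left closed cosyzD[OF that(2)] lin_scale[OF D(3)]
        fs.scale_right_diff_distrib)
  moreover have "cosyz_act act (r \<cdot> s) F = cosyz_act act s (cosyz_act act r F)"
    if "r \<in> R" "s \<in> R" "F \<in> cosyz V" for r s F
    using that
    by (intro cosyz_eqI[OF mem mem[OF _ mem]])
      (simp_all add: sl closed mul_assoc cosyzD[OF that(3)] D(7) lin_diff[OF D(3)])
  moreover have "cosyz_act act un F = F" if "F \<in> cosyz V" for F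
    by (intro cosyz_eqI[OF mem that]) (simp_all add: sl un that cosyzD[OF that] lin_0[OF D(3)])
  moreover have "cosyz_act act i F = 0" if "i \<in> I" "F \<in> cosyz V" for i F
    by (intro cosyz_eqI[OF mem fs.subspace_0[OF cosyz_subspace[OF D(2)]]])
      (simp_all add: sl I_R I_right slice_zero that cosyzD[OF that(2)] lin_0[OF D(3)])
  ultimately show ?thesis using mem cosyz_fin_dim[OF D(1)] unfolding rmod_def by blast
qed

lemma cosyz_hom:
  assumes "rmod V act" "rhom V act W act' f"
  shows "rhom (cosyz V) (cosyz_act act) (cosyz W) (cosyz_act act') (cosyz_map f)"
proof -
  have f: "lin f" "\<And>v. v \<in> V \<Longrightarrow> f v \<in> W" "\<And>r v. r \<in> R \<Longrightarrow> v \<in> V \<Longrightarrow> f (act r v) = act' r (f v)"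
    using assms by (auto simp: rhom_def)
  have "cosyz_map f F \<in> cosyz W" if "F \<in> cosyz V" for F
    unfolding cosyz_map_def using cosyzD[OF that] f
    by (intro cosyz_glueI) (auto simp: lin_add[OF f(1)] lin_scale[OF f(1)] lin_0[OF f(1)])
  moreover have "lin (cosyz_map f)"
    unfolding cosyz_map_def by (intro lin_glue lin_app[OF f(1)] lin_slice)
  moreover have "cosyz_map f (cosyz_act act r F) = cosyz_act act' r (cosyz_map f F)"
    if "r \<in> R" "F \<in> cosyz V" for r F
  proof (rule slice_eqI)
    fix s
    have "s \<in> R \<Longrightarrow> f (act s (slice r F)) = act' s (f (slice r F))"
      using that cosyzD(3)[OF that(2)] f(3) by blast
    then show "slice s (cosyz_map f (cosyz_act act r F)) = slice s (cosyz_act act' r (cosyz_map f F))"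
      using that(1)
      by (simp add: cosyz_map_def cosyz_act_def slice_glue mul_closed lin_diff[OF f(1)])
  qed (simp add: cosyz_map_def cosyz_act_def glue_Nil)
  ultimately show ?thesis by (auto simp: rhom_def)
qed

section \<open>Iterated cosyzygies, cocycles and dimension shifting\<close>

lemma iterate_rmod: "rmod V act \<Longrightarrow> rmod ((cosyz ^^ n) V) ((cosyz_act ^^ n) act)"
  by (induction n) (simp_all add: cosyz_rmod)

lemma iterate_hom:
  assumes "rmod V act" "rhom V act W act' f"
  shows "rhom ((cosyz ^^ n) V) ((cosyz_act ^^ n) act) ((cosyz ^^ n) W) ((cosyz_act ^^ n) act')
    ((cosyz_map ^^ n) f)"
  using assms by (induction n) (simp_all add: cosyz_hom iterate_rmod)

lemma iterate_mono: "U \<subseteq> V \<Longrightarrow> (cosyz ^^ n) U \<subseteq> (cosyz ^^ n) V"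
  by (induction n) (simp_all add: cosyz_mono)

lemma iterate_zero: "(cosyz ^^ n) {0} = {0}"
proof (induction n)
  case (Suc n)
  have "F = 0" if "F \<in> cosyz {0}" for F
    using cosyzD(2,3)[OF that] cosyzD(1)[OF that]
    by - (rule slice_eqI, simp add: zero_fun_apply, simp add: slice_zero, blast)
  moreover have "0 \<in> cosyz {0}" by (simp add: cosyz_def slice_zero zero_fun_apply)
  ultimately have "cosyz {0} = {0}" by blast
  with Suc show ?case by simp
qed simp

text \<open>\<open>c r\<close> is the off-diagonal entry of an action of \<open>r\<close> on the
  direct sum of \<open>Y\<close> and \<open>M\<close> that makes it an extension of \<open>M\<close>
  by \<open>Y\<close>; the last condition is associativity of this action.\<close>

definition cocycle where
  "cocycle M actM Y actY c \<longleftrightarrow> (\<forall>r. lin (c r)) \<and> (\<forall>r\<in>R. \<forall>m\<in>M. c r m \<in> Y) \<and>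
    (\<forall>r\<in>R. \<forall>s\<in>R. \<forall>m\<in>M. c (r + s) m = c r m + c s m) \<and>
    (\<forall>a. \<forall>r\<in>R. \<forall>m\<in>M. c (a *s r) m = a *s c r m) \<and>
    (\<forall>i\<in>I. \<forall>m\<in>M. c i m = 0) \<and>
    (\<forall>r\<in>R. \<forall>s\<in>R. \<forall>m\<in>M. c (r \<cdot> s) m = c s (actM r m) + actY s (c r m))"

lemma cocycleD:
  assumes "cocycle M actM Y actY c"
  shows "lin (c r)" "r \<in> R \<Longrightarrow> m \<in> M \<Longrightarrow> c r m \<in> Y"
    "r \<in> R \<Longrightarrow> s \<in> R \<Longrightarrow> m \<in> M \<Longrightarrow> c (r + s) m = c r m + c s m"
    "r \<in> R \<Longrightarrow> m \<in> M \<Longrightarrow> c (a *s r) m = a *s c r m"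
    "i \<in> I \<Longrightarrow> m \<in> M \<Longrightarrow> c i m = 0"
    "r \<in> R \<Longrightarrow> s \<in> R \<Longrightarrow> m \<in> M \<Longrightarrow> c (r \<cdot> s) m = c s (actM r m) + actY s (c r m)"
  using assms unfolding cocycle_def by simp_all

text \<open>\<open>Ext\<^sup>1(M, Y) = 0\<close>\<close>

definition ext_zero where
  "ext_zero M actM Y actY \<longleftrightarrow> (\<forall>c. cocycle M actM Y actY c \<longrightarrow>
    (\<exists>h. lin h \<and> h ` M \<subseteq> Y \<and> (\<forall>r\<in>R. \<forall>m\<in>M. c r m = h (actM r m) - actY r (h m))))"

lemma ext_zeroD:
  assumes "ext_zero M actM Y actY" "cocycle M actM Y actY c"
  obtains h where "lin h" "\<And>m. m \<in> M \<Longrightarrow> h m \<in> Y"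
    "\<And>r m. r \<in> R \<Longrightarrow> m \<in> M \<Longrightarrow> c r m = h (actM r m) - actY r (h m)"
proof -
  obtain h where h: "lin h" "h ` M \<subseteq> Y"
      "\<forall>r\<in>R. \<forall>m\<in>M. c r m = h (actM r m) - actY r (h m)"
    using assms(1)[unfolded ext_zero_def, rule_format, OF assms(2)] by (elim exE conjE)
  show thesis
  proof (rule that[OF h(1)])
    show "h m \<in> Y" if "m \<in> M" for m using h(2) that by auto
    show "c r m = h (actM r m) - actY r (h m)" if "r \<in> R" "m \<in> M" for r m
      using h(3) that by simp
  qed
qed

text \<open>For projective \<open>P\<close>, extensions of \<open>M\<close> by
  \<open>cosyz Y\<close> and of \<open>N\<close> by \<open>Y\<close> both compute
  \<open>Ext^2(M, Y)\<close>. Concretely, a cocycle becomes trivial on \<open>P\<close> through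
  \<open>h\<close>; the restriction of \<open>h\<close> to \<open>N\<close> is a homomorphism, which
  is extended to a homomorphism \<open>k\<close> on \<open>P\<close>; then \<open>h - k\<close>
  descends to \<open>M\<close>.\<close>

lemma ext_zero_shift:
  assumes P: "rmod P actP" and Y: "rmod Y actY"
    and \<pi>: "rhom P actP M actM \<pi>" "\<pi> ` P = M"
    and N: "N = {p \<in> P. \<pi> p = 0}"
    and EP: "ext_zero P actP (cosyz Y) (cosyz_act actY)"
    and EN: "ext_zero N actP Y actY"
  shows "ext_zero M actM (cosyz Y) (cosyz_act actY)"
  unfolding ext_zero_def
proof (intro allI impI)
  fix c assume c: "cocycle M actM (cosyz Y) (cosyz_act actY) c"
  note DP = rmodD[OF P] and DY = rmodD[OF Y]
  have lp: "lin \<pi>" using \<pi> by (simp add: rhom_def)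
  have hp: "\<pi> (actP r p) = actM r (\<pi> p)" if "r \<in> R" "p \<in> P" for r p
    using \<pi> that by (auto simp: rhom_def)
  have pM: "\<pi> p \<in> M" if "p \<in> P" for p using \<pi> that by auto
  have "cocycle P actP (cosyz Y) (cosyz_act actY) (\<lambda>r p. c r (\<pi> p))"
    unfolding cocycle_def using cocycleD[OF c] hp pM lin_app[OF cocycleD(1)[OF c] lp] by auto
  then obtain h where h: "lin h" "\<And>p. p \<in> P \<Longrightarrow> h p \<in> cosyz Y"
    "\<And>r p. r \<in> R \<Longrightarrow> p \<in> P \<Longrightarrow> c r (\<pi> p) = h (actP r p) - cosyz_act actY r (h p)"
    using ext_zeroD[OF EP] by blast
  have sN: "fs.subspace N" unfolding N using DP(2)
    by (auto simp: fs.subspace_def lin_0[OF lp] lin_add[OF lp] lin_scale[OF lp])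
  have NP: "n \<in> P" if "n \<in> N" for n using that N by auto
  have hN: "h (actP r n) = cosyz_act actY r (h n)" if "r \<in> R" "n \<in> N" for r n
    using h(3)[OF that(1) NP[OF that(2)]] that N lin_0[OF cocycleD(1)[OF c]] by auto
  \<comment> \<open>The slices of \<open>h n\<close> form the cocycle of the extension of
    \<open>N\<close> by \<open>Y\<close> obtained by pulling \<open>Hom(\<Lambda>, Y)\<close> back
    along \<open>h\<close>.\<close>
  have "cocycle N actP Y actY (\<lambda>r n. slice r (h n))"
    unfolding cocycle_def
  proof (intro conjI allI ballI)
    show "lin (\<lambda>n. slice r (h n))" for r by (intro lin_app[OF lin_slice] h)
    fix r n assume rn: "r \<in> R" "n \<in> N"
    note E = cosyzD[OF h(2)[OF NP[OF rn(2)]]]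
    show "slice r (h n) \<in> Y" using rn E by auto
    show "slice (a *s r) (h n) = a *s slice r (h n)" for a using rn E by auto
    fix s assume s: "s \<in> R"
    show "slice (r + s) (h n) = slice r (h n) + slice s (h n)" using rn s E by auto
    show "slice (r \<cdot> s) (h n) = slice s (h (actP r n)) + actY s (slice r (h n))"
      using rn s by (simp add: hN cosyz_act_def slice_glue)
  qed (use cosyzD(6)[OF h(2)[OF NP]] in auto)
  then obtain g0 where g0: "lin g0" "\<And>n. n \<in> N \<Longrightarrow> g0 n \<in> Y"
    "\<And>r n. r \<in> R \<Longrightarrow> n \<in> N \<Longrightarrow> slice r (h n) = g0 (actP r n) - actY r (g0 n)"
    using ext_zeroD[OF EN] by blast
  obtain q where q: "lin q" "\<And>v. q v \<in> N" "\<And>u. u \<in> N \<Longrightarrow> q u = u"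
    using lin_projection[OF sN] by blast
  \<comment> \<open>A merely linear extension of \<open>g0\<close> suffices: a linear map from
    \<open>P\<close> to \<open>Y\<close> yields a homomorphism from \<open>P\<close> to
    \<open>Hom(\<Lambda>, Y)\<close>, and \<open>k\<close> below is its class, normalised at the
    unit.\<close>
  define g where "g = (\<lambda>p. g0 (q p))"
  have g: "lin g" "\<And>p. g p \<in> Y" unfolding g_def using g0 q by (auto intro: lin_app[OF g0(1) q(1)])
  have actN: "actP r n \<in> N" if "r \<in> R" "n \<in> N" for r n
    using that N DP(4) hp[of r n] lin_0[OF lp] hp[OF that(1), of 0] fs.subspace_0[OF DP(2)]
      lin_0[OF DP(3)] by auto
  define k where "k = (\<lambda>p. glue R (\<lambda>s. g (actP s p) - actY s (g p)))"
  have lk: "lin k" unfolding k_def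
    by (intro lin_glue lin_intros lin_app[OF g(1)] lin_app[OF DY(3)] DP(3) g)
  have kY: "k p \<in> cosyz Y" if "p \<in> P" for p
    unfolding k_def using that g
    by (intro cosyz_glueI fs.subspace_diff[OF DY(2)])
      (simp_all add: DP DY lin_add[OF g(1)] lin_scale[OF g(1)] lin_0[OF g(1)] algebra_simps
        fs.scale_right_diff_distrib)
  have khom: "k (actP r p) = cosyz_act actY r (k p)" if "r \<in> R" "p \<in> P" for r p
  proof (rule slice_eqI)
    fix s
    have "s \<in> R \<Longrightarrow> actP (r \<cdot> s) p = actP s (actP r p)"
      "s \<in> R \<Longrightarrow> actY (r \<cdot> s) (g p) = actY s (actY r (g p))"
      using DP(7) DY(7) that g by blast+
    then show "slice s (k (actP r p)) = slice s (cosyz_act actY r (k p))"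
      using that by (simp add: k_def cosyz_act_def slice_glue mul_closed lin_diff[OF DY(3)])
  qed (simp add: k_def cosyz_act_def glue_Nil)
  have kN: "k n = h n" if "n \<in> N" for n
    by (rule cosyz_eqI[OF kY[OF NP[OF that]] h(2)[OF NP[OF that]]])
      (simp add: k_def slice_glue g0(3) g_def q(3) actN that)
  obtain \<sigma> where \<sigma>: "lin \<sigma>" "\<And>w. \<sigma> w \<in> P" "\<And>v. v \<in> P \<Longrightarrow> \<pi> (\<sigma> (\<pi> v)) = \<pi> v"
    using lin_section[OF lp DP(2)] by blast
  \<comment> \<open>As \<open>h\<close> and \<open>k\<close> agree on \<open>N\<close>, the choice
    of the linear section does not matter.\<close>
  define h' where "h' = (\<lambda>m. h (\<sigma> m) - k (\<sigma> m))"
  have h'p: "h' (\<pi> p) = h p - k p" if "p \<in> P" for p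
  proof -
    have "\<sigma> (\<pi> p) - p \<in> N"
      using that \<sigma> N fs.subspace_diff[OF DP(2)] by (auto simp: lin_diff[OF lp])
    then have "h (\<sigma> (\<pi> p) - p) = k (\<sigma> (\<pi> p) - p)" using kN by simp
    then show ?thesis by (simp add: h'_def lin_diff[OF h(1)] lin_diff[OF lk] algebra_simps)
  qed
  have la: "lin (cosyz_act actY r)" for r using cosyz_rmod[OF Y] rmodD by blast
  have "lin h'" unfolding h'_def by (intro lin_intros lin_app[OF h(1)] lin_app[OF lk] \<sigma>)
  moreover have "h' ` M \<subseteq> cosyz Y" unfolding h'_def
    using fs.subspace_diff[OF cosyz_subspace[OF DY(2)] h(2) kY] \<sigma>(2) by auto
  moreover have "c r m = h' (actM r m) - cosyz_act actY r (h' m)" if rm: "r \<in> R" "m \<in> M" for r m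
  proof -
    obtain p where p: "p \<in> P" "m = \<pi> p" using rm \<pi> by auto
    have "h' (actM r m) = h (actP r p) - k (actP r p)"
      using h'p[of "actP r p"] p rm DP(4) hp by auto
    then show ?thesis using h(3)[OF rm(1) p(1)] khom[OF rm(1) p(1)] h'p[OF p(1)] p
      by (simp add: lin_diff[OF la])
  qed
  ultimately show "\<exists>h. lin h \<and> h ` M \<subseteq> cosyz Y \<and>
      (\<forall>r\<in>R. \<forall>m\<in>M. c r m = h (actM r m) - cosyz_act actY r (h m))" by blast
qed

text \<open>Each cosyzygy taken of \<open>Y\<close> is traded by \<open>ext_zero_shift\<close> for
  one step further in the resolution, where vanishing is known from index \<open>n\<close>
  on.\<close>

lemma ext_zero_resolution:
  assumes P: "\<And>i. rmod (P i) (actP i)"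
    and EP: "\<And>i (Y :: (('p \<Rightarrow> 'k) list \<Rightarrow> 'k) set) actY. rmod Y actY \<Longrightarrow> ext_zero (P i) (actP i) Y actY"
    and K: "\<And>i. rhom (P (Suc i)) (actP (Suc i)) (K i) (actP i) (d i)" "\<And>i. d i ` P (Suc i) = K i"
      "\<And>i. K (Suc i) = {p \<in> P (Suc i). d i p = 0}"
    and Y: "rmod Y actY" and E: "\<And>i. i \<ge> n \<Longrightarrow> ext_zero (K i) (actP i) Y actY"
    and ij: "i + j \<ge> n"
  shows "ext_zero (K i) (actP i) ((cosyz ^^ j) Y) ((cosyz_act ^^ j) actY)"
  using ij
proof (induction j arbitrary: i)
  case 0
  then show ?case using E by simp
next
  case (Suc j)
  have "ext_zero (K (Suc i)) (actP (Suc i)) ((cosyz ^^ j) Y) ((cosyz_act ^^ j) actY)"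
    using Suc.prems by (intro Suc.IH) simp
  from ext_zero_shift[OF P iterate_rmod[OF Y] K EP[OF cosyz_rmod[OF iterate_rmod[OF Y]]] this]
  show ?case by simp
qed

text \<open>Functionals on the algebra are stored as functions of one-element lists.\<close>

definition dual :: "(('p \<Rightarrow> 'k) \<Rightarrow> 'k) \<Rightarrow> ('p \<Rightarrow> 'k) list \<Rightarrow> 'k" where
  "dual f = (\<lambda>l. if length l = 1 \<and> hd l \<in> R then f (hd l) else 0)"

definition dual_alg :: "(('p \<Rightarrow> 'k) list \<Rightarrow> 'k) set" where
  "dual_alg = {F. F = dual (\<lambda>r. F [r]) \<and> (\<forall>r\<in>R. \<forall>s\<in>R. F [r + s] = F [r] + F [s]) \<and>
    (\<forall>c. \<forall>r\<in>R. F [c *s r] = c * F [r]) \<and> (\<forall>i\<in>I. F [i] = 0)}"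

definition dual_act :: "('p \<Rightarrow> 'k) \<Rightarrow> (('p \<Rightarrow> 'k) list \<Rightarrow> 'k) \<Rightarrow> ('p \<Rightarrow> 'k) list \<Rightarrow> 'k" where
  "dual_act r F = dual (\<lambda>s. F [r \<cdot> s])"

lemma dual_apply: "r \<in> R \<Longrightarrow> dual f [r] = f r"
  by (simp add: dual_def)

lemma dual_cong: "(\<And>r. r \<in> R \<Longrightarrow> f r = g r) \<Longrightarrow> dual f = dual g"
  by (auto simp: dual_def fun_eq_iff)

lemma dual_dual: "dual (\<lambda>r. dual f [r]) = dual f"
  by (rule dual_cong) (simp add: dual_apply)

lemma dual_algD:
  assumes "F \<in> dual_alg"
  shows "F = dual (\<lambda>r. F [r])" "r \<in> R \<Longrightarrow> s \<in> R \<Longrightarrow> F [r + s] = F [r] + F [s]"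
    "r \<in> R \<Longrightarrow> F [c *s r] = c * F [r]" "i \<in> I \<Longrightarrow> F [i] = 0"
  using assms unfolding dual_alg_def by blast+

lemma dual_algI:
  assumes "\<And>r s. r \<in> R \<Longrightarrow> s \<in> R \<Longrightarrow> f (r + s) = f r + f s"
    "\<And>c r. r \<in> R \<Longrightarrow> f (c *s r) = c * f r" "\<And>i. i \<in> I \<Longrightarrow> f i = 0"
  shows "dual f \<in> dual_alg"
  using assms by (simp add: dual_alg_def dual_dual dual_apply R_closed I_R)

lemma dual_alg_eqI:
  assumes "F \<in> dual_alg" "H \<in> dual_alg" "\<And>r. r \<in> R \<Longrightarrow> F [r] = H [r]"
  shows "F = H"
  using dual_algD(1)[OF assms(1)] dual_algD(1)[OF assms(2)] dual_cong[of "\<lambda>r. F [r]", OF assms(3)]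
  by simp

lemma lin_dual:
  assumes "\<And>r F H. f r (F + H) = f r F + f r H" "\<And>r c F. f r (c *s F) = c * f r F"
  shows "lin (\<lambda>F. dual (\<lambda>r. f r F))"
  by (rule linI) (auto simp: dual_def fun_eq_iff pointwise assms)

lemma dual_alg_rmod: "rmod dual_alg dual_act"
proof -
  have sub: "fs.subspace dual_alg"
    unfolding fs.subspace_def
  proof (intro conjI ballI allI)
    have "dual (\<lambda>_. 0) \<in> dual_alg" by (rule dual_algI) simp_all
    moreover have "dual (\<lambda>_. 0) = 0" by (auto simp: dual_def fun_eq_iff pointwise)
    ultimately show "0 \<in> dual_alg" by simp
  next
    fix F H assume FH: "F \<in> dual_alg" "H \<in> dual_alg"
    note D = dual_algD[OF FH(1)] and D' = dual_algD[OF FH(2)]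
    have "dual (\<lambda>r. F [r] + H [r]) \<in> dual_alg"
      by (rule dual_algI) (simp_all add: D(2-4) D'(2-4) algebra_simps)
    moreover have "F + H = dual (\<lambda>r. F [r] + H [r])"
      by (subst D(1), subst D'(1)) (auto simp: dual_def fun_eq_iff pointwise)
    ultimately show "F + H \<in> dual_alg" by simp
  next
    fix c F assume F: "F \<in> dual_alg"
    note D = dual_algD[OF F]
    have "dual (\<lambda>r. c * F [r]) \<in> dual_alg"
      by (rule dual_algI) (simp_all add: D(2-4) algebra_simps)
    moreover have "c *s F = dual (\<lambda>r. c * F [r])"
      by (subst D(1)) (auto simp: dual_def fun_eq_iff pointwise)
    ultimately show "c *s F \<in> dual_alg" by simp
  qed
  have "dual_alg \<subseteq> fs.span ((\<lambda>g. dual (\<lambda>r. r g)) ` G)"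
  proof
    fix F assume F: "F \<in> dual_alg"
    note D = dual_algD[OF F]
    let ?\<delta> = "\<lambda>g p. if p = g then 1 else 0"
    have c: "F [r] = (\<Sum>g\<in>G. r g * F [?\<delta> g])" if "r \<in> R" for r
    proof -
      \<comment> \<open>\<open>coordinates\<close> is about function-valued maps; a scalar is viewed
        as a function on the one-point type.\<close>
      have "(\<lambda>_::unit. F [r]) = (\<Sum>g\<in>G. r g *s (\<lambda>_. F [?\<delta> g]))"
        by (rule coordinates[OF that, of "\<lambda>r _. F [r]"]) (auto simp: fun_eq_iff pointwise D(2-4))
      from fun_cong[OF this, of "()"] show ?thesis by (simp add: sum_apply pointwise)
    qed
    have s: "(\<Sum>g\<in>H. F [?\<delta> g] *s dual (\<lambda>r. r g)) l = dual (\<lambda>r. \<Sum>g\<in>H. r g * F [?\<delta> g]) l" for H l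
      by (auto simp: sum_apply dual_def pointwise mult.commute intro: sum.neutral)
    have "F = dual (\<lambda>r. \<Sum>g\<in>G. r g * F [?\<delta> g])"
      using D(1) dual_cong[of "\<lambda>r. F [r]", OF c] by (rule trans)
    also have "\<dots> = (\<Sum>g\<in>G. F [?\<delta> g] *s dual (\<lambda>r. r g))" using s by auto
    also have "\<dots> \<in> fs.span ((\<lambda>g. dual (\<lambda>r. r g)) ` G)"
      by (intro fs.span_sum fs.span_scale fs.span_base imageI)
    finally show "F \<in> fs.span ((\<lambda>g. dual (\<lambda>r. r g)) ` G)" .
  qed
  then have fd: "fin_dim dual_alg" using sub G(1) unfolding fin_dim_def by blast
  have "lin (dual_act r)" for r
    unfolding dual_act_def by (rule lin_dual) (simp_all add: pointwise)
  moreover have "dual_act r F \<in> dual_alg" if "r \<in> R" "F \<in> dual_alg" for r F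
    unfolding dual_act_def using that dual_algD(2-4)[OF that(2)]
    by (intro dual_algI) (simp_all add: mul_add_right mul_scale_right mul_closed I_left)
  moreover have "dual_act (r + s) F = dual_act r F + dual_act s F"
    if "r \<in> R" "s \<in> R" "F \<in> dual_alg" for r s F
    using that dual_algD(2)[OF that(3)]
    by (auto simp: dual_act_def dual_def fun_eq_iff pointwise mul_add_left mul_closed)
  moreover have "dual_act (c *s r) F = c *s dual_act r F" if "r \<in> R" "F \<in> dual_alg" for c r F
    using that dual_algD(3)[OF that(2)]
    by (auto simp: dual_act_def dual_def fun_eq_iff pointwise mul_scale_left mul_closed)
  moreover have "dual_act (r \<cdot> s) F = dual_act s (dual_act r F)" if "r \<in> R" "s \<in> R" for r s F
    unfolding dual_act_def using that
    by (intro dual_cong) (simp add: dual_apply mul_closed mul_assoc)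
  moreover have "dual_act un F = F" if "F \<in> dual_alg" for F
    using dual_algD(1)[OF that] dual_cong[of "\<lambda>r. F [un \<cdot> r]" "\<lambda>r. F [r]"]
    by (simp add: dual_act_def un)
  moreover have "dual_act i F = 0" if "i \<in> I" "F \<in> dual_alg" for i F
    using dual_algD(4)[OF that(2)] that
    by (auto simp: dual_act_def dual_def fun_eq_iff pointwise I_right)
  ultimately show ?thesis using fd unfolding rmod_def by blast
qed

text \<open>The dual of the algebra is injective: evaluate a cocycle at the unit.\<close>

lemma ext_zero_dual: "ext_zero M actM dual_alg dual_act"
  unfolding ext_zero_def
proof (intro allI impI)
  fix c assume c: "cocycle M actM dual_alg dual_act c"
  note C = cocycleD[OF c]
  \<comment> \<open>The sign is forced by the cocycle identity for \<open>r \<cdot> s\<close> at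
    \<open>un\<close>, in which \<open>dual_act s (c r m)\<close> takes the value
    \<open>c r m [s]\<close>.\<close>
  define h where "h = (\<lambda>m. dual (\<lambda>s. - (c s m [un])))"
  have "lin h" unfolding h_def
    by (rule lin_dual) (simp_all add: lin_add[OF C(1)] lin_scale[OF C(1)] pointwise)
  moreover have hM: "h m \<in> dual_alg" if "m \<in> M" for m
    unfolding h_def using that by (intro dual_algI) (simp_all add: C(3-5) pointwise)
  moreover have "c r m = h (actM r m) - dual_act r (h m)" if rm: "r \<in> R" "m \<in> M" for r m
  proof (rule ext)
    fix l
    show "c r m l = (h (actM r m) - dual_act r (h m)) l"
    proof (cases "length l = 1 \<and> hd l \<in> R")
      case True
      then obtain s where s: "l = [s]" "s \<in> R" by (cases l) auto
      have "c (r \<cdot> s) m [un] = c s (actM r m) [un] + dual_act s (c r m) [un]"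
        using C(6)[OF rm(1) s(2) rm(2)] by (simp add: pointwise)
      also have "dual_act s (c r m) [un] = c r m [s]"
        using s un by (simp add: dual_act_def dual_apply)
      finally show ?thesis using s rm
        by (simp add: h_def dual_act_def dual_apply mul_closed pointwise)
    next
      case False
      have "c r m l = dual (\<lambda>s. c r m [s]) l" using dual_algD(1)[OF C(2)[OF rm]] by (rule fun_cong)
      also have "\<dots> = 0" using False by (simp only: dual_def if_False)
      finally show ?thesis using False by (auto simp: h_def dual_act_def dual_def pointwise)
    qed
  qed
  ultimately show "\<exists>h. lin h \<and> h ` M \<subseteq> dual_alg \<and>
      (\<forall>r\<in>R. \<forall>m\<in>M. c r m = h (actM r m) - dual_act r (h m))" by blast
qed

end

section \<open>The trace attached to a loop\<close>

text \<open>
  \<open>r \<mapsto> eps r + D r t\<close> is a homomorphism from the algebra onto \<open>k[t]/t\<^sup>2\<close>, mapping \<open>a\<close> to \<open>t\<close>.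
\<close>

locale looped_algebra = bound_algebra R mul un I G
  for R :: "('p \<Rightarrow> 'k::field) set" and mul (infixl \<open>\<cdot>\<close> 70) and un I G +
  fixes eps D :: "('p \<Rightarrow> 'k) \<Rightarrow> 'k" and a :: "'p \<Rightarrow> 'k"
  assumes eps_add: "r \<in> R \<Longrightarrow> s \<in> R \<Longrightarrow> eps (r + s) = eps r + eps s"
    and eps_scale: "r \<in> R \<Longrightarrow> eps (c *s r) = c * eps r"
    and eps_mul: "r \<in> R \<Longrightarrow> s \<in> R \<Longrightarrow> eps (r \<cdot> s) = eps r * eps s"
    and eps_un: "eps un = 1"
    and eps_I: "i \<in> I \<Longrightarrow> eps i = 0"
    and D_add: "r \<in> R \<Longrightarrow> s \<in> R \<Longrightarrow> D (r + s) = D r + D s"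
    and D_scale: "r \<in> R \<Longrightarrow> D (c *s r) = c * D r"
    and D_mul: "r \<in> R \<Longrightarrow> s \<in> R \<Longrightarrow> D (r \<cdot> s) = eps r * D s + D r * eps s"
    and D_un: "D un = 0"
    and D_I: "i \<in> I \<Longrightarrow> D i = 0"
    and a: "a \<in> R" "eps a = 0" "D a = 1"
    and a_nilpotent: "\<exists>m. \<forall>r\<in>R. ((\<lambda>s. s \<cdot> a) ^^ m) r \<in> I"
begin

text \<open>Not the whole socle, but its part made of copies of the simple module given by
  \<open>eps\<close>, that is, \<open>Hom(S, V)\<close>.\<close>

definition soc where
  "soc V act = {v \<in> V. \<forall>r\<in>R. act r v = eps r *s v}"

text \<open>
  \<open>\<tau>\<close> is a section of multiplication by \<open>t\<close> from the \<open>k[t]/t\<^sup>2\<close>-submodule \<open>Hom(k[t]/t\<^sup>2, V)\<close>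
  of \<open>V\<close> onto \<open>soc V\<close>. It exists if and only if that submodule is free.
\<close>

definition t_section where
  "t_section V act \<tau> \<longleftrightarrow> lin \<tau> \<and> \<tau> ` V \<subseteq> V \<and>
    (\<forall>u\<in>soc V act. \<forall>r\<in>R. act r (\<tau> u) = eps r *s \<tau> u + D r *s u)"

text \<open>\<open>Ext\<^sup>1(S, V) = 0\<close> for the one-dimensional module \<open>S\<close> given by \<open>eps\<close>\<close>

definition ext_simple_zero where
  "ext_simple_zero V act \<longleftrightarrow> (\<forall>c. (\<forall>r\<in>R. c r \<in> V) \<and>
    (\<forall>r\<in>R. \<forall>s\<in>R. c (r + s) = c r + c s) \<and> (\<forall>b. \<forall>r\<in>R. c (b *s r) = b *s c r) \<and>
    (\<forall>i\<in>I. c i = 0) \<and> (\<forall>r\<in>R. \<forall>s\<in>R. c (r \<cdot> s) = eps r *s c s + act s (c r)) \<longrightarrow>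
    (\<exists>z\<in>V. \<forall>r\<in>R. c r = eps r *s z - act r z))"

section \<open>Sections of multiplication by t and their commutators\<close>

lemma soc_subspace:
  assumes "rmod V act"
  shows "fs.subspace (soc V act)" "soc V act \<subseteq> V" "fin_dim (soc V act)"
proof -
  note D = rmodD[OF assms]
  show s: "fs.subspace (soc V act)"
    unfolding fs.subspace_def soc_def using D(2)
    by (auto simp: fs.subspace_def lin_0[OF D(3)] lin_add[OF D(3)] lin_scale[OF D(3)]
        fs.scale_right_distrib mult.commute)
  show "soc V act \<subseteq> V" by (auto simp: soc_def)
  then show "fin_dim (soc V act)" using fin_dim_subset[OF D(1) s] by blast
qed

lemma soc_hom:
  assumes "rhom V act W act' f" "u \<in> soc V act"
  shows "f u \<in> soc W act'"
proof -
  have u: "act r u = eps r *s u" if "r \<in> R" for r using assms that by (auto simp: soc_def)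
  have uV: "u \<in> V" using assms by (simp add: soc_def)
  have f: "lin f" "f u \<in> W" using assms uV by (auto simp: rhom_def)
  have "act' r (f u) = eps r *s f u" if "r \<in> R" for r
  proof -
    have "act' r (f u) = f (act r u)" using assms(1) uV that by (simp add: rhom_def)
    then show ?thesis by (simp add: u[OF that] lin_scale[OF f(1)])
  qed
  then show ?thesis using f(2) by (simp add: soc_def)
qed

text \<open>As \<open>D\<close> is a derivation with respect to \<open>eps\<close>,
  \<open>D r *s u\<close> is a cocycle of the simple module with values in \<open>V\<close>. If
  \<open>z\<close> trivialises it, then \<open>- z\<close> is the required lift.\<close>

lemma t_section_step:
  assumes V: "rmod V act" and E: "ext_simple_zero V act" and u: "u \<in> soc V act"
  shows "\<exists>v\<in>V. \<forall>r\<in>R. act r v = eps r *s v + D r *s u"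
proof -
  note DV = rmodD[OF V]
  have au: "act r u = eps r *s u" if "r \<in> R" for r using u that by (auto simp: soc_def)
  have uV: "u \<in> V" using u by (auto simp: soc_def)
  let ?c = "\<lambda>r. D r *s u"
  have "(\<forall>r\<in>R. ?c r \<in> V) \<and> (\<forall>r\<in>R. \<forall>s\<in>R. ?c (r + s) = ?c r + ?c s) \<and>
    (\<forall>b. \<forall>r\<in>R. ?c (b *s r) = b *s ?c r) \<and> (\<forall>i\<in>I. ?c i = 0) \<and>
    (\<forall>r\<in>R. \<forall>s\<in>R. ?c (r \<cdot> s) = eps r *s ?c s + act s (?c r))"
    using uV by (simp add: D_add D_scale D_I D_mul fs.subspace_scale[OF DV(2)] lin_scale[OF DV(3)] au
        fs.scale_left_distrib)
  from E[unfolded ext_simple_zero_def, rule_format, OF this]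
  obtain z where z: "z \<in> V" "\<forall>r\<in>R. D r *s u = eps r *s z - act r z" by blast
  have "act r (- z) = eps r *s (- z) + D r *s u" if "r \<in> R" for r
    using z(2) that by (simp add: lin_minus[OF DV(3)])
  then show ?thesis using z(1) fs.subspace_neg[OF DV(2)] by blast
qed

text \<open>Prescribing the section on a submodule makes the twists of \<open>V\<close> and
  \<open>W\<close> comparable. For a linear map the defining property need only be checked on a
  basis of \<open>soc V\<close>, which is taken to extend one of \<open>soc W\<close>.\<close>

lemma t_section_exists:
  assumes V: "rmod V act" and E: "ext_simple_zero V act"
    and W: "rmod W act" "W \<subseteq> V" "t_section W act \<tau>'"
  obtains \<tau> where "t_section V act \<tau>" "\<And>u. u \<in> soc W act \<Longrightarrow> \<tau> u = \<tau>' u"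
proof -
  note DV = rmodD[OF V]
  let ?U = "soc V act" and ?U' = "soc W act"
  have t': "lin \<tau>'" "\<And>w. w \<in> W \<Longrightarrow> \<tau>' w \<in> W"
    "\<And>u r. u \<in> ?U' \<Longrightarrow> r \<in> R \<Longrightarrow> act r (\<tau>' u) = eps r *s \<tau>' u + D r *s u"
    using W(3) by (auto simp: t_section_def)
  have sub: "?U' \<subseteq> ?U" "?U' \<subseteq> W" using W(2) by (auto simp: soc_def)
  obtain A B where AB: "basis_of ?U' A" "basis_of ?U B" "A \<subseteq> B"
    using basis_extend[OF soc_subspace(3)[OF V] soc_subspace(1)[OF W(1)] sub(1)] .
  have "\<forall>u. \<exists>v. u \<in> ?U \<longrightarrow> v \<in> V \<and> (\<forall>r\<in>R. act r v = eps r *s v + D r *s u)"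
    using t_section_step[OF V E] by blast
  then obtain g where g: "\<And>u. u \<in> ?U \<Longrightarrow> g u \<in> V \<and> (\<forall>r\<in>R. act r (g u) = eps r *s g u + D r *s u)"
    by metis
  obtain \<sigma> where \<sigma>: "lin \<sigma>" "\<And>b. b \<in> B \<Longrightarrow> \<sigma> b = (if b \<in> A then \<tau>' b else g b)"
    using lin_extend_basis[of B "\<lambda>b. if b \<in> A then \<tau>' b else g b"] AB(2) by (auto simp: basis_of_def)
  define good where "good = {u. \<sigma> u \<in> V \<and> (\<forall>r\<in>R. act r (\<sigma> u) = eps r *s \<sigma> u + D r *s u)}"
  have "fs.subspace good"
    unfolding good_def using DV(2) by (auto simp: fs.subspace_def lin_0[OF \<sigma>(1)] lin_add[OF \<sigma>(1)]
        lin_scale[OF \<sigma>(1)] lin_0[OF DV(3)] lin_add[OF DV(3)] lin_scale[OF DV(3)]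
        fs.scale_right_distrib algebra_simps)
  moreover have "B \<subseteq> good"
  proof
    fix b assume b: "b \<in> B"
    show "b \<in> good"
    proof (cases "b \<in> A")
      case True
      then have "b \<in> ?U'" using basis_of_mem[OF AB(1)] by blast
      moreover from this have "\<tau>' b \<in> V" using t'(2) sub W(2) by blast
      ultimately show ?thesis using True \<sigma>(2)[OF b] t'(3) by (simp add: good_def)
    next
      case False
      then show ?thesis using \<sigma>(2)[OF b] g basis_of_mem[OF AB(2) b] by (simp add: good_def)
    qed
  qed
  ultimately have good: "?U \<subseteq> good"
    using fs.span_minimal[of B good] AB(2) by (auto simp: basis_of_def)
  have agree: "\<sigma> u = \<tau>' u" if "u \<in> ?U'" for u
  proof (rule fsp.linear_eq_on[OF \<sigma>(1) t'(1)])
    show "u \<in> fs.span A" using that AB(1) by (simp add: basis_of_def)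
    show "\<sigma> b = \<tau>' b" if "b \<in> A" for b using \<sigma>(2)[of b] that AB(3) by auto
  qed
  \<comment> \<open>A section has to map all of \<open>V\<close> into \<open>V\<close>, while
    \<sigma> is controlled on the socle only; hence the projection.\<close>
  obtain q where q: "lin q" "\<And>v. q v \<in> ?U" "\<And>u. u \<in> ?U \<Longrightarrow> q u = u"
    using lin_projection[OF soc_subspace(1)[OF V]] by blast
  have "t_section V act (\<lambda>v. \<sigma> (q v))"
    unfolding t_section_def
  proof (intro conjI ballI)
    show "lin (\<lambda>v. \<sigma> (q v))" by (rule lin_app[OF \<sigma>(1) q(1)])
    show "(\<lambda>v. \<sigma> (q v)) ` V \<subseteq> V" using q(2) good by (auto simp: good_def)
    show "act r (\<sigma> (q u)) = eps r *s \<sigma> (q u) + D r *s u" if "u \<in> ?U" "r \<in> R" for u r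
      using that good q(3) by (auto simp: good_def)
  qed
  then show thesis by (rule that) (use q sub agree in auto)
qed

lemma t_section_ex:
  assumes "rmod V act" "ext_simple_zero V act"
  obtains \<tau> where "t_section V act \<tau>"
proof -
  note D = rmodD[OF assms(1)]
  have z: "rmod {0} act"
    by (rule rmod_submodule[OF assms(1)]) (auto simp: fs.subspace_0[OF D(2)] lin_0[OF D(3)])
  have "t_section {0} act (\<lambda>_. 0)"
    by (auto simp: t_section_def soc_def lin_zero lin_0[OF D(3)])
  then show thesis using t_section_exists[OF assms z] that fs.subspace_0[OF D(2)] by blast
qed

text \<open>
  The coefficient at \<open>t\<close> of the trace over \<open>k[t]/t\<^sup>2\<close> of the endomorphism of \<open>Hom(k[t]/t\<^sup>2, V)\<close> given by \<open>f\<close>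
\<close>

definition twist where
  "twist V act f \<tau> = trace_on (soc V act) (\<lambda>v. f (\<tau> v) - \<tau> (f v))"

text \<open>Both terms lift the same vector \<open>f u\<close> along multiplication by t, so that
  they differ by an element of the socle.\<close>

lemma commutator_soc:
  assumes V: "rmod V act" and f: "rhom V act V act f" and t: "t_section V act \<tau>" and u: "u \<in> soc V act"
  shows "f (\<tau> u) - \<tau> (f u) \<in> soc V act"
proof -
  note DV = rmodD[OF V]
  have f': "lin f" "\<And>v. v \<in> V \<Longrightarrow> f v \<in> V" "\<And>r v. r \<in> R \<Longrightarrow> v \<in> V \<Longrightarrow> f (act r v) = act r (f v)"
    using f by (auto simp: rhom_def)
  have t': "\<And>w. w \<in> V \<Longrightarrow> \<tau> w \<in> V"
    "\<And>u r. u \<in> soc V act \<Longrightarrow> r \<in> R \<Longrightarrow> act r (\<tau> u) = eps r *s \<tau> u + D r *s u"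
    using t by (auto simp: t_section_def)
  have uV: "u \<in> V" and fu: "f u \<in> soc V act" using u soc_hom[OF f u] by (auto simp: soc_def)
  have "act r (f (\<tau> u) - \<tau> (f u)) = eps r *s (f (\<tau> u) - \<tau> (f u))" if "r \<in> R" for r
  proof -
    have "act r (f (\<tau> u)) = f (eps r *s \<tau> u + D r *s u)"
      using f'(3)[OF that t'(1)[OF uV]] t'(2)[OF u that] by simp
    also have "\<dots> = eps r *s f (\<tau> u) + D r *s f u" by (simp add: lin_add[OF f'(1)] lin_scale[OF f'(1)])
    finally show ?thesis using t'(2)[OF fu that]
      by (simp add: lin_diff[OF DV(3)] fs.scale_right_diff_distrib)
  qed
  then show ?thesis using fs.subspace_diff[OF DV(2)] f'(2) t'(1) uV by (auto simp: soc_def)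
qed

lemma lin_commutator: "lin f \<Longrightarrow> lin g \<Longrightarrow> lin (\<lambda>v. f (g v) - g (f v))"
  using lin_minus'[OF lin_app lin_app, of f g g f] .

text \<open>
  Two sections differ by an endomorphism \<open>h\<close> of \<open>soc V\<close>, and the commutator of \<open>f\<close> and \<open>h\<close> has
  trace zero.
\<close>

lemma twist_indep:
  assumes V: "rmod V act" and f: "rhom V act V act f"
    and t: "t_section V act \<tau>" and t': "t_section V act \<tau>'"
  shows "twist V act f \<tau> = twist V act f \<tau>'"
proof -
  note DV = rmodD[OF V]
  let ?U = "soc V act" and ?h = "\<lambda>u. \<tau> u - \<tau>' u"
  have l: "lin f" "lin \<tau>" "lin \<tau>'" using f t t' by (auto simp: rhom_def t_section_def)
  have lh: "lin ?h" by (intro lin_intros l)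
  have hU: "?h ` ?U \<subseteq> ?U"
  proof
    fix w assume "w \<in> ?h ` ?U"
    then obtain u where u: "u \<in> ?U" "w = ?h u" by blast
    then have "u \<in> V" by (auto simp: soc_def)
    then have "\<tau> u \<in> V" "\<tau>' u \<in> V" using t t' by (auto simp: t_section_def)
    then have "w \<in> V" using u(2) fs.subspace_diff[OF DV(2)] by simp
    moreover have "act r w = eps r *s w" if "r \<in> R" for r
      using u t t' that
      by (simp add: t_section_def lin_diff[OF DV(3)] fs.scale_right_diff_distrib)
    ultimately show "w \<in> ?U" by (auto simp: soc_def)
  qed
  have fU: "f ` ?U \<subseteq> ?U" using soc_hom[OF f] by auto
  note fd = soc_subspace(3)[OF V]
  have c: "lin (\<lambda>v. f (\<sigma> v) - \<sigma> (f v))" "(\<lambda>v. f (\<sigma> v) - \<sigma> (f v)) ` ?U \<subseteq> ?U"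
    if "t_section V act \<sigma>" for \<sigma>
  proof -
    have "lin \<sigma>" using that by (simp add: t_section_def)
    then show "lin (\<lambda>v. f (\<sigma> v) - \<sigma> (f v))" by (rule lin_commutator[OF l(1)])
    show "(\<lambda>v. f (\<sigma> v) - \<sigma> (f v)) ` ?U \<subseteq> ?U" using commutator_soc[OF V f that] by auto
  qed
  have "twist V act f \<tau> - twist V act f \<tau>' = trace_on ?U (\<lambda>v. f (?h v) - ?h (f v))"
    unfolding twist_def trace_on_diff[OF fd c[OF t] c[OF t'], symmetric]
    by (rule trace_on_cong[OF fd]) (simp add: lin_diff[OF l(1)])
  also have "\<dots> = trace_on ?U (\<lambda>v. f (?h v)) - trace_on ?U (\<lambda>v. ?h (f v))"
    using hU fU by (intro trace_on_diff[OF fd] lin_app[OF l(1) lh] lin_app[OF lh l(1)]) auto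
  also have "\<dots> = 0" using trace_on_commute[OF fd l(1) fU lh hU] by simp
  finally show ?thesis by simp
qed

text \<open>Choose a section of \<open>V\<close> that extends the one of \<open>W\<close>. As
  \<open>f\<close> maps \<open>V\<close> into \<open>W\<close>, the commutator maps
  \<open>soc V\<close> into \<open>soc W\<close>, and \<open>trace_on_subspace\<close>
  applies.\<close>

lemma twist_submodule:
  assumes V: "rmod V act" "ext_simple_zero V act" and W: "rmod W act" "W \<subseteq> V"
    and f: "rhom V act V act f" "f ` V \<subseteq> W"
    and t: "t_section V act \<tau>" and t': "t_section W act \<tau>'"
  shows "twist V act f \<tau> = twist W act f \<tau>'"
proof -
  obtain \<sigma> where \<sigma>: "t_section V act \<sigma>" "\<And>u. u \<in> soc W act \<Longrightarrow> \<sigma> u = \<tau>' u"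
    using t_section_exists[OF V W t'] by blast
  let ?c = "\<lambda>v. f (\<sigma> v) - \<sigma> (f v)"
  have sub: "soc W act \<subseteq> soc V act" using W(2) by (auto simp: soc_def)
  have lf: "lin f" "lin \<sigma>" using f \<sigma> by (auto simp: rhom_def t_section_def)
  have fW: "f v \<in> soc W act" if "v \<in> soc V act" for v
  proof -
    have "f v \<in> soc V act" using soc_hom[OF f(1) that] .
    moreover have "f v \<in> W" using that f(2) by (auto simp: soc_def)
    ultimately show ?thesis by (auto simp: soc_def)
  qed
  have cW: "?c ` soc V act \<subseteq> soc W act"
  proof
    fix w assume "w \<in> ?c ` soc V act"
    then obtain v where v: "v \<in> soc V act" "w = ?c v" by blast
    have "v \<in> V" using v by (auto simp: soc_def)
    then have "f (\<sigma> v) \<in> W" using \<sigma>(1) f(2) by (auto simp: t_section_def)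
    moreover have "\<sigma> (f v) \<in> W"
      using fW[OF v(1)] \<sigma>(2)[OF fW[OF v(1)]] t' by (auto simp: t_section_def soc_def)
    ultimately have "w \<in> W" using v fs.subspace_diff[OF rmodD(2)[OF W(1)]] by blast
    then show "w \<in> soc W act"
      using commutator_soc[OF V(1) f(1) \<sigma>(1) v(1)] v(2) by (auto simp: soc_def)
  qed
  have "twist V act f \<tau> = trace_on (soc V act) ?c"
    using twist_indep[OF V(1) f(1) t \<sigma>(1)] by (simp add: twist_def)
  also have "\<dots> = trace_on (soc W act) ?c"
    by (rule trace_on_subspace[OF soc_subspace(3)[OF V(1)] soc_subspace(1)[OF W(1)] sub
        lin_commutator[OF lf] cW])
  also have "\<dots> = twist W act f \<tau>'"
    unfolding twist_def using \<sigma>(2) fW sub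
    by (intro trace_on_cong[OF soc_subspace(3)[OF W(1)]]) auto
  finally show ?thesis .
qed

text \<open>
  The socle of \<open>cosyz Y\<close> is \<open>Y / soc Y\<close>, on which the commutator attached to \<open>cosyz Y\<close> is induced
  by a commutator of endomorphisms of \<open>Y\<close>.
\<close>

lemma twist_cosyz:
  assumes Y: "rmod Y act" "ext_simple_zero Y act" and f: "rhom Y act Y act f"
    and t: "t_section Y act \<tau>"
  obtains \<tau>' where "t_section (cosyz Y) (cosyz_act act) \<tau>'"
    "twist (cosyz Y) (cosyz_act act) (cosyz_map f) \<tau>' = - twist Y act f \<tau>"
proof -
  note DY = rmodD[OF Y(1)]
  note closed = mul_closed R_closed I_R un(1)
  have f': "lin f" "\<And>v. v \<in> Y \<Longrightarrow> f v \<in> Y" "\<And>r v. r \<in> R \<Longrightarrow> v \<in> Y \<Longrightarrow> f (act r v) = act r (f v)"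
    using f by (auto simp: rhom_def)
  have t': "lin \<tau>" "\<And>w. w \<in> Y \<Longrightarrow> \<tau> w \<in> Y"
    "\<And>u r. u \<in> soc Y act \<Longrightarrow> r \<in> R \<Longrightarrow> act r (\<tau> u) = eps r *s \<tau> u + D r *s u"
    using t by (auto simp: t_section_def)
  note L = lin_add[OF DY(3)] lin_scale[OF DY(3)] lin_diff[OF DY(3)]
    lin_add[OF f'(1)] lin_scale[OF f'(1)] lin_diff[OF f'(1)]
    lin_add[OF t'(1)] lin_scale[OF t'(1)] lin_diff[OF t'(1)]
  \<comment> \<open>The class of the map \<open>s \<mapsto> eps s *s y\<close> in
    \<open>Hom(\<Lambda>, Y)\<close>, on which the algebra acts by \<open>eps\<close>, normalised at
    the unit.\<close>
  define \<pi> where "\<pi> = (\<lambda>y. glue R (\<lambda>s. eps s *s y - act s y))"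
  \<comment> \<open>The map \<open>s \<mapsto> D s *s y\<close> lifts
    \<open>s \<mapsto> eps s *s y\<close> along t. Adding \<open>eps s *s \<tau> y\<close> changes
    its class by \<open>\<pi> (\<tau> y)\<close>, which keeps it a lift and makes it vanish for
    \<open>y\<close> in the socle of \<open>Y\<close>.\<close>
  define k where "k = (\<lambda>y. glue R (\<lambda>s. (D s *s y + eps s *s \<tau> y) - act s (\<tau> y)))"
  have lpi: "lin \<pi>" unfolding \<pi>_def by (intro lin_glue lin_intros DY(3))
  have lk: "lin k" unfolding k_def by (intro lin_glue lin_intros t'(1) lin_app[OF DY(3)])
  note sub = fs.subspace_diff[OF DY(2)] fs.subspace_add[OF DY(2)] fs.subspace_scale[OF DY(2)]
  have pi_mem: "\<pi> y \<in> cosyz Y" if "y \<in> Y" for y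
    unfolding \<pi>_def using that
    by (intro cosyz_glueI sub DY(4))
      (simp_all add: eps_add eps_scale eps_I eps_un DY(5,6,8,9) fs.scale_left_distrib
        fs.scale_right_diff_distrib algebra_simps)
  have k_mem: "k y \<in> cosyz Y" if "y \<in> Y" for y
    unfolding k_def using that t'(2)[OF that]
    by (intro cosyz_glueI sub DY(4) t'(2))
      (simp_all add: eps_add eps_scale eps_I eps_un D_add D_scale D_I D_un DY(5,6,8,9)
        fs.scale_left_distrib fs.scale_right_diff_distrib fs.scale_right_distrib algebra_simps)
  have pi_ker: "\<pi> y = 0 \<longleftrightarrow> y \<in> soc Y act" if "y \<in> Y" for y
  proof
    assume z: "\<pi> y = 0"
    have "act s y = eps s *s y" if "s \<in> R" for s
      using arg_cong[OF z, of "slice s"] that by (simp add: \<pi>_def slice_glue slice_zero)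
    then show "y \<in> soc Y act" using that by (simp add: soc_def)
  next
    assume "y \<in> soc Y act"
    then show "\<pi> y = 0"
      by - (rule slice_eqI, auto simp: \<pi>_def slice_glue slice_zero glue_Nil soc_def zero_fun_apply)
  qed
  have k_soc: "k y = 0" if "y \<in> soc Y act" for y
    using t'(3)[OF that]
    by - (rule slice_eqI, auto simp: k_def slice_glue slice_zero glue_Nil zero_fun_apply)
  have sl: "slice s (cosyz_act act r F) = slice (r \<cdot> s) F - act s (slice r F)" if "s \<in> R" for r s F
    using that by (simp add: cosyz_act_def slice_glue)
  note mem = cosyz_rmod[OF Y(1)]
  note DZ = rmodD[OF mem]
  note subZ = fs.subspace_add[OF DZ(2)] fs.subspace_scale[OF DZ(2)]
  have act_pi: "cosyz_act act r (\<pi> y) = eps r *s \<pi> y" if "r \<in> R" "y \<in> Y" for r y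
    using that DY(7)[of r _ y]
    by (intro cosyz_eqI[OF DZ(4) subZ(2)] pi_mem)
      (simp_all add: sl slice_scale \<pi>_def slice_glue closed eps_mul L fs.scale_right_diff_distrib)
  have act_k: "cosyz_act act r (k y) = eps r *s k y + D r *s \<pi> y" if "r \<in> R" "y \<in> Y" for r y
    using that DY(7)[of r _ "\<tau> y"] t'(2)
    by (intro cosyz_eqI[OF DZ(4) subZ(1)] pi_mem k_mem subZ(2))
      (simp_all add: sl slice_scale slice_add \<pi>_def k_def slice_glue closed eps_mul D_mul L
        fs.scale_right_diff_distrib fs.scale_right_distrib fs.scale_left_distrib)
  have soc_eq: "soc (cosyz Y) (cosyz_act act) = \<pi> ` Y"
  proof
    show "\<pi> ` Y \<subseteq> soc (cosyz Y) (cosyz_act act)" using pi_mem act_pi by (auto simp: soc_def)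
    show "soc (cosyz Y) (cosyz_act act) \<subseteq> \<pi> ` Y"
    proof
      fix F assume F: "F \<in> soc (cosyz Y) (cosyz_act act)"
      have Fr: "cosyz_act act r F = eps r *s F" if "r \<in> R" for r
        using F that by (auto simp: soc_def)
      have FY: "F \<in> cosyz Y" using F by (auto simp: soc_def)
      note E = cosyzD[OF FY]
      \<comment> \<open>The socle condition read at \<open>s\<close> says that the slices of
        \<open>F\<close> form a cocycle of the simple module in \<open>Y\<close>; trivialising it by
        \<open>z\<close> gives \<open>F = \<pi> z\<close>.\<close>
      have c: "slice (r \<cdot> s) F = eps r *s slice s F + act s (slice r F)" if "r \<in> R" "s \<in> R" for r s
        using arg_cong[OF Fr[OF that(1)], of "slice s"] that by (simp add: sl slice_scale algebra_simps)
      have "(\<forall>r\<in>R. slice r F \<in> Y) \<and> (\<forall>r\<in>R. \<forall>s\<in>R. slice (r + s) F = slice r F + slice s F) \<and>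
        (\<forall>b. \<forall>r\<in>R. slice (b *s r) F = b *s slice r F) \<and> (\<forall>i\<in>I. slice i F = 0) \<and>
        (\<forall>r\<in>R. \<forall>s\<in>R. slice (r \<cdot> s) F = eps r *s slice s F + act s (slice r F))"
        by (intro conjI allI ballI E(3-6) c)
      from Y(2)[unfolded ext_simple_zero_def, rule_format, OF this]
      obtain z where z: "z \<in> Y" "\<forall>r\<in>R. slice r F = eps r *s z - act r z" by blast
      have "F = \<pi> z" by (rule cosyz_eqI[OF FY pi_mem[OF z(1)]]) (simp add: z \<pi>_def slice_glue)
      then show "F \<in> \<pi> ` Y" using z(1) by blast
    qed
  qed
  \<comment> \<open>\<open>k\<close> vanishes on the kernel of \<pi>, so it factors through the
    image of \<pi>, and any linear section serves.\<close>
  obtain \<sigma> where \<sigma>: "lin \<sigma>" "\<And>w. \<sigma> w \<in> Y" "\<And>v. v \<in> Y \<Longrightarrow> \<pi> (\<sigma> (\<pi> v)) = \<pi> v"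
    using lin_section[OF lpi DY(2)] by blast
  define \<tau>' where "\<tau>' = (\<lambda>F. k (\<sigma> F))"
  have t'pi: "\<tau>' (\<pi> y) = k y" if "y \<in> Y" for y
  proof -
    have "\<sigma> (\<pi> y) - y \<in> Y" using that \<sigma> sub by blast
    moreover have "\<pi> (\<sigma> (\<pi> y) - y) = 0" using that \<sigma> by (simp add: lin_diff[OF lpi])
    ultimately have "k (\<sigma> (\<pi> y) - y) = 0" using k_soc pi_ker by blast
    then show ?thesis by (simp add: \<tau>'_def lin_diff[OF lk])
  qed
  have sec: "t_section (cosyz Y) (cosyz_act act) \<tau>'"
    unfolding t_section_def soc_eq
  proof (intro conjI ballI)
    show "lin \<tau>'" unfolding \<tau>'_def by (rule lin_app[OF lk \<sigma>(1)])
    show "\<tau>' ` cosyz Y \<subseteq> cosyz Y" using \<sigma>(2) k_mem by (auto simp: \<tau>'_def)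
    fix u r assume "u \<in> \<pi> ` Y" "r \<in> R"
    then show "cosyz_act act r (\<tau>' u) = eps r *s \<tau>' u + D r *s u" using act_k t'pi by auto
  qed
  let ?c = "\<lambda>v. f (\<tau> v) - \<tau> (f v)" and ?C = "\<lambda>F. cosyz_map f (\<tau>' F) - \<tau>' (cosyz_map f F)"
  have map_pi: "cosyz_map f (\<pi> y) = \<pi> (f y)" if "y \<in> Y" for y
    using that f'(3)
    by - (rule slice_eqI, auto simp: cosyz_map_def \<pi>_def slice_glue glue_Nil L)
  have map_k: "cosyz_map f (k y) = k (f y) + \<pi> (?c y)" if "y \<in> Y" for y
    using that f'(3) t'(2)
    by - (rule slice_eqI,
      auto simp: cosyz_map_def \<pi>_def k_def slice_glue glue_Nil L slice_add plus_fun_apply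
        fs.scale_right_diff_distrib fs.scale_right_distrib)
  have induced: "?C (\<pi> y) = \<pi> (?c y)" if "y \<in> Y" for y
    using that f'(2) by (simp add: map_pi t'pi map_k)
  have lc: "lin ?c" by (rule lin_commutator[OF f'(1) t'(1)])
  have lF: "lin (cosyz_map f)" using cosyz_hom[OF Y(1) f] by (simp add: rhom_def)
  have lt: "lin \<tau>'" using sec by (simp add: t_section_def)
  have lC: "lin ?C" by (rule lin_commutator[OF lF lt])
  have cY: "?c ` Y \<subseteq> Y" using f'(2) t'(2) sub by auto
  \<comment> \<open>On all of \<open>Y\<close>, where \<tau> is an endomorphism, the commutator has
    trace zero. Hence the contributions of the socle and of its quotient cancel, which is the origin
    of the sign.\<close>
  have "trace_on Y ?c = trace_on (soc Y act) ?c + trace_on (\<pi> ` Y) ?C"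
  proof (rule trace_on_exact[where V = Y and p = \<pi> and f = "?c" and g = "?C" and U = "soc Y act"])
    show "soc Y act = {v \<in> Y. \<pi> v = 0}" using pi_ker by (auto simp: soc_def)
  qed (fact DY(1) lpi lc cY lC induced)+
  moreover have "trace_on Y ?c = trace_on Y (\<lambda>v. f (\<tau> v)) - trace_on Y (\<lambda>v. \<tau> (f v))"
    using f'(2) t'(2) trace_on_diff[OF DY(1) lin_app[OF f'(1) t'(1)] _ lin_app[OF t'(1) f'(1)]]
    by auto
  moreover have "trace_on Y (\<lambda>v. f (\<tau> v)) = trace_on Y (\<lambda>v. \<tau> (f v))"
    using f'(2) t'(2) trace_on_commute[OF DY(1) f'(1) _ t'(1)] by auto
  ultimately have "twist (cosyz Y) (cosyz_act act) (cosyz_map f) \<tau>' = - twist Y act f \<tau>"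
    by (simp add: twist_def soc_eq eq_neg_iff_add_eq_0 add.commute)
  then show thesis using that[OF sec] by blast
qed

end

section \<open>The twist of the shift on the dual of the algebra\<close>

lemma trace_on_zero:
  assumes "lin f"
  shows "trace_on {0} f = 0"
proof -
  have "basis_of {0} {}" by (simp add: basis_of_def fs.independent_empty)
  from trace_on_basis[OF this assms] show ?thesis using lin_0[OF assms] by simp
qed

lemma trace_on_line:
  assumes "lin f" "u \<noteq> 0" "f u = u"
  shows "trace_on (fs.span {u}) f = 1"
proof -
  have b: "basis_of (fs.span {u}) {u}" using assms by (simp add: basis_of_def)
  have "f ` fs.span {u} \<subseteq> fs.span {u}"
    using assms fsp.linear_span_image[OF assms(1), of "{u}"] by simp
  from trace_on_basis[OF b assms(1) this] show ?thesis
    using assms by (simp add: fs.representation_basis)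
qed

context looped_algebra
begin

lemma ext_simple_zeroI:
  assumes "ext_zero (UNIV :: (unit \<Rightarrow> 'k) set) (\<lambda>r v. eps r *s v) V act" "rmod V act"
  shows "ext_simple_zero V act"
  unfolding ext_simple_zero_def
proof (intro allI impI)
  fix c assume c: "(\<forall>r\<in>R. c r \<in> V) \<and>
    (\<forall>r\<in>R. \<forall>s\<in>R. c (r + s) = c r + c s) \<and> (\<forall>b. \<forall>r\<in>R. c (b *s r) = b *s c r) \<and>
    (\<forall>i\<in>I. c i = 0) \<and> (\<forall>r\<in>R. \<forall>s\<in>R. c (r \<cdot> s) = eps r *s c s + act s (c r))"
  note DV = rmodD[OF assms(2)]
  have "cocycle (UNIV :: (unit \<Rightarrow> 'k) set) (\<lambda>r v. eps r *s v) V act (\<lambda>r v. v () *s c r)"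
    unfolding cocycle_def using c
    by (auto simp: fs.subspace_scale[OF DV(2)] lin_scale[OF DV(3)] pointwise fs.scale_left_distrib
        fs.scale_right_distrib algebra_simps intro!: linI)
  from ext_zeroD[OF assms(1) this]
  obtain h :: "(unit \<Rightarrow> 'k) \<Rightarrow> _" where h: "lin h" "\<And>m. h m \<in> V"
    "\<And>r m. r \<in> R \<Longrightarrow> m () *s c r = h (eps r *s m) - act r (h m)"
    by auto
  have "c r = eps r *s h (\<lambda>_. 1) - act r (h (\<lambda>_. 1))" if "r \<in> R" for r
    using h(3)[OF that, of "\<lambda>_. 1"] by (simp add: lin_scale[OF h(1)])
  then show "\<exists>z\<in>V. \<forall>r\<in>R. c r = eps r *s z - act r z" using h(2) by blast
qed

text \<open>The action on the dual multiplies the argument on the left, so multiplying it by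
  \<open>a\<close> on the right gives an endomorphism.\<close>

definition dual_shift :: "(('p \<Rightarrow> 'k) list \<Rightarrow> 'k) \<Rightarrow> ('p \<Rightarrow> 'k) list \<Rightarrow> 'k" where
  "dual_shift F = dual (\<lambda>r. F [r \<cdot> a])"

lemma dual_shift_hom: "rhom dual_alg dual_act dual_alg dual_act dual_shift"
proof -
  have "lin dual_shift" unfolding dual_shift_def by (rule lin_dual) (simp_all add: pointwise)
  moreover have "dual_shift F \<in> dual_alg" if "F \<in> dual_alg" for F
    unfolding dual_shift_def using dual_algD(2-4)[OF that] a(1)
    by (intro dual_algI) (simp_all add: mul_add_left mul_scale_left mul_closed I_right)
  moreover have "dual_shift (dual_act r F) = dual_act r (dual_shift F)" if "r \<in> R" for r F
    unfolding dual_shift_def dual_act_def using that a(1)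
    by (intro dual_cong) (simp add: dual_apply mul_closed mul_assoc)
  ultimately show ?thesis by (auto simp: rhom_def)
qed

text \<open>The socle is the line spanned by \<open>eps\<close>, and \<open>D\<close> lifts
  \<open>eps\<close> along t. The shift maps \<open>D\<close> to \<open>eps\<close> and kills
  \<open>eps\<close>, so the commutator is the identity on this line.\<close>

lemma twist_dual:
  obtains \<tau> where "t_section dual_alg dual_act \<tau>" "twist dual_alg dual_act dual_shift \<tau> = 1"
proof -
  note M = rmodD[OF dual_alg_rmod]
  define E where "E = dual eps"
  define F where "F = dual D"
  have E: "E \<in> dual_alg" unfolding E_def by (rule dual_algI) (simp_all add: eps_add eps_scale eps_I)
  have F: "F \<in> dual_alg" unfolding F_def by (rule dual_algI) (simp_all add: D_add D_scale D_I)
  have un_E: "E [un] = 1" by (simp add: E_def dual_apply un eps_un)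
  have act_E: "dual_act r E = eps r *s E" if "r \<in> R" for r
    using that by (auto simp: dual_act_def E_def dual_def fun_eq_iff pointwise mul_closed eps_mul)
  have act_F: "dual_act r F = eps r *s F + D r *s E" if "r \<in> R" for r
    using that
    by (auto simp: dual_act_def E_def F_def dual_def fun_eq_iff pointwise mul_closed D_mul)
  have soc_E: "soc dual_alg dual_act = fs.span {E}"
  proof
    show "fs.span {E} \<subseteq> soc dual_alg dual_act"
      using E act_E by (intro fs.span_minimal soc_subspace[OF dual_alg_rmod]) (auto simp: soc_def)
    show "soc dual_alg dual_act \<subseteq> fs.span {E}"
    proof
      fix H assume H: "H \<in> soc dual_alg dual_act"
      then have HD: "H \<in> dual_alg" by (simp add: soc_def)
      have "H = H [un] *s E"
      proof (rule dual_alg_eqI[OF HD fs.subspace_scale[OF M(2) E]])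
        fix r assume r: "r \<in> R"
        have "dual_act r H [un] = (eps r *s H) [un]" using H r by (simp add: soc_def)
        then show "H [r] = (H [un] *s E) [r]"
          using r by (simp add: dual_act_def dual_apply un pointwise E_def)
      qed
      then show "H \<in> fs.span {E}" using fs.span_scale[OF fs.span_base[of E "{E}"]] by (metis insertI1)
    qed
  qed
  define \<tau> where "\<tau> = (\<lambda>H :: ('p \<Rightarrow> 'k) list \<Rightarrow> 'k. H [un] *s F)"
  have lt: "lin \<tau>" unfolding \<tau>_def
    by (rule linI) (simp_all add: pointwise fs.scale_left_distrib)
  have sec: "t_section dual_alg dual_act \<tau>"
    unfolding t_section_def
  proof (intro conjI ballI)
    show "\<tau> ` dual_alg \<subseteq> dual_alg" using F fs.subspace_scale[OF M(2)] by (auto simp: \<tau>_def)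
    fix u r assume u: "u \<in> soc dual_alg dual_act" and r: "r \<in> R"
    obtain k where k: "u = k *s E" using u soc_E by (auto simp: fs.span_singleton)
    have "\<tau> u = k *s F" by (simp add: \<tau>_def k un_E pointwise)
    then show "dual_act r (\<tau> u) = eps r *s \<tau> u + D r *s u"
      using act_F[OF r] by (simp add: k lin_scale[OF M(3)] fs.scale_right_distrib mult.commute)
  qed (rule lt)
  have ls: "lin dual_shift" using dual_shift_hom by (simp add: rhom_def)
  have sE: "dual_shift E = 0"
    using a by (auto simp: dual_shift_def E_def dual_def fun_eq_iff pointwise mul_closed eps_mul)
  have sF: "dual_shift F = E"
    using a by (auto simp: dual_shift_def E_def F_def dual_def fun_eq_iff mul_closed D_mul)
  have "dual_shift (\<tau> E) - \<tau> (dual_shift E) = E"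
    by (simp add: sE lin_0[OF lt]) (simp add: \<tau>_def un_E sF)
  moreover have "E \<noteq> 0" using un_E by (metis zero_fun_apply zero_neq_one)
  ultimately have "twist dual_alg dual_act dual_shift \<tau> = 1"
    unfolding twist_def soc_E by (intro trace_on_line lin_commutator ls lt)
  then show thesis using that sec by blast
qed

text \<open>Each cosyzygy contributes one sign. Extensions have to vanish at every intermediate
  stage, not only at the last one.\<close>

lemma twist_iterate_dual:
  assumes "\<And>j. ext_simple_zero ((cosyz ^^ j) dual_alg) ((cosyz_act ^^ j) dual_act)"
  shows "\<exists>\<tau>. t_section ((cosyz ^^ j) dual_alg) ((cosyz_act ^^ j) dual_act) \<tau> \<and>
    twist ((cosyz ^^ j) dual_alg) ((cosyz_act ^^ j) dual_act) ((cosyz_map ^^ j) dual_shift) \<tau> = (- 1) ^ j"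
proof (induction j)
  case 0
  then show ?case using twist_dual by auto
next
  case (Suc j)
  then obtain \<tau> where \<tau>: "t_section ((cosyz ^^ j) dual_alg) ((cosyz_act ^^ j) dual_act) \<tau>"
    "twist ((cosyz ^^ j) dual_alg) ((cosyz_act ^^ j) dual_act) ((cosyz_map ^^ j) dual_shift) \<tau> = (- 1) ^ j"
    by blast
  from twist_cosyz[OF iterate_rmod[OF dual_alg_rmod] assms iterate_hom[OF dual_alg_rmod dual_shift_hom]
      \<tau>(1)] show ?case using \<tau>(2) by auto
qed

text \<open>
  Multiplication by the nilpotent element \<open>a\<close> shifts a finite filtration of the dual of the algebra
  by submodules, so that its twist vanishes.
\<close>

lemma looped_algebra_contradiction:
  assumes "\<And>Y act. rmod Y act \<Longrightarrow> ext_simple_zero ((cosyz ^^ n) Y) ((cosyz_act ^^ n) act)"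
    and "\<And>j. ext_simple_zero ((cosyz ^^ j) dual_alg) ((cosyz_act ^^ j) dual_act)"
  shows False
proof -
  note M = rmodD[OF dual_alg_rmod]
  have s: "lin dual_shift" "\<And>F. F \<in> dual_alg \<Longrightarrow> dual_shift F \<in> dual_alg"
    "\<And>r F. r \<in> R \<Longrightarrow> F \<in> dual_alg \<Longrightarrow> dual_shift (dual_act r F) = dual_act r (dual_shift F)"
    using dual_shift_hom by (auto simp: rhom_def)
  \<comment> \<open>The shift maps each term onto the next, and nilpotency of \<open>a\<close> makes
    term number \<open>m\<close> zero.\<close>
  define Y where "Y = (\<lambda>i. (dual_shift ^^ i) ` dual_alg)"
  have Y0: "Y 0 = dual_alg" and YS: "Y (Suc i) = dual_shift ` Y i" for i
    by (simp_all add: Y_def image_comp)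
  have Y: "rmod (Y i) dual_act \<and> Y i \<subseteq> dual_alg" for i
  proof (induction i)
    case 0
    then show ?case by (simp add: Y0 dual_alg_rmod)
  next
    case (Suc i)
    have sub: "Y (Suc i) \<subseteq> dual_alg" using Suc s(2) by (auto simp: YS)
    moreover have "rmod (Y (Suc i)) dual_act"
    proof (rule rmod_submodule[OF dual_alg_rmod _ sub])
      show "fs.subspace (Y (Suc i))"
        unfolding YS using Suc rmodD(2) by (intro fsp.linear_subspace_image[OF s(1)]) blast
      show "dual_act r u \<in> Y (Suc i)" if ru: "r \<in> R" "u \<in> Y (Suc i)" for r u
      proof -
        obtain v where v: "v \<in> Y i" "u = dual_shift v" using ru by (auto simp: YS)
        then have "dual_act r u = dual_shift (dual_act r v)" using s(3) ru Suc by auto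
        moreover have "dual_act r v \<in> Y i" using Suc rmodD(4) ru v by blast
        ultimately show ?thesis by (simp add: YS)
      qed
    qed
    ultimately show ?case by blast
  qed
  have dec: "Y (Suc i) \<subseteq> Y i" for i
  proof (induction i)
    case 0
    then show ?case using Y[of 1] Y0 by simp
  next
    case (Suc i)
    then show ?case by (simp only: YS[of "Suc i"] YS[of i]) (rule image_mono)
  qed
  obtain m where m: "\<And>r. r \<in> R \<Longrightarrow> ((\<lambda>s. s \<cdot> a) ^^ m) r \<in> I" using a_nilpotent by blast
  have pow_R: "((\<lambda>s. s \<cdot> a) ^^ i) r \<in> R" if "r \<in> R" for r i
    using that by (induction i) (simp_all add: mul_closed a)
  have pow: "(dual_shift ^^ i) F [r] = F [((\<lambda>s. s \<cdot> a) ^^ i) r]" if "r \<in> R" for i F r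
    using that
  proof (induction i arbitrary: F)
    case (Suc i)
    have "(dual_shift ^^ Suc i) F [r] = (dual_shift ^^ i) (dual_shift F) [r]"
      by (simp add: funpow_swap1)
    also have "\<dots> = dual_shift F [((\<lambda>s. s \<cdot> a) ^^ i) r]" by (rule Suc.IH[OF Suc.prems])
    also have "\<dots> = F [((\<lambda>s. s \<cdot> a) ^^ Suc i) r]"
      unfolding dual_shift_def using pow_R[OF Suc.prems] by (simp add: dual_apply)
    finally show ?case .
  qed simp
  have "F = 0" if F: "F \<in> Y m" for F
  proof -
    have FD: "F \<in> dual_alg" using F Y by blast
    obtain H where H: "H \<in> dual_alg" "F = (dual_shift ^^ m) H" using F by (auto simp: Y_def)
    show ?thesis
    proof (rule dual_alg_eqI[OF FD fs.subspace_0[OF M(2)]])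
      show "F [r] = 0 [r]" if "r \<in> R" for r
        using pow[OF that, of m H] dual_algD(4)[OF H(1) m[OF that]] H(2) by (simp add: zero_fun_apply)
    qed
  qed
  moreover have "0 \<in> Y m" using Y rmodD(2) fs.subspace_0 by blast
  ultimately have Ym: "Y m = {0}" by blast
  \<comment> \<open>\<open>Ext^1(S, Y i)\<close> may be nonzero; twists are compared after
    \<open>n\<close> cosyzygies, where this group is known to vanish.\<close>
  let ?Z = "\<lambda>i. (cosyz ^^ n) (Y i)" and ?act = "(cosyz_act ^^ n) dual_act"
    and ?f = "(cosyz_map ^^ n) dual_shift"
  have Z: "rmod (?Z i) ?act" "ext_simple_zero (?Z i) ?act" for i
    using Y iterate_rmod assms(1) by blast+
  have hom_Z: "rhom (?Z i) ?act (?Z (Suc i)) ?act ?f" for i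
  proof (rule iterate_hom)
    show "rmod (Y i) dual_act" using Y by blast
    show "rhom (Y i) dual_act (Y (Suc i)) dual_act dual_shift"
      using s Y[of i] by (auto simp: rhom_def YS)
  qed
  have step: "twist (?Z i) ?act ?f \<tau> = twist (?Z (Suc i)) ?act ?f \<tau>'"
    if "t_section (?Z i) ?act \<tau>" "t_section (?Z (Suc i)) ?act \<tau>'" for i \<tau> \<tau>'
  proof (rule twist_submodule[OF Z Z(1) _ _ _ that])
    show sub: "?Z (Suc i) \<subseteq> ?Z i" by (rule iterate_mono[OF dec])
    show "?f ` ?Z i \<subseteq> ?Z (Suc i)" using hom_Z[of i] by (simp add: rhom_def)
    then show "rhom (?Z i) ?act (?Z i) ?act ?f" using hom_Z[of i] sub by (auto simp: rhom_def)
  qed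
  obtain \<tau> where \<tau>: "t_section (?Z 0) ?act \<tau>" "twist (?Z 0) ?act ?f \<tau> = (- 1) ^ n"
    using twist_iterate_dual[OF assms(2), of n] by (auto simp: Y0)
  have "\<exists>\<tau>. t_section (?Z i) ?act \<tau> \<and> twist (?Z i) ?act ?f \<tau> = (- 1) ^ n" for i
  proof (induction i)
    case 0
    then show ?case using \<tau> by blast
  next
    case (Suc i)
    obtain \<tau>' where \<tau>': "t_section (?Z (Suc i)) ?act \<tau>'" using t_section_ex[OF Z] .
    then show ?case using Suc step[OF _ \<tau>'] by (metis (no_types))
  qed
  then obtain \<tau>' where \<tau>': "t_section (?Z m) ?act \<tau>'" "twist (?Z m) ?act ?f \<tau>' = (- 1) ^ n" by blast
  \<comment> \<open>Cosyzygies of the zero module are zero, so the twist vanishes, although it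
    equals \<open>(- 1) ^ n\<close>, which is nonzero in every characteristic.\<close>
  have "soc (?Z m) ?act = {0}"
    using soc_subspace(1,2)[OF Z(1)[of m]] fs.subspace_0 by (simp only: Ym iterate_zero) blast
  moreover have "lin (\<lambda>v. ?f (\<tau>' v) - \<tau>' (?f v))"
    using hom_Z[of m] \<tau>'(1) by (intro lin_commutator) (simp_all add: rhom_def t_section_def)
  ultimately have "twist (?Z m) ?act ?f \<tau>' = 0" by (simp add: twist_def trace_on_zero)
  then show False using \<tau>'(2) by simp
qed

end

section \<open>Modules as records\<close>

text \<open>\<open>cls\<close> is the quotient map from the function model to the algebra as a
  record. The trace argument lives in the former, the given resolution in the latter.\<close>

locale presented_algebra = bound_algebra R mul un I G + A: ring A
  for R :: "('p \<Rightarrow> 'k::field) set" and mul (infixl \<open>\<cdot>\<close> 70) and un I G and A :: "('k, 'a) module" +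
  fixes cls :: "('p \<Rightarrow> 'k) \<Rightarrow> 'a"
  assumes cls_image: "cls ` R = carrier A"
    and cls_add: "r \<in> R \<Longrightarrow> s \<in> R \<Longrightarrow> cls (r + s) = cls r \<oplus>\<^bsub>A\<^esub> cls s"
    and cls_mul: "r \<in> R \<Longrightarrow> s \<in> R \<Longrightarrow> cls (r \<cdot> s) = cls r \<otimes>\<^bsub>A\<^esub> cls s"
    and cls_un: "cls un = \<one>\<^bsub>A\<^esub>"
    and cls_scale: "r \<in> R \<Longrightarrow> cls (c *s r) = c \<odot>\<^bsub>A\<^esub> cls r"
    and cls_I: "r \<in> R \<Longrightarrow> cls r = \<zero>\<^bsub>A\<^esub> \<longleftrightarrow> r \<in> I"
begin

lemma cls_closed: "r \<in> R \<Longrightarrow> cls r \<in> carrier A"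
  using cls_image by auto

lemma scalar_cls: "c \<odot>\<^bsub>A\<^esub> \<one>\<^bsub>A\<^esub> = cls (c *s un)"
  by (simp add: cls_scale cls_un un)

lemma scalar_R: "c *s un \<in> R"
  using R_closed un by simp

text \<open>Compatibility with scalars is automatic, because \<open>c\<close> acts as the class of
  \<open>c *s un\<close>.\<close>

definition module_equiv ::
    "('q \<Rightarrow> 'k) set \<Rightarrow> (('p \<Rightarrow> 'k) \<Rightarrow> ('q \<Rightarrow> 'k) \<Rightarrow> ('q \<Rightarrow> 'k)) \<Rightarrow> ('a, 'm) right_module \<Rightarrow>
     (('q \<Rightarrow> 'k) \<Rightarrow> 'm) \<Rightarrow> bool" where
  "module_equiv V act M \<kappa> \<longleftrightarrow> bij_betw \<kappa> V (carrier M) \<and>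
    (\<forall>u\<in>V. \<forall>v\<in>V. \<kappa> (u + v) = \<kappa> u \<oplus>\<^bsub>M\<^esub> \<kappa> v) \<and>
    (\<forall>r\<in>R. \<forall>v\<in>V. \<kappa> (act r v) = \<kappa> v \<lhd>\<^bsub>M\<^esub> cls r)"

lemma module_equivD:
  assumes "module_equiv V act M \<kappa>"
  shows "inj_on \<kappa> V" "\<kappa> ` V = carrier M" "v \<in> V \<Longrightarrow> \<kappa> v \<in> carrier M"
    "u \<in> V \<Longrightarrow> v \<in> V \<Longrightarrow> \<kappa> (u + v) = \<kappa> u \<oplus>\<^bsub>M\<^esub> \<kappa> v"
    "r \<in> R \<Longrightarrow> v \<in> V \<Longrightarrow> \<kappa> (act r v) = \<kappa> v \<lhd>\<^bsub>M\<^esub> cls r"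
  using assms unfolding module_equiv_def bij_betw_def by auto

section \<open>Translation between function modules and record modules\<close>

lemma act_scalar: "rmod V act \<Longrightarrow> v \<in> V \<Longrightarrow> act (c *s un) v = c *s v"
  using rmodD(6)[of V act un v c] rmodD(8)[of V act v] un by simp

text \<open>\<open>projective\<close> tests lifting against modules on
  \<open>nat \<Rightarrow> 'k\<close> only; coordinates in a finite basis place \<open>V\<close>
  there.\<close>

lemma rmod_to_record:
  assumes V: "rmod V act"
  obtains N :: "('k, 'a) std_module" and \<kappa> where "fd_module A N" "module_equiv V act N \<kappa>"
proof -
  note D = rmodD[OF V]
  obtain B where B: "basis_of V B" using fin_dim_basis[OF D(1)] .
  have fB: "finite B" using B by (simp add: basis_of_def)
  obtain e where e: "bij_betw e {..<card B} B"
    using ex_bij_betw_nat_finite[OF fB] by (auto simp: atLeast0LessThan)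
  define \<kappa> where "\<kappa> = (\<lambda>v i. if i < card B then fs.representation B v (e i) else 0)"
  have inj: "inj_on \<kappa> V"
  proof
    fix u v assume uv: "u \<in> V" "v \<in> V" "\<kappa> u = \<kappa> v"
    have "fs.representation B u b = fs.representation B v b" if "b \<in> B" for b
    proof -
      obtain i where i: "i < card B" "b = e i" using e \<open>b \<in> B\<close> by (auto simp: bij_betw_def)
      show ?thesis using fun_cong[OF uv(3), of i] i by (simp add: \<kappa>_def)
    qed
    then have "(\<Sum>b\<in>B. fs.representation B u b *s b) = (\<Sum>b\<in>B. fs.representation B v b *s b)" by simp
    then show "u = v" using representation_sum_basis[OF B] uv by simp
  qed
  define dec where "dec = inv_into V \<kappa>"
  \<comment> \<open>The algebra acts through chosen representatives; \<open>act_eq\<close> shows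
    that the choice does not matter, because \<open>I\<close> acts by zero.\<close>
  define rp where "rp = (\<lambda>X. SOME r. r \<in> R \<and> cls r = X)"
  have dec: "dec (\<kappa> v) = v" if "v \<in> V" for v using inj that by (simp add: dec_def)
  have rp: "rp X \<in> R" "cls (rp X) = X" if "X \<in> carrier A" for X
  proof -
    have "\<exists>r. r \<in> R \<and> cls r = X" using that unfolding cls_image[symmetric] by auto
    from someI_ex[OF this] show "rp X \<in> R" "cls (rp X) = X" by (auto simp: rp_def)
  qed
  have act_eq: "act r v = act s v" if "r \<in> R" "s \<in> R" "cls r = cls s" "v \<in> V" for r s v
  proof -
    have d: "r - s \<in> R" using fs.subspace_diff[OF R] that by blast
    have "cls (r - s) \<oplus>\<^bsub>A\<^esub> cls s = cls s" using cls_add[OF d that(2)] that(3) by simp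
    then have "cls (r - s) = \<zero>\<^bsub>A\<^esub>"
      using cls_closed d that(2) by (simp add: A.add.r_cancel_one)
    then have "r - s \<in> I" using cls_I[OF d] by simp
    then have "act (r - s) v = 0" using D(9) that by blast
    then show ?thesis using D(5)[OF d that(2,4)] by simp
  qed
  define N :: "('k, 'a) std_module" where
    "N = \<lparr>carrier = \<kappa> ` V, mult = (\<lambda>x y. x), one = \<kappa> 0, zero = \<kappa> 0,
      add = (\<lambda>x y. \<kappa> (dec x + dec y)), ract = (\<lambda>x X. \<kappa> (act (rp X) (dec x)))\<rparr>"
  have N_simps: "carrier N = \<kappa> ` V" "\<zero>\<^bsub>N\<^esub> = \<kappa> 0"
    "\<And>u v. u \<in> V \<Longrightarrow> v \<in> V \<Longrightarrow> \<kappa> u \<oplus>\<^bsub>N\<^esub> \<kappa> v = \<kappa> (u + v)"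
    "\<And>v X. v \<in> V \<Longrightarrow> \<kappa> v \<lhd>\<^bsub>N\<^esub> X = \<kappa> (act (rp X) v)"
    by (simp_all add: N_def dec)
  note cl = fs.subspace_add[OF D(2)] fs.subspace_0[OF D(2)] D(4) rp(1)
  have ag: "abelian_group N"
  proof (rule abelian_groupI)
    fix x assume "x \<in> carrier N"
    then obtain v where v: "v \<in> V" "x = \<kappa> v" by (auto simp: N_simps)
    then have "\<kappa> (- v) \<oplus>\<^bsub>N\<^esub> x = \<zero>\<^bsub>N\<^esub>" using fs.subspace_neg[OF D(2)] by (simp add: N_simps)
    then show "\<exists>y\<in>carrier N. y \<oplus>\<^bsub>N\<^esub> x = \<zero>\<^bsub>N\<^esub>"
      using v fs.subspace_neg[OF D(2)] by (intro bexI[of _ "\<kappa> (- v)"]) (auto simp: N_simps)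
  qed (auto simp: N_simps cl ac_simps)
  have rep_add: "act (rp (X \<oplus>\<^bsub>A\<^esub> Y)) v = act (rp X) v + act (rp Y) v"
    if "X \<in> carrier A" "Y \<in> carrier A" "v \<in> V" for X Y v
    using act_eq[of "rp (X \<oplus>\<^bsub>A\<^esub> Y)" "rp X + rp Y" v] that rp R_closed cls_add D(5) by simp
  have rep_mult: "act (rp (X \<otimes>\<^bsub>A\<^esub> Y)) v = act (rp Y) (act (rp X) v)"
    if "X \<in> carrier A" "Y \<in> carrier A" "v \<in> V" for X Y v
    using act_eq[of "rp (X \<otimes>\<^bsub>A\<^esub> Y)" "rp X \<cdot> rp Y" v] that rp mul_closed cls_mul D(7) by simp
  have rep_one: "act (rp \<one>\<^bsub>A\<^esub>) v = v" if "v \<in> V" for v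
    using act_eq[of "rp \<one>\<^bsub>A\<^esub>" un v] that rp un cls_un D(8) by simp
  have rm: "right_module A N"
    using ag A.ring_axioms
    by (intro right_module.intro right_module_axioms.intro)
      (auto simp: N_simps cl rep_add rep_mult rep_one lin_add[OF D(3)])
  interpret N: abelian_group N by (rule ag)
  have ract: "\<kappa> v \<lhd>\<^bsub>N\<^esub> cls r = \<kappa> (act r v)" if "v \<in> V" "r \<in> R" for v r
    using act_eq[of "rp (cls r)" r v] that rp[OF cls_closed[OF that(2)]] by (simp add: N_simps)
  have fs: "\<kappa> (\<Sum>b\<in>S. g b) = (\<Oplus>\<^bsub>N\<^esub>b\<in>S. \<kappa> (g b))" if "finite S" "\<And>b. b \<in> S \<Longrightarrow> g b \<in> V" for S g
    using that
  proof (induction S rule: finite_induct)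
    case (insert b S)
    have "(\<Sum>b\<in>S. g b) \<in> V" using insert by (intro fs.subspace_sum[OF D(2)]) auto
    then have "\<kappa> (g b + sum g S) = \<kappa> (g b) \<oplus>\<^bsub>N\<^esub> \<kappa> (sum g S)"
      using insert.prems by (simp add: N_simps(3))
    then show ?case using insert by (subst N.finsum_insert) (auto simp: N_simps(1))
  qed (simp add: N_simps)
  have BV: "B \<subseteq> V" using basis_of_mem[OF B] by auto
  have "\<exists>c. m = (\<Oplus>\<^bsub>N\<^esub>b\<in>\<kappa> ` B. b \<lhd>\<^bsub>N\<^esub> (c b \<odot>\<^bsub>A\<^esub> \<one>\<^bsub>A\<^esub>))" if "m \<in> carrier N" for m
  proof -
    obtain v where v: "v \<in> V" "m = \<kappa> v" using \<open>m \<in> carrier N\<close> by (auto simp: N_simps)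
    let ?c = "\<lambda>x. fs.representation B v (dec x)"
    have "m = \<kappa> (\<Sum>b\<in>B. fs.representation B v b *s b)"
      using representation_sum_basis[OF B v(1)] v by simp
    also have "\<dots> = (\<Oplus>\<^bsub>N\<^esub>b\<in>B. \<kappa> (fs.representation B v b *s b))"
      using BV fs.subspace_scale[OF D(2)] by (intro fs[OF fB]) auto
    also have "\<dots> = (\<Oplus>\<^bsub>N\<^esub>b\<in>B. \<kappa> b \<lhd>\<^bsub>N\<^esub> (?c (\<kappa> b) \<odot>\<^bsub>A\<^esub> \<one>\<^bsub>A\<^esub>))"
      using BV by (intro N.finsum_cong')
        (auto simp: scalar_cls ract scalar_R dec act_scalar[OF V] N_simps(1) subset_eq
          fs.subspace_scale[OF D(2)])
    also have "\<dots> = (\<Oplus>\<^bsub>N\<^esub>x\<in>\<kappa> ` B. x \<lhd>\<^bsub>N\<^esub> (?c x \<odot>\<^bsub>A\<^esub> \<one>\<^bsub>A\<^esub>))"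
      using BV inj_on_subset[OF inj BV]
      by (intro N.finsum_reindex[symmetric])
        (auto simp: scalar_cls ract scalar_R act_scalar[OF V] N_simps(1) subset_eq
          fs.subspace_scale[OF D(2)])
    finally show ?thesis by (rule exI[of _ ?c])
  qed
  moreover have "finite (\<kappa> ` B)" "\<kappa> ` B \<subseteq> carrier N" using fB BV by (auto simp: N_simps)
  ultimately have "fd_module A N" unfolding fd_module_def using rm by blast
  moreover have "module_equiv V act N \<kappa>"
    using inj ract by (auto simp: module_equiv_def bij_betw_def N_simps)
  ultimately show thesis by (rule that)
qed

text \<open>Functions on a finite spanning set map onto \<open>M\<close> by linear combination. A
  linear complement of the kernel is a copy of \<open>M\<close> inside a function space, to which
  the action is transported.\<close>

lemma record_to_rmod:
  fixes M :: "('a, 'm) right_module"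
  assumes M: "fd_module A M"
  obtains V :: "('m \<Rightarrow> 'k) set" and act \<kappa> where "rmod V act" "module_equiv V act M \<kappa>"
proof -
  interpret M: right_module A M using M by (simp add: fd_module_def)
  obtain B where B: "finite B" "B \<subseteq> carrier M"
    "\<forall>m\<in>carrier M. \<exists>c :: 'm \<Rightarrow> 'k. m = (\<Oplus>\<^bsub>M\<^esub>b\<in>B. b \<lhd>\<^bsub>M\<^esub> (c b \<odot>\<^bsub>A\<^esub> \<one>\<^bsub>A\<^esub>))"
    using M by (auto simp: fd_module_def)
  define \<mu> where "\<mu> = (\<lambda>f :: 'm \<Rightarrow> 'k. \<Oplus>\<^bsub>M\<^esub>b\<in>B. b \<lhd>\<^bsub>M\<^esub> cls (f b *s un))"
  note sc = cls_closed[OF scalar_R]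
  have term_closed: "b \<lhd>\<^bsub>M\<^esub> cls (c *s un) \<in> carrier M" if "b \<in> B" for b c
    using that B(2) sc M.ract_closed by auto
  have mu_closed: "\<mu> f \<in> carrier M" for f
    unfolding \<mu>_def using term_closed by (intro M.finsum_closed) auto
  have mu_add: "\<mu> (f + g) = \<mu> f \<oplus>\<^bsub>M\<^esub> \<mu> g" for f g
  proof -
    have "b \<lhd>\<^bsub>M\<^esub> cls ((f + g) b *s un) = b \<lhd>\<^bsub>M\<^esub> cls (f b *s un) \<oplus>\<^bsub>M\<^esub> b \<lhd>\<^bsub>M\<^esub> cls (g b *s un)"
      if "b \<in> B" for b
      using that B(2) sc by (subst M.ract_r_distr[symmetric])
        (auto simp: cls_add[symmetric] scalar_R fs.scale_left_distrib plus_fun_apply)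
    then have "\<mu> (f + g) = (\<Oplus>\<^bsub>M\<^esub>b\<in>B. b \<lhd>\<^bsub>M\<^esub> cls (f b *s un) \<oplus>\<^bsub>M\<^esub> b \<lhd>\<^bsub>M\<^esub> cls (g b *s un))"
      unfolding \<mu>_def using term_closed by (intro M.finsum_cong') auto
    also have "\<dots> = \<mu> f \<oplus>\<^bsub>M\<^esub> \<mu> g"
      unfolding \<mu>_def using term_closed by (intro M.finsum_addf) auto
    finally show ?thesis .
  qed
  have ract_sum: "(\<Oplus>\<^bsub>M\<^esub>b\<in>S. g b) \<lhd>\<^bsub>M\<^esub> X = (\<Oplus>\<^bsub>M\<^esub>b\<in>S. g b \<lhd>\<^bsub>M\<^esub> X)"
    if "finite S" "\<And>b. b \<in> S \<Longrightarrow> g b \<in> carrier M" "X \<in> carrier A" for S g X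
    using that
  proof (induction S rule: finite_induct)
    case empty
    have "\<zero>\<^bsub>M\<^esub> \<lhd>\<^bsub>M\<^esub> X = \<zero>\<^bsub>M\<^esub> \<lhd>\<^bsub>M\<^esub> X \<oplus>\<^bsub>M\<^esub> \<zero>\<^bsub>M\<^esub> \<lhd>\<^bsub>M\<^esub> X"
      using M.ract_l_distr[of "\<zero>\<^bsub>M\<^esub>" "\<zero>\<^bsub>M\<^esub>" X] empty by simp
    then show ?case using M.ract_closed[of "\<zero>\<^bsub>M\<^esub>" X] empty by (simp add: M.add.l_cancel_one)
  next
    case (insert b S)
    then show ?case
      by (subst (1 2) M.finsum_insert) (auto simp: M.ract_l_distr M.ract_closed M.finsum_closed)
  qed
  have mu_scale: "\<mu> (c *s f) = \<mu> f \<lhd>\<^bsub>M\<^esub> cls (c *s un)" for c f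
  proof -
    have "b \<lhd>\<^bsub>M\<^esub> cls ((c *s f) b *s un) = b \<lhd>\<^bsub>M\<^esub> cls (f b *s un) \<lhd>\<^bsub>M\<^esub> cls (c *s un)" if "b \<in> B" for b
    proof -
      have "(c *s f) b *s un = (f b *s un) \<cdot> (c *s un)"
        using un scalar_R by (simp add: mul_scale_left mul_scale_right fscale_apply mult.commute)
      then show ?thesis
        using that B(2) sc by (subst M.ract_assoc[symmetric]) (auto simp: cls_mul[symmetric] scalar_R)
    qed
    then show ?thesis unfolding \<mu>_def using term_closed sc B(1)
      by (subst ract_sum) (auto intro!: M.finsum_cong' M.ract_closed[OF term_closed])
  qed
  have mu_surj: "\<exists>f. m = \<mu> f" if "m \<in> carrier M" for m
    using B(3) that by (auto simp: \<mu>_def scalar_cls)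
  define W where "W = {f :: 'm \<Rightarrow> 'k. \<forall>b. b \<notin> B \<longrightarrow> f b = 0}"
  have sW: "fs.subspace W" by (auto simp: W_def fs.subspace_def pointwise)
  have "f \<in> fs.span ((\<lambda>b x. if x = b then 1 else 0) ` B)" if "f \<in> W" for f
  proof -
    have "f = (\<Sum>b\<in>B. f b *s (\<lambda>x. if x = b then 1 else 0))"
      using that B(1) by (auto simp: fun_eq_iff sum_apply pointwise W_def if_distrib cong: if_cong)
    also have "\<dots> \<in> fs.span ((\<lambda>b x. if x = b then 1 else 0) ` B)"
      by (intro fs.span_sum fs.span_scale fs.span_base imageI)
    finally show ?thesis .
  qed
  then have fW: "fin_dim W" using sW B(1) unfolding fin_dim_def by blast
  have mu_W: "\<exists>f\<in>W. m = \<mu> f" if "m \<in> carrier M" for m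
  proof -
    obtain f where f: "m = \<mu> f" using mu_surj \<open>m \<in> carrier M\<close> by blast
    have "\<mu> (\<lambda>b. if b \<in> B then f b else 0) = \<mu> f"
      unfolding \<mu>_def using term_closed by (intro M.finsum_cong') auto
    then show ?thesis using f by (intro bexI[of _ "\<lambda>b. if b \<in> B then f b else 0"]) (auto simp: W_def)
  qed
  have mu_0: "\<mu> 0 = \<zero>\<^bsub>M\<^esub>" using mu_add[of 0 0] mu_closed[of 0] by (simp add: M.add.l_cancel_one)
  have zero_ract: "\<zero>\<^bsub>M\<^esub> \<lhd>\<^bsub>M\<^esub> X = \<zero>\<^bsub>M\<^esub>" if "X \<in> carrier A" for X
    using ract_sum[of "{}" "\<lambda>b. b" X] that by simp
  define K where "K = {f \<in> W. \<mu> f = \<zero>\<^bsub>M\<^esub>}"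
  have sK: "fs.subspace K" using sW
    by (auto simp: K_def fs.subspace_def mu_0 mu_add mu_scale zero_ract sc)
  obtain q where q: "lin q" "\<And>v. q v \<in> K" "\<And>u. u \<in> K \<Longrightarrow> q u = u" using lin_projection[OF sK] by blast
  \<comment> \<open>\<open>q\<close> projects onto the kernel \<open>K\<close>, so this is a
    complement of \<open>K\<close> in \<open>W\<close>.\<close>
  define V where "V = {f \<in> W. q f = 0}"
  have sV: "fs.subspace V" using sW
    by (auto simp: V_def fs.subspace_def lin_0[OF q(1)] lin_add[OF q(1)] lin_scale[OF q(1)])
  have fV: "fin_dim V" using fin_dim_subset[OF fW sV] by (auto simp: V_def)
  have inj: "inj_on \<mu> V"
  proof
    fix f g assume fg: "f \<in> V" "g \<in> V" "\<mu> f = \<mu> g"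
    have d: "f - g \<in> V" using fs.subspace_diff[OF sV] fg by blast
    have "\<mu> (f - g) \<oplus>\<^bsub>M\<^esub> \<mu> g = \<mu> g" using mu_add[of "f - g" g] fg by simp
    then have "\<mu> (f - g) = \<zero>\<^bsub>M\<^esub>" using mu_closed by (simp add: M.add.r_cancel_one)
    then have "f - g \<in> K" using d by (simp add: K_def V_def)
    then have "q (f - g) = f - g" by (rule q(3))
    then show "f = g" using d by (simp add: V_def)
  qed
  have surj: "\<mu> ` V = carrier M"
  proof
    show "carrier M \<subseteq> \<mu> ` V"
    proof
      fix m assume "m \<in> carrier M"
      then obtain f where f: "f \<in> W" "m = \<mu> f" using mu_W by blast
      have "q (f - q f) = 0" using q by (simp add: lin_diff[OF q(1)])
      moreover have "f - q f \<in> W" using f q(2) fs.subspace_diff[OF sW] by (auto simp: K_def)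
      ultimately have "f - q f \<in> V" by (simp add: V_def)
      moreover have "\<mu> (f - q f) = m"
        using mu_add[of "f - q f" "q f"] q(2)[of f] f mu_closed by (simp add: K_def)
      ultimately show "m \<in> \<mu> ` V" by blast
    qed
  qed (use mu_closed in auto)
  define dec where "dec = inv_into V \<mu>"
  have dec: "dec m \<in> V" "\<mu> (dec m) = m" if "m \<in> carrier M" for m
    using that surj by (auto simp: dec_def inv_into_into f_inv_into_f)
  have eqI: "u = v" if "u \<in> V" "v \<in> V" "\<mu> u = \<mu> v" for u v using inj that by (auto dest: inj_onD)
  have mu_ract: "\<mu> (dec (\<mu> v \<lhd>\<^bsub>M\<^esub> cls r)) = \<mu> v \<lhd>\<^bsub>M\<^esub> cls r" "dec (\<mu> v \<lhd>\<^bsub>M\<^esub> cls r) \<in> V"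
    if "r \<in> R" for v r
    using dec M.ract_closed mu_closed cls_closed that by simp_all
  note cl = fs.subspace_add[OF sV] fs.subspace_scale[OF sV] mu_closed cls_closed scalar_R
  have "\<exists>g. lin g \<and> (r \<in> R \<longrightarrow> (\<forall>v\<in>V. g v = dec (\<mu> v \<lhd>\<^bsub>M\<^esub> cls r)))" for r
  proof (cases "r \<in> R")
    case True
    \<comment> \<open>Multiples of the unit are central, which makes the transported action
      linear.\<close>
    have comm: "m \<lhd>\<^bsub>M\<^esub> cls (c *s un) \<lhd>\<^bsub>M\<^esub> cls r = m \<lhd>\<^bsub>M\<^esub> cls r \<lhd>\<^bsub>M\<^esub> cls (c *s un)"
      if "m \<in> carrier M" for m c
    proof -
      have "(c *s un) \<cdot> r = r \<cdot> (c *s un)" using True un by (simp add: mul_scale_left mul_scale_right)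
      then have "cls (c *s un) \<otimes>\<^bsub>A\<^esub> cls r = cls r \<otimes>\<^bsub>A\<^esub> cls (c *s un)"
        using cls_mul True scalar_R by metis
      then show ?thesis using that True cl by (simp add: M.ract_assoc[symmetric])
    qed
    have 1: "dec (\<mu> (u + v) \<lhd>\<^bsub>M\<^esub> cls r) = dec (\<mu> u \<lhd>\<^bsub>M\<^esub> cls r) + dec (\<mu> v \<lhd>\<^bsub>M\<^esub> cls r)"
      if "u \<in> V" "v \<in> V" for u v
      using that True by (intro eqI) (simp_all add: dec M.ract_closed cl mu_add M.ract_l_distr)
    have 2: "dec (\<mu> (c *s u) \<lhd>\<^bsub>M\<^esub> cls r) = c *s dec (\<mu> u \<lhd>\<^bsub>M\<^esub> cls r)" if "u \<in> V" for c u
      using that True by (intro eqI) (simp_all add: dec M.ract_closed cl mu_scale comm)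
    obtain g where "lin g" "\<And>v. v \<in> V \<Longrightarrow> g v = dec (\<mu> v \<lhd>\<^bsub>M\<^esub> cls r)"
      using lin_extend[OF sV 1 2] by blast
    then show ?thesis by blast
  next
    case False
    then show ?thesis using lin_zero by blast
  qed
  then obtain act where act: "\<And>r. lin (act r)"
    "\<And>r v. r \<in> R \<Longrightarrow> v \<in> V \<Longrightarrow> act r v = dec (\<mu> v \<lhd>\<^bsub>M\<^esub> cls r)"
    by metis
  have act_V: "act r v \<in> V" "\<mu> (act r v) = \<mu> v \<lhd>\<^bsub>M\<^esub> cls r" if "r \<in> R" "v \<in> V" for r v
    using that by (simp_all add: act mu_ract)
  have zero_act: "m \<lhd>\<^bsub>M\<^esub> \<zero>\<^bsub>A\<^esub> = \<zero>\<^bsub>M\<^esub>" if "m \<in> carrier M" for m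
    using M.ract_r_distr[of m "\<zero>\<^bsub>A\<^esub>" "\<zero>\<^bsub>A\<^esub>"] M.ract_closed[of m "\<zero>\<^bsub>A\<^esub>"] that
    by (simp add: M.add.l_cancel_one)
  have "rmod V act"
    unfolding rmod_def
  proof (intro conjI ballI allI)
    fix r s v assume rs: "r \<in> R" "s \<in> R" "v \<in> V"
    show "act (r + s) v = act r v + act s v"
      using rs by (intro eqI) (simp_all add: act_V cl R_closed mu_add cls_add M.ract_r_distr)
    show "act (r \<cdot> s) v = act s (act r v)"
      using rs by (intro eqI) (simp_all add: act_V cl mul_closed cls_mul M.ract_assoc)
  next
    fix c r v assume rv: "r \<in> R" "v \<in> V"
    have "c *s r = r \<cdot> (c *s un)" using rv un by (simp add: mul_scale_right)
    then have "cls (c *s r) = cls r \<otimes>\<^bsub>A\<^esub> cls (c *s un)" using cls_mul rv scalar_R by metis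
    then show "act (c *s r) v = c *s act r v"
      using rv by (intro eqI) (simp_all add: act_V cl R_closed mu_scale M.ract_assoc)
  next
    fix v assume v: "v \<in> V"
    show "act un v = v" using v by (intro eqI) (simp_all add: act_V un cls_un M.ract_one cl)
    fix i assume i: "i \<in> I"
    have iR: "i \<in> R" using I_R i .
    then have "cls i = \<zero>\<^bsub>A\<^esub>" using cls_I i by blast
    then show "act i v = 0"
      using v iR by (intro eqI) (simp_all add: act_V fs.subspace_0[OF sV] mu_0 zero_act cl)
  qed (use fV act act_V in auto)
  moreover have "module_equiv V act M \<mu>"
    using inj surj mu_add act_V(2) by (auto simp: module_equiv_def bij_betw_def)
  ultimately show thesis by (rule that)
qed

lemma module_equiv_zero:
  assumes V: "rmod V act" and \<kappa>: "module_equiv V act M \<kappa>" and M: "fd_module A M" and v: "v \<in> V"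
  shows "\<kappa> v = \<zero>\<^bsub>M\<^esub> \<longleftrightarrow> v = 0"
proof -
  interpret M: right_module A M using M by (simp add: fd_module_def)
  note E = module_equivD[OF \<kappa>]
  have z: "0 \<in> V" using rmodD(2)[OF V] fs.subspace_0 by blast
  have "\<kappa> 0 = \<zero>\<^bsub>M\<^esub>" using E(4)[OF z z] E(3)[OF z] by (simp add: M.add.l_cancel_one)
  then show ?thesis using inj_onD[OF E(1) _ v z] by auto
qed

lemma record_hom_to_hom:
  assumes V: "rmod V act" "module_equiv V act M \<kappa>" and W: "rmod W act'" "module_equiv W act' N \<eta>"
    and d: "d \<in> module_hom A M N"
  obtains f where "rhom V act W act' f" "\<And>v. v \<in> V \<Longrightarrow> \<eta> (f v) = d (\<kappa> v)"
proof -
  note EV = module_equivD[OF V(2)] and EW = module_equivD[OF W(2)]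
  note DV = rmodD[OF V(1)] and DW = rmodD[OF W(1)]
  have d': "\<And>m. m \<in> carrier M \<Longrightarrow> d m \<in> carrier N"
    "\<And>m m'. m \<in> carrier M \<Longrightarrow> m' \<in> carrier M \<Longrightarrow> d (m \<oplus>\<^bsub>M\<^esub> m') = d m \<oplus>\<^bsub>N\<^esub> d m'"
    "\<And>m X. m \<in> carrier M \<Longrightarrow> X \<in> carrier A \<Longrightarrow> d (m \<lhd>\<^bsub>M\<^esub> X) = d m \<lhd>\<^bsub>N\<^esub> X"
    using d by (auto simp: module_hom_def)
  define f where "f = (\<lambda>v. inv_into W \<eta> (d (\<kappa> v)))"
  have f: "f v \<in> W" "\<eta> (f v) = d (\<kappa> v)" if "v \<in> V" for v
  proof -
    have "d (\<kappa> v) \<in> \<eta> ` W" using d'(1) EV(3)[OF that] EW(2) by simp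
    then show "f v \<in> W" "\<eta> (f v) = d (\<kappa> v)" by (simp_all add: f_def inv_into_into f_inv_into_f)
  qed
  have eqI: "u = v" if "u \<in> W" "v \<in> W" "\<eta> u = \<eta> v" for u v
    using inj_onD[OF EW(1)] that by blast
  note cl = fs.subspace_add[OF DV(2)] fs.subspace_add[OF DW(2)] DV(4) DW(4)
  have f_add: "f (u + v) = f u + f v" if "u \<in> V" "v \<in> V" for u v
    using that by (intro eqI) (simp_all add: f cl EV EW d')
  have f_act: "f (act r v) = act' r (f v)" if "r \<in> R" "v \<in> V" for r v
    using that by (intro eqI) (simp_all add: f cl EV EW d' cls_closed)
  have f_scale: "f (c *s v) = c *s f v" if "v \<in> V" for c v
    using f_act[OF scalar_R that] act_scalar[OF V(1) that] act_scalar[OF W(1) f(1)[OF that]] by metis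
  obtain g where g: "lin g" "\<And>v. v \<in> V \<Longrightarrow> g v = f v" using lin_extend[OF DV(2) f_add f_scale] by blast
  have "rhom V act W act' g" using g f f_act DV(4) by (auto simp: rhom_def)
  then show thesis using that g f by simp
qed

lemma hom_to_record_hom:
  assumes V: "rmod V act" "module_equiv V act M \<kappa>" and W: "module_equiv W act' N \<eta>"
    and f: "rhom V act W act' f"
  obtains d where "d \<in> module_hom A M N" "\<And>v. v \<in> V \<Longrightarrow> d (\<kappa> v) = \<eta> (f v)"
proof -
  note EV = module_equivD[OF V(2)] and EW = module_equivD[OF W] and DV = rmodD[OF V(1)]
  have f': "lin f" "\<And>v. v \<in> V \<Longrightarrow> f v \<in> W" "\<And>r v. r \<in> R \<Longrightarrow> v \<in> V \<Longrightarrow> f (act r v) = act' r (f v)"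
    using f by (auto simp: rhom_def)
  define d where "d = (\<lambda>m. \<eta> (f (inv_into V \<kappa> m)))"
  have d: "d (\<kappa> v) = \<eta> (f v)" if "v \<in> V" for v using that EV(1) by (simp add: d_def)
  have "d \<in> module_hom A M N"
    unfolding module_hom_def
  proof (intro CollectI conjI ballI funcsetI)
    fix m assume "m \<in> carrier M"
    then obtain v where v: "v \<in> V" "m = \<kappa> v" using EV(2) by auto
    show "d m \<in> carrier N" using v d f' EW(3) by simp
    show "d (m \<lhd>\<^bsub>M\<^esub> X) = d m \<lhd>\<^bsub>N\<^esub> X" if X: "X \<in> carrier A" for X
    proof -
      obtain r where r: "r \<in> R" "X = cls r" using X[folded cls_image] by auto
      have "d (m \<lhd>\<^bsub>M\<^esub> X) = d (\<kappa> (act r v))" using EV(5)[OF r(1) v(1)] r v by simp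
      then show ?thesis using d[OF DV(4)[OF r(1) v(1)]] d[OF v(1)] f' EW(5) r v by simp
    qed
    fix m' assume "m' \<in> carrier M"
    then obtain u where u: "u \<in> V" "m' = \<kappa> u" using EV(2) by auto
    have "d (m \<oplus>\<^bsub>M\<^esub> m') = d (\<kappa> (v + u))" using EV(4) u v by simp
    then show "d (m \<oplus>\<^bsub>M\<^esub> m') = d m \<oplus>\<^bsub>N\<^esub> d m'"
      using d fs.subspace_add[OF DV(2)] u v f' EW(4) lin_add[OF f'(1)] by simp
  qed
  then show thesis using that d by blast
qed

text \<open>
  A cocycle makes \<open>Y \<oplus> V\<close> into an extension of the projective module \<open>V\<close> by \<open>Y\<close>, which splits.
\<close>

lemma projective_ext_zero:
  fixes P :: "('k, 'a) std_module" and V :: "('q \<Rightarrow> 'k) set" and Y :: "('y \<Rightarrow> 'k) set"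
  assumes P: "fd_module A P" "projective A P" and V: "rmod V act" "module_equiv V act P \<kappa>"
    and Y: "rmod Y actY"
  shows "ext_zero V act Y actY"
  unfolding ext_zero_def
proof (intro allI impI)
  fix c assume c: "cocycle V act Y actY c"
  note C = cocycleD[OF c] and DV = rmodD[OF V(1)] and DY = rmodD[OF Y]
  \<comment> \<open>The direct sum of \<open>Y\<close> and \<open>V\<close>, as functions on the
    disjoint sum of the index types.\<close>
  define W where "W = {f. (\<lambda>x. f (Inl x)) \<in> Y \<and> (\<lambda>x. f (Inr x)) \<in> V}"
  define fl where "fl = (\<lambda>(f :: 'y + 'q \<Rightarrow> 'k) x. f (Inl x))"
  define fr where "fr = (\<lambda>(f :: 'y + 'q \<Rightarrow> 'k) x. f (Inr x))"
  define pair where "pair = (\<lambda>y v. case_sum y v :: 'y + 'q \<Rightarrow> 'k)"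
  have W: "f \<in> W \<longleftrightarrow> fl f \<in> Y \<and> fr f \<in> V" for f by (simp add: W_def fl_def fr_def)
  have pr: "fl (pair y v) = y" "fr (pair y v) = v" for y v
    by (simp_all add: fl_def fr_def pair_def)
  have sumI: "f = h" if "fl f = fl h" "fr f = fr h" for f h
  proof
    fix x show "f x = h x" using fun_cong[OF that(1)] fun_cong[OF that(2)]
      by (cases x) (simp_all add: fl_def fr_def)
  qed
  have lf: "lin fl" "lin fr" by (rule linI; simp add: fl_def fr_def pointwise fun_eq_iff)+
  note L = lin_add[OF lf(1)] lin_add[OF lf(2)] lin_scale[OF lf(1)] lin_scale[OF lf(2)]
    lin_0[OF lf(1)] lin_0[OF lf(2)]
  have lp: "lin (\<lambda>u. pair (f u) (g u))" if "lin f" "lin g" for f g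
    by (rule linI; rule sumI; simp add: pr L lin_add[OF that(1)] lin_add[OF that(2)]
        lin_scale[OF that(1)] lin_scale[OF that(2)])
  have sW: "fs.subspace W"
    using DV(2) DY(2) by (auto simp: fs.subspace_def W L)
  have fW: "fin_dim W"
  proof -
    obtain S T where ST: "finite S" "Y \<subseteq> fs.span S" "finite T" "V \<subseteq> fs.span T"
      using DV(1) DY(1) by (auto simp: fin_dim_def)
    let ?l = "\<lambda>y. pair y 0" and ?r = "\<lambda>v. pair 0 v"
    have l: "lin ?l" "lin ?r" by (rule lp[OF lin_id lin_zero], rule lp[OF lin_zero lin_id])
    have "f \<in> fs.span (?l ` S \<union> ?r ` T)" if f: "f \<in> W" for f
    proof -
      have "?l (fl f) \<in> ?l ` fs.span S" "?r (fr f) \<in> ?r ` fs.span T" using f ST by (auto simp: W)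
      then have "?l (fl f) \<in> fs.span (?l ` S)" "?r (fr f) \<in> fs.span (?r ` T)"
        using fsp.linear_span_image[OF l(1)] fsp.linear_span_image[OF l(2)] by simp_all
      moreover have "fs.span (?l ` S) \<subseteq> fs.span (?l ` S \<union> ?r ` T)"
        "fs.span (?r ` T) \<subseteq> fs.span (?l ` S \<union> ?r ` T)"
        by (intro fs.span_mono Un_upper1 Un_upper2)+
      ultimately have "?l (fl f) + ?r (fr f) \<in> fs.span (?l ` S \<union> ?r ` T)"
        by (intro fs.span_add) (auto dest: subsetD)
      moreover have "?l (fl f) + ?r (fr f) = f" by (rule sumI) (simp_all add: pr L)
      ultimately show ?thesis by simp
    qed
    moreover have "finite (?l ` S \<union> ?r ` T)" using ST by blast
    ultimately show ?thesis using sW unfolding fin_dim_def by blast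
  qed
  define actW where "actW = (\<lambda>r f. pair (actY r (fl f) + c r (fr f)) (act r (fr f)))"
  have rW: "rmod W actW"
    unfolding rmod_def
  proof (intro conjI ballI allI)
    show "lin (actW r)" for r
      unfolding actW_def
      by (intro lp lin_plus lin_app[OF DY(3) lf(1)] lin_app[OF C(1) lf(2)] lin_app[OF DV(3) lf(2)])
    fix f assume "f \<in> W"
    then have f: "fl f \<in> Y" "fr f \<in> V" by (simp_all add: W)
    \<comment> \<open>The cocycle identity at \<open>un \<cdot> un\<close> reads
      \<open>c un = c un + c un\<close>; hence the unit acts as the identity on the
      extension.\<close>
    have un0: "c un (fr f) = 0"
      using C(6)[OF un(1) un(1) f(2)] DV(8)[OF f(2)] DY(8)[OF C(2)[OF un(1) f(2)]] un by simp
    show "actW un f = f" by (rule sumI) (simp_all add: actW_def pr DV(8) DY(8) f un0)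
    show "actW i f = 0" if "i \<in> I" for i
      using that by (intro sumI) (simp_all add: actW_def pr L DV(9) DY(9) C(5) f)
    fix r assume r: "r \<in> R"
    show "actW r f \<in> W" using r f by (simp add: W actW_def pr DV(4) DY(4) C(2) fs.subspace_add[OF DY(2)])
    show "actW (a *s r) f = a *s actW r f" for a
      using r f by (intro sumI) (simp_all add: actW_def pr L DV(6) DY(6) C(4) fs.scale_right_distrib)
    fix s assume s: "s \<in> R"
    show "actW (r + s) f = actW r f + actW s f"
      using r s f by (intro sumI) (simp_all add: actW_def pr L DV(5) DY(5) C(3) algebra_simps)
    have e: "actY s (actY r (fl f) + c r (fr f)) + c s (act r (fr f))
        = actY (r \<cdot> s) (fl f) + c (r \<cdot> s) (fr f)"
      using r s f by (simp add: DY(7) C(6) lin_add[OF DY(3)] algebra_simps)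
    show "actW (r \<cdot> s) f = actW s (actW r f)"
      by (rule sumI) (simp_all add: actW_def pr e DV(7)[OF r s f(2)])
  qed (rule fW)
  obtain N :: "('k, 'a) std_module" and \<eta> where N: "fd_module A N" "module_equiv W actW N \<eta>"
    using rmod_to_record[OF rW] by blast
  have "rhom W actW V act fr" using lf(2) by (auto simp: rhom_def W actW_def pr)
  then obtain g where g: "g \<in> module_hom A N P" "\<And>w. w \<in> W \<Longrightarrow> g (\<eta> w) = \<kappa> (fr w)"
    using hom_to_record_hom[OF rW N(2) V(2)] by blast
  note EV = module_equivD[OF V(2)] and EN = module_equivD[OF N(2)]
  have gN: "g ` carrier N = carrier P"
  proof
    show "g ` carrier N \<subseteq> carrier P" using g(1) by (auto simp: module_hom_def)
    show "carrier P \<subseteq> g ` carrier N"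
    proof
      fix p assume "p \<in> carrier P"
      then obtain v where v: "v \<in> V" "p = \<kappa> v" using EV(2) by auto
      have "pair 0 v \<in> W" using v fs.subspace_0[OF DY(2)] by (simp add: W pr)
      then show "p \<in> g ` carrier N" using g(2)[of "pair 0 v"] EN(3) v
        by (intro image_eqI[of _ _ "\<eta> (pair 0 v)"]) (simp_all add: pr)
    qed
  qed
  \<comment> \<open>Lifting the identity of \<open>P\<close> along \<open>g\<close> splits the
    extension, and the \<open>Y\<close>-component of the splitting trivialises
    \<open>c\<close>.\<close>
  have "(\<lambda>p. p) \<in> module_hom A P P" by (simp add: module_hom_def)
  then obtain s where s: "s \<in> module_hom A P N" "\<And>p. p \<in> carrier P \<Longrightarrow> g (s p) = p"
    using P N(1) g(1) gN unfolding projective_def by meson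
  obtain w where w: "rhom V act W actW w" "\<And>v. v \<in> V \<Longrightarrow> \<eta> (w v) = s (\<kappa> v)"
    using record_hom_to_hom[OF V rW N(2) s(1)] by blast
  have w': "lin w" "\<And>v. v \<in> V \<Longrightarrow> w v \<in> W"
    "\<And>r v. r \<in> R \<Longrightarrow> v \<in> V \<Longrightarrow> w (act r v) = actW r (w v)"
    using w(1) by (auto simp: rhom_def)
  have frw: "fr (w v) = v" if "v \<in> V" for v
  proof -
    have "\<kappa> (fr (w v)) = \<kappa> v" using g(2)[OF w'(2)[OF that]] w(2)[OF that] s(2)[OF EV(3)[OF that]] by simp
    then show ?thesis using inj_onD[OF EV(1)] w'(2)[OF that] that by (auto simp: W)
  qed
  have "lin (\<lambda>v. fl (w v))" by (rule lin_app[OF lf(1) w'(1)])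
  moreover have "(\<lambda>v. fl (w v)) ` V \<subseteq> Y" using w'(2) by (auto simp: W)
  moreover have "c r v = fl (w (act r v)) - actY r (fl (w v))" if "r \<in> R" "v \<in> V" for r v
    using w'(3)[OF that] frw[OF that(2)] by (simp add: actW_def pr)
  ultimately show "\<exists>h. lin h \<and> h ` V \<subseteq> Y \<and> (\<forall>r\<in>R. \<forall>m\<in>V. c r m = h (act r m) - actY r (h m))"
    by blast
qed

end

context bound_algebra
begin

lemma ext_zero_trivial:
  assumes "M \<subseteq> {0}" "rmod Y actY"
  shows "ext_zero M actM Y actY"
  unfolding ext_zero_def
proof (intro allI impI)
  fix c assume c: "cocycle M actM Y actY c"
  note D = rmodD[OF assms(2)]
  have "c r 0 = 0" for r using lin_0[OF cocycleD(1)[OF c]] .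
  then show "\<exists>h. lin h \<and> h ` M \<subseteq> Y \<and> (\<forall>r\<in>R. \<forall>m\<in>M. c r m = h (actM r m) - actY r (h m))"
    using assms(1) fs.subspace_0[OF D(2)] lin_0[OF D(3)]
    by (intro exI[of _ "\<lambda>_. 0"]) (auto simp: lin_zero)
qed

end

locale looped_presented_algebra =
  looped_algebra R mul un I G eps D a + presented_algebra R mul un I G A cls
  for R :: "('p \<Rightarrow> 'k::field) set" and mul (infixl \<open>\<cdot>\<close> 70) and un I G
    and eps D :: "('p \<Rightarrow> 'k) \<Rightarrow> 'k" and a and A :: "('k, 'a) module" and cls
begin

text \<open>The resolution is transported to function modules, where its syzygies vanish beyond
  \<open>n\<close>. Dimension shifting then supplies both hypotheses of
  \<open>looped_algebra_contradiction\<close>.\<close>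

theorem no_finite_resolution:
  fixes S :: "('a, 'k) right_module"
  assumes S: "carrier S = UNIV" "\<zero>\<^bsub>S\<^esub> = 0" "\<And>m n. m \<oplus>\<^bsub>S\<^esub> n = m + n"
      "\<And>m r. r \<in> R \<Longrightarrow> m \<lhd>\<^bsub>S\<^esub> cls r = m * eps r"
    and res: "projective_resolution A S P d \<epsilon>"
    and fin: "\<And>i. i > n \<Longrightarrow> carrier (P i) = {\<zero>\<^bsub>P i\<^esub>}"
  shows False
proof -
  have P: "fd_module A (P i)" "projective A (P i)" and d: "d i \<in> module_hom A (P (Suc i)) (P i)"
    and e: "\<epsilon> \<in> module_hom A (P 0) S" "\<epsilon> ` carrier (P 0) = carrier S"
    and d0: "d 0 ` carrier (P 1) = module_ker (P 0) S \<epsilon>"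
    and dS: "d (Suc i) ` carrier (P (Suc (Suc i))) = module_ker (P (Suc i)) (P i) (d i)" for i
    using res unfolding projective_resolution_def by auto
  have "\<exists>(V :: ((nat \<Rightarrow> 'k) \<Rightarrow> 'k) set) act \<kappa>. rmod V act \<and> module_equiv V act (P i) \<kappa>" for i
    by (rule record_to_rmod[OF P(1)]) blast
  then obtain V :: "nat \<Rightarrow> ((nat \<Rightarrow> 'k) \<Rightarrow> 'k) set" and act \<kappa> where V: "\<And>i. rmod (V i) (act i)" "\<And>i. module_equiv (V i) (act i) (P i) (\<kappa> i)"
    by metis
  note EV = module_equivD[OF V(2)] and DV = rmodD[OF V(1)]
  have "\<exists>f. rhom (V (Suc i)) (act (Suc i)) (V i) (act i) f \<and>
      (\<forall>v\<in>V (Suc i). \<kappa> i (f v) = d i (\<kappa> (Suc i) v))" for i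
    by (rule record_hom_to_hom[OF V(1) V(2) V(1) V(2) d]) blast
  then obtain \<delta> where \<delta>: "\<And>i. rhom (V (Suc i)) (act (Suc i)) (V i) (act i) (\<delta> i)"
    "\<And>i v. v \<in> V (Suc i) \<Longrightarrow> \<kappa> i (\<delta> i v) = d i (\<kappa> (Suc i) v)"
    by metis
  have e': "\<epsilon> (\<kappa> 0 (u + v)) = \<epsilon> (\<kappa> 0 u) + \<epsilon> (\<kappa> 0 v)" if "u \<in> V 0" "v \<in> V 0" for u v
    using e(1) that EV(3,4)[of _ 0] by (simp add: module_hom_def S)
  have e_act: "\<epsilon> (\<kappa> 0 (act 0 r v)) = \<epsilon> (\<kappa> 0 v) * eps r" if "r \<in> R" "v \<in> V 0" for r v
    using e(1) that EV(3)[OF that(2)] EV(5)[OF that] cls_closed by (simp add: module_hom_def S)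
  have e_scale: "\<epsilon> (\<kappa> 0 (c *s v)) = c * \<epsilon> (\<kappa> 0 v)" if "v \<in> V 0" for c v
    using e_act[OF scalar_R that, of c] act_scalar[OF V(1) that] eps_scale[OF un(1), of c] eps_un
    by (simp add: mult.commute)
  obtain \<pi> :: "_ \<Rightarrow> unit \<Rightarrow> 'k" where \<pi>: "lin \<pi>" "\<And>v. v \<in> V 0 \<Longrightarrow> \<pi> v = (\<lambda>_. \<epsilon> (\<kappa> 0 v))"
  proof (rule lin_extend[OF DV(2)[of 0], of "\<lambda>v _. \<epsilon> (\<kappa> 0 v) :: 'k"])
    show "(\<lambda>_::unit. \<epsilon> (\<kappa> 0 (u + v))) = (\<lambda>_. \<epsilon> (\<kappa> 0 u)) + (\<lambda>_. \<epsilon> (\<kappa> 0 v))"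
      if "u \<in> V 0" "v \<in> V 0" for u v using e'[OF that] by (simp add: fun_eq_iff pointwise)
    show "(\<lambda>_::unit. \<epsilon> (\<kappa> 0 (c *s u))) = c *s (\<lambda>_. \<epsilon> (\<kappa> 0 u))" if "u \<in> V 0" for c u
      using e_scale[OF that] by (simp add: fun_eq_iff pointwise)
  qed blast
  let ?S = "UNIV :: (unit \<Rightarrow> 'k) set" and ?s = "\<lambda>r (v :: unit \<Rightarrow> 'k). eps r *s v"
  have hom_pi: "rhom (V 0) (act 0) ?S ?s \<pi>"
    using \<pi> e_act DV(4) by (auto simp: rhom_def fun_eq_iff pointwise mult.commute)
  have pi_onto: "\<pi> ` V 0 = ?S"
  proof -
    have "u \<in> \<pi> ` V 0" for u
    proof -
      obtain p where p: "p \<in> carrier (P 0)" "\<epsilon> p = u ()" using e(2) S(1) by (metis UNIV_I imageE)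
      then obtain v where "v \<in> V 0" "p = \<kappa> 0 v" using EV(2)[of 0] by auto
      then have "u () = \<pi> v ()" using p(2) by (simp add: \<pi>(2))
      then have "u = \<pi> v" by (intro ext) simp
      then show ?thesis using \<open>v \<in> V 0\<close> by blast
    qed
    then show ?thesis by blast
  qed
  \<comment> \<open>\<open>K i\<close> is the syzygy number \<open>i + 1\<close> of
    \<open>S\<close>.\<close>
  define K where "K = (\<lambda>i. case i of 0 \<Rightarrow> {v \<in> V 0. \<pi> v = 0} | Suc j \<Rightarrow> {v \<in> V (Suc j). \<delta> j v = 0})"
  have K0: "K 0 = {v \<in> V 0. \<pi> v = 0}" and KS: "K (Suc i) = {v \<in> V (Suc i). \<delta> i v = 0}" for i
    by (simp_all add: K_def)
  have z: "\<kappa> i v = \<zero>\<^bsub>P i\<^esub> \<longleftrightarrow> v = 0" if "v \<in> V i" for i v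
    using module_equiv_zero[OF V(1) V(2) P(1) that] .
  have kK: "\<kappa> i ` K i = d i ` carrier (P (Suc i))" for i
  proof (cases i)
    case 0
    have "\<kappa> 0 ` K 0 = module_ker (P 0) S \<epsilon>"
    proof -
      have "module_ker (P 0) S \<epsilon> = {m \<in> \<kappa> 0 ` V 0. \<epsilon> m = 0}" by (simp add: module_ker_def S EV(2))
      also have "\<dots> = \<kappa> 0 ` K 0" using \<pi>(2) by (auto simp: K0 fun_eq_iff pointwise)
      finally show ?thesis by simp
    qed
    then show ?thesis using 0 d0 by simp
  next
    case (Suc j)
    have dV: "\<delta> j v \<in> V j" if "v \<in> V (Suc j)" for v using \<delta>(1)[of j] that by (auto simp: rhom_def)
    have ker: "d j (\<kappa> (Suc j) v) = \<zero>\<^bsub>P j\<^esub> \<longleftrightarrow> \<delta> j v = 0" if "v \<in> V (Suc j)" for v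
      using \<delta>(2)[OF that] z[OF dV[OF that]] by simp
    have "module_ker (P (Suc j)) (P j) (d j) = {m \<in> \<kappa> (Suc j) ` V (Suc j). d j m = \<zero>\<^bsub>P j\<^esub>}"
      by (simp add: module_ker_def EV(2))
    also have "\<dots> = \<kappa> (Suc j) ` K (Suc j)"
      using ker by (auto simp: KS)
    finally show ?thesis using Suc dS[of j] by simp
  qed
  \<comment> \<open>Exactness is given for records; it is transported by comparing images under the
    injective \<open>\<kappa> i\<close>.\<close>
  have im: "\<delta> i ` V (Suc i) = K i" for i
  proof (rule inj_on_image_eq_iff[OF EV(1)[of i], THEN iffD1])
    show "\<delta> i ` V (Suc i) \<subseteq> V i" using \<delta>(1)[of i] by (simp add: rhom_def)
    show "K i \<subseteq> V i" by (auto simp: K_def split: nat.splits)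
    have "\<kappa> i ` \<delta> i ` V (Suc i) = d i ` \<kappa> (Suc i) ` V (Suc i)"
      using \<delta>(2) by (simp add: image_image cong: image_cong)
    then show "\<kappa> i ` \<delta> i ` V (Suc i) = \<kappa> i ` K i" by (simp add: kK EV(2))
  qed
  have hom_K: "rhom (V (Suc i)) (act (Suc i)) (K i) (act i) (\<delta> i)" for i
    using \<delta>(1)[of i] im[of i] by (simp add: rhom_def)
  have EP: "ext_zero (V i) (act i) Y actY" if "rmod Y actY" for i and Y :: "(('p \<Rightarrow> 'k) list \<Rightarrow> 'k) set" and actY
    by (rule projective_ext_zero[OF P V that])
  \<comment> \<open>\<open>m\<close> is an index from which \<open>Ext^1(K i, Y)\<close> vanishes:
    \<open>Suc n\<close> for arbitrary \<open>Y\<close>, and 0 for the injective dual. The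
    additional \<open>Suc\<close> is the shift from \<open>K 0\<close> to the simple module
    itself.\<close>
  have simple: "ext_simple_zero ((cosyz ^^ Suc j) Y) ((cosyz_act ^^ Suc j) actY)"
    if Y: "rmod Y actY" and m: "\<And>i. i \<ge> m \<Longrightarrow> ext_zero (K i) (act i) Y actY" and j: "j \<ge> m" for Y actY m j
  proof (rule ext_simple_zeroI)
    note it = iterate_rmod[OF Y]
    have "ext_zero (K 0) (act 0) ((cosyz ^^ j) Y) ((cosyz_act ^^ j) actY)"
      by (rule ext_zero_resolution[where P = V and actP = act and K = K and d = \<delta> and n = m and i = 0])
        (use V(1) EP hom_K im KS Y m j in simp_all)
    from ext_zero_shift[OF V(1) it hom_pi pi_onto K0 EP[OF cosyz_rmod[OF it]] this]
    show "ext_zero ?S ?s ((cosyz ^^ Suc j) Y) ((cosyz_act ^^ Suc j) actY)" by simp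
    show "rmod ((cosyz ^^ Suc j) Y) ((cosyz_act ^^ Suc j) actY)" by (rule it)
  qed
  have KN: "K i \<subseteq> {0}" if "i > n" for i
  proof
    fix v assume v: "v \<in> K i"
    have vV: "v \<in> V i" using v by (auto simp: K_def split: nat.splits)
    then have "\<kappa> i v = \<zero>\<^bsub>P i\<^esub>" using EV(3)[OF vV] fin[OF that] by simp
    then show "v \<in> {0}" using z[OF vV] by simp
  qed
  show False
  proof (rule looped_algebra_contradiction)
    show "ext_simple_zero ((cosyz ^^ Suc (Suc n)) Y) ((cosyz_act ^^ Suc (Suc n)) actY)"
      if "rmod Y actY" for Y actY
      using KN by (intro simple[OF that, of "Suc n"] ext_zero_trivial[OF _ that]) simp_all
    show "ext_simple_zero ((cosyz ^^ j) dual_alg) ((cosyz_act ^^ j) dual_act)" for j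
    proof (cases j)
      case 0
      then show ?thesis using ext_simple_zeroI[OF ext_zero_dual dual_alg_rmod] by simp
    next
      case (Suc i)
      show ?thesis unfolding Suc by (rule simple[OF dual_alg_rmod, of 0]) (simp_all add: ext_zero_dual)
    qed
  qed
qed

end

section \<open>Bound quiver algebras\<close>

lemma path_algebra_simps:
  "f \<oplus>\<^bsub>path_algebra Q\<^esub> g = f + g" "\<zero>\<^bsub>path_algebra Q\<^esub> = 0" "c \<odot>\<^bsub>path_algebra Q\<^esub> f = c *s f"
  "(f \<otimes>\<^bsub>path_algebra Q\<^esub> g) (u, p) =
    (\<Sum>i\<le>length p. f (u, take i p) * g (pre_digraph.awlast Q u (take i p), drop i p))"
  by (auto simp: path_algebra_def fun_eq_iff pointwise)

lemma path_algebra_carrier: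
  "f \<in> carrier (path_algebra Q) \<longleftrightarrow> finite {r. f r \<noteq> 0} \<and> {r. f r \<noteq> 0} \<subseteq> quiver_paths Q"
  by (simp add: path_algebra_def)

lemma path_algebra_subspace:
  "fs.subspace (carrier (path_algebra Q) :: ('v \<times> 'e list \<Rightarrow> 'k::field) set)"
  unfolding fs.subspace_def
proof (intro conjI ballI allI)
  show "(0 :: 'v \<times> 'e list \<Rightarrow> 'k) \<in> carrier (path_algebra Q)"
    by (simp add: path_algebra_carrier pointwise)
  fix f :: "'v \<times> 'e list \<Rightarrow> 'k" assume f: "f \<in> carrier (path_algebra Q)"
  have "{r. (c *s f) r \<noteq> 0} \<subseteq> {r. f r \<noteq> 0}" for c by (auto simp: pointwise)
  then show "c *s f \<in> carrier (path_algebra Q)" for c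
    using f finite_subset unfolding path_algebra_carrier by blast
  fix g :: "'v \<times> 'e list \<Rightarrow> 'k" assume g: "g \<in> carrier (path_algebra Q)"
  have "{r. (f + g) r \<noteq> 0} \<subseteq> {r. f r \<noteq> 0} \<union> {r. g r \<noteq> 0}" by (auto simp: pointwise)
  then show "f + g \<in> carrier (path_algebra Q)"
    using f g finite_subset finite_Un unfolding path_algebra_carrier by (metis (no_types, lifting) Un_least subset_trans)
qed

lemma path_algebra_delta:
  "q \<in> quiver_paths Q \<Longrightarrow> (\<lambda>p. if p = q then 1 else 0) \<in> carrier (path_algebra Q)"
  by (auto simp: path_algebra_carrier)

lemma finite_short_paths:
  assumes "fin_digraph Q"
  shows "finite {q \<in> quiver_paths Q. length (snd q) < m}"
proof -
  interpret fin_digraph Q by fact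
  have "{q \<in> quiver_paths Q. length (snd q) < m} \<subseteq>
      verts Q \<times> {p. set p \<subseteq> arcs Q \<and> length p \<le> m}"
    by (auto simp: quiver_paths_def awalk_def)
  then show ?thesis
    by (rule finite_subset) (intro finite_cartesian_product finite_verts finite_lists_length_le finite_arcs)
qed

text \<open>Modulo \<open>I\<close> only paths shorter than \<open>m\<close> matter: deleting their
  coefficients from an element leaves a combination of paths of length at least
  \<open>m\<close>.\<close>

lemma bound_quiver_bound_algebra:
  fixes I :: "('v \<times> 'e list \<Rightarrow> 'k::field) set"
  assumes Q: "fin_digraph Q" and I: "ideal I (path_algebra Q)" and m: "arrow_ideal_power Q m \<subseteq> I"
  shows "bound_algebra (carrier (path_algebra Q)) (mult (path_algebra Q)) (one (path_algebra Q)) I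
    {q \<in> quiver_paths Q. length (snd q) < m}"
proof -
  interpret I: ideal I "path_algebra Q" by fact
  show ?thesis
  proof
    fix r s t :: "'v \<times> 'e list \<Rightarrow> 'k" and c
    assume r: "r \<in> carrier (path_algebra Q)"
    show "c *s r \<otimes>\<^bsub>path_algebra Q\<^esub> s = c *s (r \<otimes>\<^bsub>path_algebra Q\<^esub> s)"
      by (auto simp: fun_eq_iff path_algebra_simps pointwise sum_distrib_left mult.assoc)
    show "r \<otimes>\<^bsub>path_algebra Q\<^esub> c *s s = c *s (r \<otimes>\<^bsub>path_algebra Q\<^esub> s)"
      by (auto simp: fun_eq_iff path_algebra_simps pointwise sum_distrib_left mult.left_commute)
    let ?\<delta> = "\<lambda>g p. if p = g then 1 else 0" and ?G = "{q \<in> quiver_paths Q. length (snd q) < m}"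
    let ?f = "r - (\<Sum>g\<in>?G. r g *s ?\<delta> g)"
    have val: "?f q = (if q \<in> ?G then 0 else r q)" for q
    proof -
      have "(\<Sum>g\<in>?G. r g *s ?\<delta> g) q = (\<Sum>g\<in>?G. if g = q then r q else 0)"
        unfolding sum_apply by (rule sum.cong) (auto simp: pointwise)
      then show ?thesis using finite_short_paths[OF Q, of m] by (simp add: pointwise)
    qed
    have "{q. ?f q \<noteq> 0} \<subseteq> {q. r q \<noteq> 0}"
    proof
      fix q assume "q \<in> {q. ?f q \<noteq> 0}"
      then have "?f q \<noteq> 0" by (rule CollectD)
      then show "q \<in> {q. r q \<noteq> 0}" unfolding val by (simp split: if_splits)
    qed
    then have "?f \<in> carrier (path_algebra Q)"
      using r finite_subset unfolding path_algebra_carrier by blast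
    moreover have "m \<le> length p" if "?f (u, p) \<noteq> 0" for u p
      using that r by (auto simp: val path_algebra_carrier split: if_splits)
    ultimately have "?f \<in> arrow_ideal_power Q m" unfolding arrow_ideal_power_def by blast
    then show "?f \<in> I" using m by blast
  qed (use I.m_assoc I.l_distr[unfolded path_algebra_simps(1)] I.r_distr[unfolded path_algebra_simps(1)] I.l_one I.r_one finite_short_paths[OF Q]
      path_algebra_subspace I.Icarr I.I_l_closed I.I_r_closed path_algebra_delta in auto)
qed

lemma bound_quiver_cls:
  fixes I :: "('v \<times> 'e list \<Rightarrow> 'k::field) set"
  assumes I: "ideal I (path_algebra Q)"
  defines "R \<equiv> carrier (path_algebra Q)" and "A \<equiv> bound_quiver_algebra Q I"
    and "cls \<equiv> \<lambda>r. I +>\<^bsub>path_algebra Q\<^esub> r"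
  shows "cls ` R = carrier A"
    "\<And>r s. r \<in> R \<Longrightarrow> s \<in> R \<Longrightarrow> cls (r + s) = cls r \<oplus>\<^bsub>A\<^esub> cls s"
    "\<And>r s. r \<in> R \<Longrightarrow> s \<in> R \<Longrightarrow> cls (r \<otimes>\<^bsub>path_algebra Q\<^esub> s) = cls r \<otimes>\<^bsub>A\<^esub> cls s"
    "cls \<one>\<^bsub>path_algebra Q\<^esub> = \<one>\<^bsub>A\<^esub>"
    "\<And>c r. r \<in> R \<Longrightarrow> cls (c *s r) = c \<odot>\<^bsub>A\<^esub> cls r"
    "\<And>r. r \<in> R \<Longrightarrow> cls r = \<zero>\<^bsub>A\<^esub> \<longleftrightarrow> r \<in> I"
    "\<And>r. cls r = {h + r |h. h \<in> I}"
proof -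
  interpret I: ideal I "path_algebra Q" by fact
  have cls: "cls r = {h + r |h. h \<in> I}" for r
    by (auto simp: cls_def a_r_coset_def' path_algebra_simps)
  show "cls r = {h + r |h. h \<in> I}" for r by (rule cls)
  note A = A_def quotient_algebra_def FactRing_def
  show "cls ` R = carrier A" by (auto simp: A cls_def R_def A_RCOSETS_def')
  show "cls (r + s) = cls r \<oplus>\<^bsub>A\<^esub> cls s" if "r \<in> R" "s \<in> R" for r s
    using I.a_rcos_sum[of r s] that by (simp add: A cls_def R_def path_algebra_simps)
  show "cls (r \<otimes>\<^bsub>path_algebra Q\<^esub> s) = cls r \<otimes>\<^bsub>A\<^esub> cls s" if "r \<in> R" "s \<in> R" for r s
    using I.rcoset_mult_add[of r s] that by (simp add: A cls_def R_def)
  show "cls \<one>\<^bsub>path_algebra Q\<^esub> = \<one>\<^bsub>A\<^esub>" by (simp add: A cls_def)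
  note sub = ideal.axioms(1)[OF I]
  have zI: "0 \<in> I" using additive_subgroup.zero_closed[OF sub] by (simp add: path_algebra_simps)
  have addI: "f + g \<in> I" if "f \<in> I" "g \<in> I" for f g
    using additive_subgroup.a_closed[OF sub that] by (simp add: path_algebra_simps)
  show zero: "cls r = \<zero>\<^bsub>A\<^esub> \<longleftrightarrow> r \<in> I" if "r \<in> R" for r
  proof
    assume "cls r = \<zero>\<^bsub>A\<^esub>"
    moreover have "r \<in> cls r" using zI by (auto simp: cls intro!: exI[of _ 0])
    ultimately show "r \<in> I" by (simp add: A)
  next
    assume "r \<in> I"
    then show "cls r = \<zero>\<^bsub>A\<^esub>"
      using I.a_coset_join2[of r I] that I.a_subgroup by (simp add: A cls_def R_def)
  qed
  \<comment> \<open>\<open>ideal\<close> demands no closure under scalars; this follows because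
    multiples of the unit belong to the algebra.\<close>
  have scI: "c *s h \<in> I" if h: "h \<in> I" for c h
  proof -
    have hR: "h \<in> R" using I.Icarr[OF h] by (simp add: R_def)
    have "c *s \<one>\<^bsub>path_algebra Q\<^esub> \<in> R"
      unfolding R_def by (rule fs.subspace_scale[OF path_algebra_subspace I.one_closed])
    then have "(c *s \<one>\<^bsub>path_algebra Q\<^esub>) \<otimes>\<^bsub>path_algebra Q\<^esub> h \<in> I"
      using I.I_l_closed[OF h] by (simp add: R_def)
    moreover have "(c *s \<one>\<^bsub>path_algebra Q\<^esub>) \<otimes>\<^bsub>path_algebra Q\<^esub> h = c *s (\<one>\<^bsub>path_algebra Q\<^esub> \<otimes>\<^bsub>path_algebra Q\<^esub> h)"
      by (auto simp: fun_eq_iff path_algebra_simps(4) pointwise sum_distrib_left mult.assoc)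
    ultimately show ?thesis using hR by (simp add: R_def)
  qed
  show "cls (c *s r) = c \<odot>\<^bsub>A\<^esub> cls r" if "r \<in> R" for c r
  proof -
    have "c \<odot>\<^bsub>A\<^esub> cls r = (\<Union>f\<in>cls r. cls (c *s f))"
      by (simp add: A cls_def path_algebra_simps)
    moreover have "cls (c *s f) = cls (c *s r)" if f: "f \<in> cls r" for f
    proof -
      obtain h where h: "h \<in> I" "f = h + r" using f by (auto simp: cls)
      have "h' + c *s f \<in> cls (c *s r)" if "h' \<in> I" for h'
        using addI[OF that scI[OF h(1), of c]] h(2)
        by (auto simp: cls fs.scale_right_distrib add.assoc intro!: exI[of _ "h' + c *s h"])
      moreover have "h' + c *s r \<in> cls (c *s f)" if "h' \<in> I" for h'
        using addI[OF that scI[OF h(1), of "- c"]] h(2)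
        by (auto simp: cls fs.scale_right_distrib fs.scale_minus_left add.assoc
            intro!: exI[of _ "h' + (- c) *s h"])
      ultimately show ?thesis using cls by (auto simp: cls[of "c *s f"] cls[of "c *s r"])
    qed
    moreover have "cls r \<noteq> {}" using zI by (auto simp: cls)
    ultimately show ?thesis by auto
  qed
qed

text \<open>The map to B reads off the coefficients at the trivial path and at the loop
  \<open>e\<close>. They vanish on \<open>I\<close>, whose elements involve only paths of length at
  least two. It is multiplicative because \<open>[e]\<close> can be cut only at its two ends, which
  are both \<open>x\<close>.\<close>

theorem no_loop:
  fixes Q :: "('v, 'e) pre_digraph"
    and I :: "('v \<times> 'e list \<Rightarrow> 'k::field) set"
  assumes Q: "fin_digraph Q"
    and I: "admissible_ideal Q I"
    and pd: "projective_dimension (bound_quiver_algebra Q I) (simple_module Q x) < \<infinity>"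
  shows "\<not> x \<rightarrow>\<^bsub>Q\<^esub> x"
proof
  assume "x \<rightarrow>\<^bsub>Q\<^esub> x"
  interpret Q: fin_digraph Q by fact
  obtain e where e: "e \<in> arcs Q" "tail Q e = x" "head Q e = x"
    using \<open>x \<rightarrow>\<^bsub>Q\<^esub> x\<close> by (auto simp: arcs_ends_def arc_to_ends_def)
  have x: "x \<in> verts Q" using e Q.tail_in_verts by blast
  obtain m where m: "arrow_ideal_power Q m \<subseteq> I" and idl: "ideal I (path_algebra Q)"
    and I2: "I \<subseteq> arrow_ideal_power Q 2"
    using I by (auto simp: admissible_ideal_def)
  let ?A = "bound_quiver_algebra Q I" and ?S = "simple_module Q x :: (('v \<times> 'e list \<Rightarrow> 'k) set, 'k) right_module"
  \<comment> \<open>Without such a resolution the infimum would be over the empty set, hence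
    infinite.\<close>
  obtain n P d \<epsilon> where res: "projective_resolution ?A ?S P d \<epsilon>"
    and fin: "\<And>i. i > n \<Longrightarrow> carrier (P i) = {\<zero>\<^bsub>P i\<^esub>}"
  proof (rule ccontr)
    assume "\<not> thesis"
    then have "{enat n |n. \<exists>P d \<epsilon>. projective_resolution ?A ?S P d \<epsilon> \<and>
        (\<forall>i>n. carrier (P i) = {\<zero>\<^bsub>P i\<^esub>})} = {}" using that by blast
    then have "projective_dimension ?A ?S = \<infinity>"
      unfolding projective_dimension_def by (simp only: Inf_empty top_enat_def)
    then show False using pd by simp
  qed
  let ?R = "carrier (path_algebra Q) :: ('v \<times> 'e list \<Rightarrow> 'k) set" and ?mul = "mult (path_algebra Q)"
    and ?un = "one (path_algebra Q) :: 'v \<times> 'e list \<Rightarrow> 'k"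
    and ?G = "{q \<in> quiver_paths Q. length (snd q) < m}" and ?cls = "\<lambda>r. I +>\<^bsub>path_algebra Q\<^esub> r"
    and ?eps = "\<lambda>f :: 'v \<times> 'e list \<Rightarrow> 'k. f (x, [])" and ?D = "\<lambda>f :: 'v \<times> 'e list \<Rightarrow> 'k. f (x, [e])"
    and ?a = "(\<lambda>q. if q = (x, [e]) then 1 else 0) :: 'v \<times> 'e list \<Rightarrow> 'k"
  interpret pa: ideal I "path_algebra Q" by (rule idl)
  interpret bound_algebra ?R ?mul ?un I ?G by (rule bound_quiver_bound_algebra[OF Q idl m])
  have aw: "pre_digraph.awlast Q x [] = x" "pre_digraph.awlast Q x [e] = x" using e by simp_all
  have vanish: "i (x, []) = 0" "i (x, [e]) = 0" if "i \<in> I" for i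
  proof -
    have h: "2 \<le> length p" if "i (u, p) \<noteq> 0" for u p
      using subsetD[OF I2 \<open>i \<in> I\<close>] that by (auto simp: arrow_ideal_power_def)
    show "i (x, []) = 0" "i (x, [e]) = 0" using h[of x "[]"] h[of x "[e]"] by auto
  qed
  have a: "?a \<in> ?R"
  proof (rule path_algebra_delta)
    have "Q.awalk x [e] x" using e x by (simp add: Q.awalk_def)
    then show "(x, [e]) \<in> quiver_paths Q" by (auto simp: quiver_paths_def)
  qed
  \<comment> \<open>Each multiplication by the arrow lengthens all paths by one; from length
    \<open>m\<close> on they lie in \<open>I\<close>.\<close>
  have nil: "((\<lambda>s. ?mul s ?a) ^^ k) r \<in> arrow_ideal_power Q k" if "r \<in> ?R" for r k
  proof (induction k)
    case 0
    then show ?case using that by (simp add: arrow_ideal_power_def)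
  next
    case (Suc k)
    let ?s = "((\<lambda>s. ?mul s ?a) ^^ k) r"
    have sR: "?s \<in> ?R" and s: "\<And>u p. ?s (u, p) \<noteq> 0 \<Longrightarrow> k \<le> length p"
      using Suc by (auto simp: arrow_ideal_power_def)
    have "Suc k \<le> length p" if nz: "?mul ?s ?a (u, p) \<noteq> 0" for u p
    proof -
      obtain i where i: "i \<le> length p"
        "?s (u, take i p) * ?a (pre_digraph.awlast Q u (take i p), drop i p) \<noteq> 0"
        using nz unfolding path_algebra_simps by (meson atMost_iff sum.not_neutral_contains_not_neutral)
      then have "drop i p = [e]" "k \<le> length (take i p)" using s[of u "take i p"] by (auto split: if_splits)
      then show ?thesis using i(1) by (metis Suc_le_mono add.commute append_take_drop_id length_Cons
            length_append list.size(3) plus_1_eq_Suc One_nat_def)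
    qed
    then show ?case using pa.m_closed[OF sR a] by (simp add: arrow_ideal_power_def)
  qed
  \<comment> \<open>The ring axioms for the quotient are part of the modules occurring in the
    resolution.\<close>
  have ringA: "ring ?A"
    using res by (simp add: projective_resolution_def fd_module_def right_module_def)
  note C = bound_quiver_cls[OF idl]
  interpret looped_presented_algebra ?R ?mul ?un I ?G ?eps ?D ?a ?A ?cls
  proof (intro looped_presented_algebra.intro looped_algebra.intro presented_algebra.intro
      looped_algebra_axioms.intro presented_algebra_axioms.intro bound_algebra_axioms ringA)
    show "\<exists>m. \<forall>r\<in>?R. ((\<lambda>s. ?mul s ?a) ^^ m) r \<in> I" using nil m by blast
    show "?un (x, []) = 1" "?un (x, [e]) = 0" using x by (simp_all add: path_algebra_def)
    show "?D (?mul r s) = ?eps r * ?D s + ?D r * ?eps s" for r s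
      using aw by (simp add: path_algebra_simps)
    show "?eps (?mul r s) = ?eps r * ?eps s" for r s using aw by (simp add: path_algebra_simps)
  qed (use C a vanish in \<open>auto simp: pointwise\<close>)
  have "(THE c. \<forall>f\<in>?cls r. f (x, []) = c) = r (x, [])" if "r \<in> ?R" for r
  proof (rule the_equality)
    have 0: "(0 :: 'v \<times> 'e list \<Rightarrow> 'k) \<in> I" using additive_subgroup.zero_closed[OF ideal.axioms(1)[OF idl]] by (simp add: path_algebra_simps)
    show "\<forall>f\<in>?cls r. f (x, []) = r (x, [])" using vanish by (auto simp: C(7) pointwise)
    have "r \<in> ?cls r" using 0 by (auto simp: C(7) intro!: exI[of _ 0])
    then show "c = r (x, [])" if "\<forall>f\<in>?cls r. f (x, []) = c" for c
      using bspec[OF that] by simp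
  qed
  then show False
    using no_finite_resolution[OF _ _ _ _ res fin] by (simp add: simple_module_def)
qed

theorem theorem1p1:
  fixes Q :: "('v, 'e) pre_digraph"
    and I :: "('v \<times> 'e list \<Rightarrow> 'k::alg_closed_field) set"
    and x :: 'v
  assumes "fin_digraph Q"
    and "admissible_ideal Q I"
    and "x \<in> verts Q"
    and "projective_dimension (bound_quiver_algebra Q I) (simple_module Q x) < \<infinity>"
    and "mild (neighborhood Q I x)"
  shows "\<not> x \<rightarrow>\<^bsub>Q\<^esub> x"
  using assms(1,2,4) by (rule no_loop)

end
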